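(* Let $d\ge 2$, $0<R_0<R_1<\infty$ and $0<s<R_1-R_0$, and let $\Omega_s=B_{R_1}(0)\setminus\overline{B_{R_0}(se_1)}\subset\mathbb{R}^d$. Let $u>0$ be an eigenfunction, corresponding to the first eigenvalue $\tau_1(s)$, of the mixed problem $$-\Delta u=\tau u\ \text{ in }\Omega_s,\qquad u=0\ \text{ on }\partial B_{R_0}(se_1),\qquad \frac{\partial u}{\partial n}=0\ \text{ on }\partial B_{R_1}(0).$$ Then $u$ is strictly increasing along all the affine-radial directions from $se_1$ in $\Omega_s$; more precisely, $$\nabla u(x)\cdot(x-se_1)>0\quad\text{for } x\in\overline{\Omega_s}\setminus\{\pm R_1e_1\}.$$
   Context: $B_r(z)$ is the open ball in $\mathbb{R}^d$ with center $z$ and radius $r$; $e_1=(1,0,\dots,0)$; $n$ is the unit outward normal to $\Omega_s$. With $\Gamma_D=\partial B_{R_0}(se_1)$ and $H^1_{\Gamma_D}(\Omega_s)=\{u\in H^1(\Omega_s): u|_{\Gamma_D}=0\text{ in the trace sense}\}$, a real $\tau$ is an eigenvalue with eigenfunction $u\in H^1_{\Gamma_D}(\Omega_s)\setminus\{0\}$ if $\int_{\Omega_s}\nabla u\cdot\nabla\varphi\,dx=\tau\int_{\Omega_s}u\varphi\,dx$ for all $\varphi\in H^1_{\Gamma_D}(\Omega_s)$. The first eigenvalue is $\tau_1(s)=\inf\{\int_{\Omega_s}|\nabla\phi|^2dx:\phi\in H^1_{\Gamma_D}(\Omega_s),\ \int_{\Omega_s}\phi^2dx=1\}$; it is simple.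 Eigenfunctions are identified with their representatives in $C^2(\Omega_s)\cap C^1(\overline{\Omega_s})$, so that $\nabla u$ is defined on $\overline{\Omega_s}$; "$u>0$" means $u>0$ in $\Omega_s$. *)

theory Defs
  imports "HOL-Analysis.Analysis"
begin

definition grad :: "('a::euclidean_space \<Rightarrow> real) \<Rightarrow> 'a \<Rightarrow> 'a" where
  "grad f x = (THE D. GDERIV f x :> D)"

text \<open>\<open>C_k_on k f S\<close> is meant for open \<open>S\<close>: all partial derivatives of order at most \<open>k\<close> exist
  and are continuous on \<open>S\<close>.\<close>

primrec C_k_on :: "nat \<Rightarrow> ('a::euclidean_space \<Rightarrow> real) \<Rightarrow> 'a set \<Rightarrow> bool" where
  "C_k_on 0 f S \<longleftrightarrow> continuous_on S f"
| "C_k_on (Suc k) f S \<longleftrightarrow>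
     (\<forall>x\<in>S. f differentiable (at x)) \<and> (\<forall>b\<in>Basis. C_k_on k (\<lambda>x. grad f x \<bullet> b) S)"

text \<open>The space $C^1(\overline\Omega)$, for open \<open>\<Omega>\<close>: the function is continuous on the closure and
  its gradient extends continuously from \<open>\<Omega>\<close> to the closure. That extension, the meaning of the
  gradient at boundary points, is \<open>grad_closure \<Omega> f\<close>; on \<open>\<Omega>\<close> it agrees with \<open>grad f\<close>.\<close>

definition C1_closure :: "'a::euclidean_space set \<Rightarrow> ('a \<Rightarrow> real) set" where
  "C1_closure \<Omega> = {f. continuous_on (closure \<Omega>) f \<and> (\<forall>x\<in>\<Omega>. f differentiable (at x)) \<and>
     (\<exists>G. continuous_on (closure \<Omega>) G \<and> (\<forall>x\<in>\<Omega>. G x = grad f x))}"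

definition grad_closure :: "'a::euclidean_space set \<Rightarrow> ('a \<Rightarrow> real) \<Rightarrow> 'a \<Rightarrow> 'a" where
  "grad_closure \<Omega> f x = Lim (at x within \<Omega>) (grad f)"

text \<open>Elements of function spaces are functions on the whole type, of which only the values on
  \<open>\<Omega>\<close> matter; equality almost everywhere on \<open>\<Omega>\<close> is not divided out.\<close>

definition L2_on :: "'a measure \<Rightarrow> 'a set \<Rightarrow> ('a \<Rightarrow> 'b::euclidean_space) set" where
  "L2_on M A = {f. set_borel_measurable M A f \<and> set_integrable M A (\<lambda>x. (norm (f x))\<^sup>2)}"

definition test_functions :: "'a::euclidean_space set \<Rightarrow> ('a \<Rightarrow> real) set" where
  "test_functions \<Omega> = {\<phi>. (\<forall>k. C_k_on k \<phi> UNIV) \<and>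
     compact (closure {x. \<phi> x \<noteq> 0}) \<and> closure {x. \<phi> x \<noteq> 0} \<subseteq> \<Omega>}"

definition has_weak_gradient ::
    "'a::euclidean_space set \<Rightarrow> ('a \<Rightarrow> real) \<Rightarrow> ('a \<Rightarrow> 'a) \<Rightarrow> bool" where
  "has_weak_gradient \<Omega> u g \<longleftrightarrow> g \<in> L2_on lebesgue \<Omega> \<and>
     (\<forall>\<phi>\<in>test_functions \<Omega>.
        (LINT x:\<Omega>|lebesgue. u x *\<^sub>R grad \<phi> x) = - (LINT x:\<Omega>|lebesgue. \<phi> x *\<^sub>R g x))"

definition H1 :: "'a::euclidean_space set \<Rightarrow> ('a \<Rightarrow> real) set" where
  "H1 \<Omega> = {u. u \<in> L2_on lebesgue \<Omega> \<and> (\<exists>g. has_weak_gradient \<Omega> u g)}"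

text \<open>The weak gradient is determined up to a null subset of \<open>\<Omega>\<close>; one version is chosen.\<close>

definition wgrad :: "'a::euclidean_space set \<Rightarrow> ('a \<Rightarrow> real) \<Rightarrow> 'a \<Rightarrow> 'a" where
  "wgrad \<Omega> u = (SOME g. has_weak_gradient \<Omega> u g)"

definition H1_dist_sq :: "'a::euclidean_space set \<Rightarrow> ('a \<Rightarrow> real) \<Rightarrow> ('a \<Rightarrow> real) \<Rightarrow> real" where
  "H1_dist_sq \<Omega> u v = (LINT x:\<Omega>|lebesgue. (u x - v x)\<^sup>2) +
     (LINT x:\<Omega>|lebesgue. (norm (wgrad \<Omega> u x - wgrad \<Omega> v x))\<^sup>2)"

text \<open>Surface measure on the sphere of radius \<open>r > 0\<close> about \<open>c\<close>, from integration in polar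
  coordinates: with $d$ the dimension, the measure of \<open>A\<close> is $d\,r^{d-1}$ times the volume of the
  part of the unit ball projected radially onto \<open>A\<close>.\<close>

definition sphere_measure :: "'a::euclidean_space \<Rightarrow> real \<Rightarrow> 'a measure" where
  "sphere_measure c r = scale_measure (ennreal (real DIM('a) * r ^ (DIM('a) - 1)))
     (distr (restrict_space lborel (ball 0 1)) borel (\<lambda>x. c + r *\<^sub>R sgn x))"

text \<open>The trace operator is the continuous extension to $H^1(\Omega)$ of the restriction map
  $C^1(\overline\Omega) \to L^2(\Gamma)$, where \<open>\<Gamma>\<close> is here a sphere contained in the boundary
  of \<open>\<Omega>\<close>.\<close>

definition has_trace_on_sphere ::
    "'a::euclidean_space set \<Rightarrow> 'a \<Rightarrow> real \<Rightarrow> ('a \<Rightarrow> real) \<Rightarrow> ('a \<Rightarrow> real) \<Rightarrow> bool" where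
  "has_trace_on_sphere \<Omega> c r u f \<longleftrightarrow> f \<in> L2_on (sphere_measure c r) (sphere c r) \<and>
     (\<exists>\<phi>. (\<forall>n::nat. \<phi> n \<in> C1_closure \<Omega> \<inter> H1 \<Omega>) \<and>
          (\<lambda>n. H1_dist_sq \<Omega> (\<phi> n) u) \<longlonglongrightarrow> 0 \<and>
          (\<lambda>n. LINT x:sphere c r|sphere_measure c r. (\<phi> n x - f x)\<^sup>2) \<longlonglongrightarrow> 0)"

definition H1_zero_on_sphere :: "'a::euclidean_space set \<Rightarrow> 'a \<Rightarrow> real \<Rightarrow> ('a \<Rightarrow> real) set" where
  "H1_zero_on_sphere \<Omega> c r = {u \<in> H1 \<Omega>. has_trace_on_sphere \<Omega> c r u (\<lambda>_. 0)}"

definition annular_domain :: "real \<Rightarrow> real \<Rightarrow> 'a::euclidean_space \<Rightarrow> 'a set" where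
  "annular_domain R0 R1 c = ball 0 R1 - closure (ball c R0)"

text \<open>Dirichlet condition on \<open>sphere c R0\<close>; the Neumann condition on \<open>sphere 0 R1\<close> is the
  natural boundary condition of the weak formulation.\<close>

definition mixed_eigenfunction ::
    "real \<Rightarrow> real \<Rightarrow> 'a::euclidean_space \<Rightarrow> real \<Rightarrow> ('a \<Rightarrow> real) \<Rightarrow> bool" where
  "mixed_eigenfunction R0 R1 c \<tau> u \<longleftrightarrow>
     (let \<Omega> = annular_domain R0 R1 c; V = H1_zero_on_sphere \<Omega> c R0 in
       u \<in> V \<and> \<not> (AE x in lebesgue. x \<in> \<Omega> \<longrightarrow> u x = 0) \<and>
       (\<forall>\<phi>\<in>V. (LINT x:\<Omega>|lebesgue. wgrad \<Omega> u x \<bullet> wgrad \<Omega> \<phi> x) =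
               \<tau> * (LINT x:\<Omega>|lebesgue. u x * \<phi> x)))"

definition first_mixed_eigenvalue :: "real \<Rightarrow> real \<Rightarrow> 'a::euclidean_space \<Rightarrow> real" where
  "first_mixed_eigenvalue R0 R1 c =
     (let \<Omega> = annular_domain R0 R1 c; V = H1_zero_on_sphere \<Omega> c R0 in
       Inf {LINT x:\<Omega>|lebesgue. (norm (wgrad \<Omega> \<phi> x))\<^sup>2 | \<phi>.
              \<phi> \<in> V \<and> (LINT x:\<Omega>|lebesgue. (\<phi> x)\<^sup>2) = 1})"

end

theory Submission
  imports Defs
begin

text \<open>Let \<open>c = s e1\<close> and \<open>w x = grad u x \<bullet> (x - c)\<close>. Since \<open>u > 0\<close> solves \<open>- \<Delta> u = \<tau> u\<close> and
  \<open>- \<Delta> w = \<tau> w + 2 \<tau> u\<close>, the quotient \<open>w / u\<close> has no interior minimum. It tends to infinity at the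
  inner sphere by Hopf's argument, and on the outer sphere the Neumann condition gives
  \<open>w = - s (grad u \<bullet> e1)\<close>. The sign of this quantity comes from reflections in hyperplanes through the
  origin with normal \<open>a\<close>, \<open>a \<bullet> e1 > 0\<close>: the difference \<open>v\<close> of the reflected function and \<open>u\<close> is
  nonnegative on the half domain \<open>a \<bullet> x > 0\<close>, by the minimum principle for \<open>v / u\<close>, and it dominates a
  multiple of \<open>(a \<bullet> x) exp (- \<alpha> \<bar>x - c\<bar>\<^sup>2)\<close>, which gives a strict normal derivative along the
  hyperplane up to the outer sphere.

  The classical equation, the Neumann condition and the vanishing of \<open>u\<close> on the inner sphere are
  recovered from the weak formulation by testing with smooth bumps, with cutoffs
  concentrating at the outer sphere, and by a trace inequality, respectively.\<close>

section \<open>Laplacians and the minimum principle\<close>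

text \<open>Since \<tau> is not small, the operator \<open>- \<Delta> - \<tau>\<close> has no
  minimum principle of its own. As long as the sign of a difference is unknown, a multiple
  \<open>m * u\<close> is therefore subtracted, with \<open>m\<close> the minimum of the quotient by
  \<open>u\<close>: the result vanishes at the minimum point (up to a small error in the last step),
  and the zeroth order term with it. The obstacle is the inner sphere, where \<open>u\<close>
  vanishes and the quotients become 0 / 0. It is met by splitting off from \<open>u\<close> the
  factor \<open>(norm (x - c))^2 - R0^2\<close>; by Hopf's lemma the other factor is positive up to
  the boundary. Reflecting the half that contains \<open>c\<close> moves its points away from
  \<open>c\<close>, so it stays in the region and enlarges exactly the factor split off. The last
  step needs \<open>0 < \<tau>\<close>, because the source \<open>2 * \<tau> * u\<close> is what
  forbids an interior minimum. If \<tau> were 0, the energy identity would annihilate the gradient,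
  against Hopf's lemma.\<close>

text \<open>The gradient \<open>F\<close> is a parameter, so that the rules below compute it along
  with the Laplacian and so that it may be the continuous extension of a gradient to a closed set.
  Second derivatives enter only through the derivative of \<open>F\<close> at \<open>x\<close>,
  whose trace is \<open>L\<close>.\<close>

definition has_laplacian :: "('a::euclidean_space \<Rightarrow> real) \<Rightarrow> ('a \<Rightarrow> 'a) \<Rightarrow> real \<Rightarrow> 'a \<Rightarrow> bool" where
  "has_laplacian f F L x \<longleftrightarrow> (\<forall>\<^sub>F y in nhds x. GDERIV f y :> F y) \<and>
     (\<exists>H. (F has_derivative H) (at x) \<and> (\<Sum>b\<in>Basis. H b \<bullet> b) = L)"

lemma has_laplacian_subst:
  "has_laplacian f F L x \<Longrightarrow> f = f' \<Longrightarrow> F = F' \<Longrightarrow> L = L' \<Longrightarrow> has_laplacian f' F' L' x"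
  by simp

lemma has_laplacian_imp_GDERIV: "has_laplacian f F L x \<Longrightarrow> GDERIV f x :> F x"
  unfolding has_laplacian_def by (meson eventually_nhds_x_imp_x)

lemma has_laplacian_const: "has_laplacian (\<lambda>x. k) (\<lambda>x. 0) 0 x"
  unfolding has_laplacian_def
  by (auto intro!: GDERIV_const always_eventually exI[of _ "\<lambda>x. 0"])

lemma has_laplacian_inner: "has_laplacian (\<lambda>x. a \<bullet> x) (\<lambda>x. a) 0 x"
  unfolding has_laplacian_def gderiv_def
  by (auto intro!: always_eventually exI[of _ "\<lambda>x. 0"] derivative_eq_intros simp: inner_commute)

lemma has_laplacian_add:
  assumes "has_laplacian f F L x" "has_laplacian g G M x"
  shows "has_laplacian (\<lambda>x. f x + g x) (\<lambda>x. F x + G x) (L + M) x"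
proof -
  from assms obtain H K where "(F has_derivative H) (at x)" "(\<Sum>b\<in>Basis. H b \<bullet> b) = L"
    "(G has_derivative K) (at x)" "(\<Sum>b\<in>Basis. K b \<bullet> b) = M"
    unfolding has_laplacian_def by blast
  moreover have "\<forall>\<^sub>F y in nhds x. GDERIV (\<lambda>x. f x + g x) y :> F y + G y"
    using assms[unfolded has_laplacian_def, THEN conjunct1]
    by eventually_elim (rule GDERIV_add)
  ultimately show ?thesis
    unfolding has_laplacian_def
    by (auto intro!: exI[of _ "\<lambda>h. H h + K h"] derivative_eq_intros simp: inner_add_left sum.distrib)
qed

lemma has_laplacian_mult:
  assumes "has_laplacian f F L x" "has_laplacian g G M x"
  shows "has_laplacian (\<lambda>x. f x * g x) (\<lambda>x. f x *\<^sub>R G x + g x *\<^sub>R F x)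
           (f x * M + g x * L + 2 * (F x \<bullet> G x)) x"
proof -
  from assms obtain H K where H: "(F has_derivative H) (at x)" "(\<Sum>b\<in>Basis. H b \<bullet> b) = L"
    and K: "(G has_derivative K) (at x)" "(\<Sum>b\<in>Basis. K b \<bullet> b) = M"
    unfolding has_laplacian_def by blast
  have ev: "\<forall>\<^sub>F y in nhds x. GDERIV (\<lambda>x. f x * g x) y :> f y *\<^sub>R G y + g y *\<^sub>R F y"
    using assms[unfolded has_laplacian_def, THEN conjunct1]
    by eventually_elim (rule GDERIV_mult)
  have fg: "(f has_derivative (\<lambda>h. h \<bullet> F x)) (at x)" "(g has_derivative (\<lambda>h. h \<bullet> G x)) (at x)"
    using assms[THEN has_laplacian_imp_GDERIV] unfolding gderiv_def by auto
  let ?T = "\<lambda>h. f x *\<^sub>R K h + (h \<bullet> F x) *\<^sub>R G x + (g x *\<^sub>R H h + (h \<bullet> G x) *\<^sub>R F x)"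
  have D: "((\<lambda>x. f x *\<^sub>R G x + g x *\<^sub>R F x) has_derivative ?T) (at x)"
    using H(1) K(1) fg by (auto intro!: derivative_eq_intros)
  have "(\<Sum>b\<in>Basis. ?T b \<bullet> b) = f x * (\<Sum>b\<in>Basis. K b \<bullet> b) + g x * (\<Sum>b\<in>Basis. H b \<bullet> b)
      + 2 * (\<Sum>b\<in>Basis. (F x \<bullet> b) * (G x \<bullet> b))"
    by (simp add: inner_add_left sum.distrib sum_distrib_left inner_commute algebra_simps)
  also have "(\<Sum>b\<in>Basis. (F x \<bullet> b) * (G x \<bullet> b)) = F x \<bullet> G x"
    by (rule euclidean_inner[symmetric])
  finally show ?thesis
    using ev D H(2) K(2) unfolding has_laplacian_def by auto
qed

lemma has_laplacian_cmult:
  "has_laplacian f F L x \<Longrightarrow> has_laplacian (\<lambda>x. k * f x) (\<lambda>x. k *\<^sub>R F x) (k * L) x"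
  by (rule has_laplacian_subst[OF has_laplacian_mult[OF has_laplacian_const]]) auto

lemma has_laplacian_diff:
  assumes "has_laplacian f F L x" "has_laplacian g G M x"
  shows "has_laplacian (\<lambda>x. f x - g x) (\<lambda>x. F x - G x) (L - M) x"
  by (rule has_laplacian_subst[OF has_laplacian_add[OF assms(1) has_laplacian_cmult[OF assms(2), of "-1"]]])
     auto

lemma has_laplacian_dist_sq:
  fixes p :: "'a::euclidean_space"
  shows "has_laplacian (\<lambda>x. (norm (x - p))\<^sup>2) (\<lambda>x. 2 *\<^sub>R (x - p)) (2 * DIM('a)) x"
  unfolding has_laplacian_def gderiv_def power2_norm_eq_inner
  by (auto intro!: always_eventually exI[of _ "\<lambda>h. 2 *\<^sub>R h"] derivative_eq_intros
      simp: inner_commute algebra_simps sum_distrib_left[symmetric] inner_Basis)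

lemma has_laplacian_compose:
  fixes f :: "'a::euclidean_space \<Rightarrow> real"
  assumes f: "has_laplacian f F L x"
    and \<phi>: "\<And>t. (\<phi> has_real_derivative \<phi>' t) (at t)" "(\<phi>' has_real_derivative \<phi>'') (at (f x))"
  shows "has_laplacian (\<lambda>x. \<phi> (f x)) (\<lambda>x. \<phi>' (f x) *\<^sub>R F x)
           (\<phi>' (f x) * L + \<phi>'' * (F x \<bullet> F x)) x"
proof -
  from f obtain H where H: "(F has_derivative H) (at x)" "(\<Sum>b\<in>Basis. H b \<bullet> b) = L"
    unfolding has_laplacian_def by blast
  have ev: "\<forall>\<^sub>F y in nhds x. GDERIV (\<lambda>x. \<phi> (f x)) y :> \<phi>' (f y) *\<^sub>R F y"
    using f unfolding has_laplacian_def
    by (auto elim!: eventually_mono intro: GDERIV_DERIV_compose[OF _ \<phi>(1)])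
  have "(f has_derivative (\<lambda>h. h \<bullet> F x)) (at x)"
    using f[THEN has_laplacian_imp_GDERIV] unfolding gderiv_def by auto
  from has_derivative_compose[OF this \<phi>(2)[unfolded has_field_derivative_def]]
  have fd: "((\<lambda>x. \<phi>' (f x)) has_derivative (\<lambda>h. \<phi>'' * (h \<bullet> F x))) (at x)" .
  let ?T = "\<lambda>h. \<phi>' (f x) *\<^sub>R H h + (\<phi>'' * (h \<bullet> F x)) *\<^sub>R F x"
  have D: "((\<lambda>x. \<phi>' (f x) *\<^sub>R F x) has_derivative ?T) (at x)"
    using H(1) fd by (auto intro!: derivative_eq_intros)
  have "(\<Sum>b\<in>Basis. ?T b \<bullet> b) = \<phi>' (f x) * (\<Sum>b\<in>Basis. H b \<bullet> b)
      + \<phi>'' * (\<Sum>b\<in>Basis. (F x \<bullet> b) * (F x \<bullet> b))"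
    by (simp add: inner_add_left sum.distrib sum_distrib_left inner_commute algebra_simps)
  also have "(\<Sum>b\<in>Basis. (F x \<bullet> b) * (F x \<bullet> b)) = F x \<bullet> F x"
    by (rule euclidean_inner[symmetric])
  finally show ?thesis
    using ev D H(2) unfolding has_laplacian_def by auto
qed

text \<open>For \<open>\<alpha> > 0\<close> this Laplacian is positive exactly where
  \<open>2 * \<alpha> * (norm (x - p))^2\<close> exceeds the dimension. Both barrier arguments take
  \<alpha> so large that this holds with room to spare.\<close>

lemma has_laplacian_gaussian:
  fixes p :: "'a::euclidean_space" and \<alpha> :: real
  shows "has_laplacian (\<lambda>x. exp (- \<alpha> * (norm (x - p))\<^sup>2))
    (\<lambda>x. (- 2 * \<alpha> * exp (- \<alpha> * (norm (x - p))\<^sup>2)) *\<^sub>R (x - p))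
    (exp (- \<alpha> * (norm (x - p))\<^sup>2) * (4 * \<alpha>\<^sup>2 * (norm (x - p))\<^sup>2 - 2 * DIM('a) * \<alpha>)) x"
proof -
  let ?r = "(norm (x - p))\<^sup>2"
  have 1: "((\<lambda>t. exp (- \<alpha> * t)) has_real_derivative - \<alpha> * exp (- \<alpha> * t)) (at t)" for t :: real
    by (auto intro!: derivative_eq_intros)
  have 2: "((\<lambda>t. - \<alpha> * exp (- \<alpha> * t)) has_real_derivative \<alpha>\<^sup>2 * exp (- \<alpha> * t)) (at t)" for t :: real
    by (auto intro!: derivative_eq_intros simp: power2_eq_square)
  show ?thesis
    by (rule has_laplacian_subst[OF has_laplacian_compose[OF has_laplacian_dist_sq 1 2]])
       (simp_all add: dot_square_norm, simp_all add: power2_eq_square ring_distribs mult_ac)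
qed

text \<open>Dilating a solution about \<open>c\<close> replaces \<tau> by
  \<open>t^2 * \<tau>\<close>. Differentiated at \<open>t = 1\<close>, this factor produces the
  source \<open>2 * \<tau> * u\<close> in the equation of the radial derivative.\<close>

lemma has_laplacian_dilation:
  assumes f: "has_laplacian f F L (c + t *\<^sub>R (x - c))"
  shows "has_laplacian (\<lambda>x. f (c + t *\<^sub>R (x - c))) (\<lambda>x. t *\<^sub>R F (c + t *\<^sub>R (x - c))) (t\<^sup>2 * L) x"
proof -
  let ?A = "\<lambda>x. c + t *\<^sub>R (x - c)"
  from f obtain H where H: "(F has_derivative H) (at (?A x))" "(\<Sum>b\<in>Basis. H b \<bullet> b) = L"
    unfolding has_laplacian_def by blast
  have A: "(?A has_derivative (\<lambda>h. t *\<^sub>R h)) (at y)" for y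
    by (auto intro!: derivative_eq_intros)
  have "(?A \<longlongrightarrow> ?A x) (nhds x)"
    by (intro tendsto_intros filterlim_ident)
  then have "\<forall>\<^sub>F y in nhds x. GDERIV f (?A y) :> F (?A y)"
    using f unfolding has_laplacian_def filterlim_iff by blast
  then have ev: "\<forall>\<^sub>F y in nhds x. GDERIV (\<lambda>x. f (?A x)) y :> t *\<^sub>R F (?A y)"
  proof (rule eventually_mono)
    fix y assume "GDERIV f (?A y) :> F (?A y)"
    from has_derivative_compose[OF A this[unfolded gderiv_def]]
    show "GDERIV (\<lambda>x. f (?A x)) y :> t *\<^sub>R F (?A y)" unfolding gderiv_def by simp
  qed
  interpret H: bounded_linear H by (rule has_derivative_bounded_linear[OF H(1)])
  have "((\<lambda>x. t *\<^sub>R F (?A x)) has_derivative (\<lambda>h. t *\<^sub>R H (t *\<^sub>R h))) (at x)"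
    by (intro derivative_intros has_derivative_compose[OF A H(1)])
  moreover have "(\<Sum>b\<in>Basis. (t *\<^sub>R H (t *\<^sub>R b)) \<bullet> b) = t\<^sup>2 * L"
    by (simp add: H.scaleR sum_distrib_left H(2)[symmetric] power2_eq_square mult.assoc)
  ultimately show ?thesis using ev unfolding has_laplacian_def by blast
qed

definition reflect :: "'a::real_inner \<Rightarrow> 'a \<Rightarrow> 'a" where
  "reflect a x = x - (2 * (a \<bullet> x)) *\<^sub>R a"

text \<open>The new gradient has derivative \<open>A H A\<close> with \<open>A\<close> the
  reflection, and conjugation with an orthogonal involution keeps the trace.\<close>

lemma has_laplacian_reflection:
  fixes a :: "'a::euclidean_space"
  assumes a: "norm a = 1" and f: "has_laplacian f F L (reflect a x)"
  shows "has_laplacian (\<lambda>x. f (reflect a x)) (\<lambda>x. reflect a (F (reflect a x))) L x"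
proof -
  from f obtain H where H: "(F has_derivative H) (at (reflect a x))" "(\<Sum>b\<in>Basis. H b \<bullet> b) = L"
    unfolding has_laplacian_def by blast
  have A: "(reflect a has_derivative reflect a) (at y)" for y
    unfolding reflect_def[abs_def] by (auto intro!: derivative_eq_intros)
  have "(reflect a \<longlongrightarrow> reflect a x) (nhds x)"
    unfolding reflect_def by (intro tendsto_intros filterlim_ident)
  then have "\<forall>\<^sub>F y in nhds x. GDERIV f (reflect a y) :> F (reflect a y)"
    using f unfolding has_laplacian_def filterlim_iff by blast
  then have ev: "\<forall>\<^sub>F y in nhds x. GDERIV (\<lambda>x. f (reflect a x)) y :> reflect a (F (reflect a y))"
  proof (rule eventually_mono)
    fix y assume "GDERIV f (reflect a y) :> F (reflect a y)"
    from has_derivative_compose[OF A this[unfolded gderiv_def]]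
    show "GDERIV (\<lambda>x. f (reflect a x)) y :> reflect a (F (reflect a y))"
      unfolding gderiv_def by (simp add: reflect_def inner_diff_left inner_diff_right inner_commute algebra_simps)
  qed
  interpret H: bounded_linear H by (rule has_derivative_bounded_linear[OF H(1)])
  have "((\<lambda>x. F (reflect a x)) has_derivative (\<lambda>h. H (reflect a h))) (at x)"
    by (intro has_derivative_compose[OF A H(1)])
  from has_derivative_compose[OF this A]
  have "((\<lambda>x. reflect a (F (reflect a x))) has_derivative (\<lambda>h. reflect a (H (reflect a h)))) (at x)" .
  moreover have "(\<Sum>b\<in>Basis. reflect a (H (reflect a b)) \<bullet> b) = L"
  proof -
    have 1: "(\<Sum>b\<in>Basis. (a \<bullet> b) * (v \<bullet> b)) = a \<bullet> v" for v
      by (rule euclidean_inner[symmetric])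
    have 2: "(\<Sum>b\<in>Basis. (a \<bullet> b) * (a \<bullet> H b)) = a \<bullet> H a"
    proof -
      have "H a = H (\<Sum>b\<in>Basis. (a \<bullet> b) *\<^sub>R b)" by (simp add: euclidean_representation)
      then show ?thesis by (simp add: H.sum H.scaleR inner_sum_right)
    qed
    have aa: "a \<bullet> a = 1" using a by (simp add: norm_eq_1)
    \<comment> \<open>As \<open>a\<close> is a unit vector, the three corrections are -2, -2 and 4
      times \<open>a \<bullet> H a\<close> and cancel.\<close>
    have "(\<Sum>b\<in>Basis. reflect a (H (reflect a b)) \<bullet> b) = (\<Sum>b\<in>Basis. H b \<bullet> b)
       - 2 * (\<Sum>b\<in>Basis. (a \<bullet> b) * (H a \<bullet> b)) - 2 * (\<Sum>b\<in>Basis. (a \<bullet> b) * (a \<bullet> H b))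
       + 4 * (a \<bullet> H a) * (\<Sum>b\<in>Basis. (a \<bullet> b) * (a \<bullet> b))"
      by (simp add: reflect_def H.diff H.scaleR inner_diff_left inner_diff_right sum.distrib
          sum_subtractf sum_distrib_left algebra_simps)
    then show ?thesis unfolding 1 2 aa using H(2) by simp
  qed
  ultimately show ?thesis using ev unfolding has_laplacian_def by blast
qed

section \<open>Derivatives along segments: second-order test at a minimum and one-sided derivatives
  at the boundary\<close>

lemma GDERIV_along_line:
  assumes "GDERIV f (x + t *\<^sub>R d) :> D"
  shows "((\<lambda>t. f (x + t *\<^sub>R d)) has_real_derivative D \<bullet> d) (at t)"
proof -
  have A: "((\<lambda>t. x + t *\<^sub>R d) has_derivative (\<lambda>h. h *\<^sub>R d)) (at t)"
    by (auto intro!: derivative_eq_intros)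
  from has_derivative_compose[OF A assms[unfolded gderiv_def]] show ?thesis
    unfolding has_field_derivative_def
    by (rule has_derivative_eq_rhs) (auto simp: fun_eq_iff inner_commute mult.commute)
qed

text \<open>A negative trace has a negative diagonal entry. In that basis direction the slope of
  \<open>f\<close> is 0 at \<open>x\<close> and, by differentiability of \<open>F\<close> at the
  single point \<open>x\<close>, negative just beyond it; the mean value theorem then contradicts
  minimality.\<close>

lemma laplacian_nonneg_at_min:
  assumes f: "has_laplacian f F L x" and m: "\<forall>\<^sub>F y in nhds x. f x \<le> f y"
  shows "0 \<le> L"
proof (rule ccontr)
  assume "\<not> 0 \<le> L"
  from f obtain H where H: "(F has_derivative H) (at x)" "(\<Sum>b\<in>Basis. H b \<bullet> b) = L"
    unfolding has_laplacian_def by blast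
  then have "\<exists>b\<in>Basis. H b \<bullet> b < 0"
    using \<open>\<not> 0 \<le> L\<close> by (meson not_le sum_nonneg)
  then obtain b where b: "b \<in> Basis" "H b \<bullet> b < 0" by blast
  have "\<forall>\<^sub>F y in nhds x. GDERIV f y :> F y \<and> f x \<le> f y"
    using f m unfolding has_laplacian_def by (auto intro: eventually_conj)
  then obtain e where e: "e > 0" "\<And>y. dist y x < e \<Longrightarrow> GDERIV f y :> F y \<and> f x \<le> f y"
    unfolding eventually_nhds_metric by blast
  define g where "g t = f (x + t *\<^sub>R b)" for t
  have nb: "norm b = 1" using b by simp
  have g: "(g has_real_derivative F (x + t *\<^sub>R b) \<bullet> b) (at t)" if "\<bar>t\<bar> < e" for t
    unfolding g_def using that nb
    by (intro GDERIV_along_line e(2)[THEN conjunct1]) (simp add: dist_norm)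
  have gmin: "g 0 \<le> g t" if "\<bar>t\<bar> < e" for t
    unfolding g_def using e(2)[of "x + t *\<^sub>R b"] that nb by (simp add: dist_norm)
  have g0: "F x \<bullet> b = 0"
    using DERIV_local_min[OF g[of 0] e(1)] e(1) gmin by auto
  have A: "((\<lambda>t. x + t *\<^sub>R b) has_derivative (\<lambda>h. h *\<^sub>R b)) (at 0)"
    by (auto intro!: derivative_eq_intros)
  have "((\<lambda>t. F (x + t *\<^sub>R b)) has_derivative (\<lambda>h. H (h *\<^sub>R b))) (at 0)"
    by (rule has_derivative_compose[OF A]) (use H(1) in simp)
  then have "((\<lambda>t. F (x + t *\<^sub>R b) \<bullet> b) has_derivative (\<lambda>h. H (h *\<^sub>R b) \<bullet> b)) (at 0)"
    by (auto intro!: derivative_eq_intros)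
  then have "((\<lambda>t. F (x + t *\<^sub>R b) \<bullet> b) has_real_derivative (H b \<bullet> b)) (at 0)"
    unfolding has_field_derivative_def
    by (rule has_derivative_eq_rhs)
       (auto simp: fun_eq_iff linear_cmul[OF bounded_linear.linear[OF has_derivative_bounded_linear[OF H(1)]]])
  from DERIV_neg_dec_right[OF this b(2)] obtain d where
    d: "d > 0" "\<And>h. 0 < h \<Longrightarrow> h < d \<Longrightarrow> F (x + h *\<^sub>R b) \<bullet> b < 0"
    using g0 by auto
  define h where "h = min d e / 2"
  have h: "0 < h" "h < d" "h < e" using d(1) e(1) by (auto simp: h_def)
  have "\<exists>z. 0 < z \<and> z < h \<and> g h - g 0 = (h - 0) * (F (x + z *\<^sub>R b) \<bullet> b)"
    by (rule MVT2) (use h g in auto)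
  then obtain z where z: "0 < z" "z < h" "g h - g 0 = h * (F (x + z *\<^sub>R b) \<bullet> b)" by auto
  have "F (x + z *\<^sub>R b) \<bullet> b < 0" using d(2)[of z] z h by auto
  then have "g h < g 0" using z(3) h(1) by (smt (verit) mult_pos_neg)
  then show False using gmin[of h] h by auto
qed

text \<open>At a boundary point \<open>F\<close> is merely a continuous extension of the gradient;
  l'Hospital's rule carries the derivative along the open segment over to its endpoint.\<close>

lemma one_sided_derivative:
  fixes f :: "'a::real_inner \<Rightarrow> real"
  assumes f: "continuous_on K f" and F: "continuous_on K F" and y: "y \<in> K" and t0: "0 < t0"
    and seg: "\<And>t. 0 < t \<Longrightarrow> t \<le> t0 \<Longrightarrow> y + t *\<^sub>R d \<in> K \<and> GDERIV f (y + t *\<^sub>R d) :> F (y + t *\<^sub>R d)"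
  shows "((\<lambda>t. (f (y + t *\<^sub>R d) - f y) / t) \<longlongrightarrow> F y \<bullet> d) (at_right 0)"
proof (rule lhopital_right_0[where f' = "\<lambda>t. F (y + t *\<^sub>R d) \<bullet> d" and g' = "\<lambda>t. 1"])
  have ev: "\<forall>\<^sub>F t in at_right 0. 0 < t \<and> t \<le> t0"
    using eventually_at_right_less[of 0] eventually_at_right[OF t0]
    by (auto intro!: exI[of _ t0] t0 simp: eventually_at_right_field)
  have line: "((\<lambda>t. y + t *\<^sub>R d) \<longlongrightarrow> y) (at_right 0)"
    by (auto intro!: tendsto_eq_intros)
  have inK: "\<forall>\<^sub>F t in at_right 0. y + t *\<^sub>R d \<in> K"
    using ev by eventually_elim (use seg in auto)
  have lim: "((\<lambda>t. g (y + t *\<^sub>R d)) \<longlongrightarrow> g y) (at_right 0)" if "continuous_on K g" for g :: "'a \<Rightarrow> 'b::topological_space"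
    by (rule continuous_on_tendsto_compose[OF that line y inK])
  show "((\<lambda>t. f (y + t *\<^sub>R d) - f y) \<longlongrightarrow> 0) (at_right 0)"
    using lim[OF f] by (simp add: LIM_zero)
  show "((\<lambda>t. F (y + t *\<^sub>R d) \<bullet> d / 1) \<longlongrightarrow> F y \<bullet> d) (at_right 0)"
    using lim[OF F] by (auto intro!: tendsto_intros)
  show "\<forall>\<^sub>F t in at_right 0. ((\<lambda>t. f (y + t *\<^sub>R d) - f y) has_real_derivative F (y + t *\<^sub>R d) \<bullet> d) (at t)"
    using ev
  proof eventually_elim
    case (elim t)
    have "((\<lambda>t. f (y + t *\<^sub>R d)) has_real_derivative F (y + t *\<^sub>R d) \<bullet> d) (at t)"
      by (rule GDERIV_along_line) (use seg elim in auto)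
    then show ?case by (auto intro!: derivative_eq_intros)
  qed
  show "\<forall>\<^sub>F x in at_right (0::real). x \<noteq> 0" using ev by eventually_elim auto
qed (auto intro!: tendsto_eq_intros)

text \<open>Serves with \<open>k > 0\<close> to read a normal derivative off a barrier, and with
  \<open>k = 0\<close> at a minimum on the boundary.\<close>

lemma one_sided_derivative_ge:
  fixes f :: "'a::real_inner \<Rightarrow> real"
  assumes f: "continuous_on K f" and F: "continuous_on K F" and y: "y \<in> K" and t0: "0 < t0"
    and seg: "\<And>t. 0 < t \<Longrightarrow> t \<le> t0 \<Longrightarrow> y + t *\<^sub>R d \<in> K \<and> GDERIV f (y + t *\<^sub>R d) :> F (y + t *\<^sub>R d)"
    and ge: "\<And>t. 0 < t \<Longrightarrow> t \<le> t0 \<Longrightarrow> f y + k * t \<le> f (y + t *\<^sub>R d)"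
  shows "k \<le> F y \<bullet> d"
proof (rule tendsto_lowerbound[OF one_sided_derivative[OF f F y t0 seg]])
  have "\<forall>\<^sub>F t in at_right 0. 0 < t \<and> t \<le> t0"
    using t0 by (auto intro!: exI[of _ t0] simp: eventually_at_right_field)
  then show "\<forall>\<^sub>F t in at_right 0. k \<le> (f (y + t *\<^sub>R d) - f y) / t"
    by eventually_elim (use ge in \<open>auto simp: field_simps\<close>)
qed auto

section \<open>Positive solutions on the eccentric annulus\<close>

lemma compact_pos_lower_bound:
  fixes f :: "'a::metric_space \<Rightarrow> real"
  assumes "compact S" "continuous_on S f" "\<And>x. x \<in> S \<Longrightarrow> 0 < f x"
  obtains m where "0 < m" "\<And>x. x \<in> S \<Longrightarrow> m \<le> f x"
proof (cases "S = {}")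
  case False
  from continuous_attains_inf[OF assms(1) this assms(2)] obtain x where "x \<in> S" "\<And>y. y \<in> S \<Longrightarrow> f x \<le> f y"
    by blast
  then show ?thesis using that[of "f x"] assms(3) by blast
qed (use that[of 1] in auto)

lemma compact_norm_bound:
  fixes f :: "'a::metric_space \<Rightarrow> 'b::real_normed_vector"
  assumes "compact S" "continuous_on S f"
  obtains M where "0 < M" "\<And>x. x \<in> S \<Longrightarrow> norm (f x) \<le> M"
proof -
  have "bounded (f ` S)" using assms compact_continuous_image compact_imp_bounded by blast
  then show ?thesis using that unfolding bounded_pos by auto
qed

text \<open>The classical boundary value problem, detached from the Sobolev setting.
  \<open>G\<close> is the gradient extended continuously to the closed region \<open>K\<close>. The
  outward normal of the outer sphere is \<open>x / R1\<close>, whence the form of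
  \<open>neumann\<close>. Here \<tau> is only nonnegative, so that Hopf's lemma is already available
  when \<open>\<tau> = 0\<close> has to be excluded.\<close>

locale eccentric_annulus =
  fixes R0 R1 s \<tau> :: real and e :: "'a::euclidean_space" and u :: "'a \<Rightarrow> real" and G :: "'a \<Rightarrow> 'a"
    and c :: 'a and \<Omega> K :: "'a set"
  defines "c \<equiv> s *\<^sub>R e" and "\<Omega> \<equiv> ball 0 R1 - cball c R0" and "K \<equiv> cball 0 R1 - ball c R0"
  assumes R0: "0 < R0" and s: "0 < s" and sR: "s < R1 - R0" and e: "norm e = 1" and \<tau>: "0 \<le> \<tau>"
    and u_cont: "continuous_on K u" and G_cont: "continuous_on K G"
    and lap: "\<And>x. x \<in> \<Omega> \<Longrightarrow> has_laplacian u G (- \<tau> * u x) x"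
    and u_pos: "\<And>x. x \<in> \<Omega> \<Longrightarrow> 0 < u x"
    and u_inner: "\<And>x. norm (x - c) = R0 \<Longrightarrow> u x = 0"
    and neumann: "\<And>x. norm x = R1 \<Longrightarrow> G x \<bullet> x = 0"
begin

lemma K_iff: "x \<in> K \<longleftrightarrow> norm x \<le> R1 \<and> R0 \<le> norm (x - c)"
  unfolding K_def by (auto simp: dist_norm norm_minus_commute)

lemma \<Omega>_iff: "x \<in> \<Omega> \<longleftrightarrow> norm x < R1 \<and> R0 < norm (x - c)"
  unfolding \<Omega>_def by (auto simp: dist_norm norm_minus_commute)

lemma \<Omega>_K: "x \<in> \<Omega> \<Longrightarrow> x \<in> K" by (simp add: K_iff \<Omega>_iff)

lemma open_\<Omega>: "open \<Omega>" unfolding \<Omega>_def by (intro open_Diff) auto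

lemma compact_K: "compact K" unfolding K_def by (intro compact_diff) auto

lemma norm_c: "norm c = s" using s e by (simp add: c_def)

lemma outer_dist: "norm x \<ge> r \<Longrightarrow> norm (x - c) \<ge> r - s"
  using norm_triangle_ineq2[of x c] norm_c by linarith

lemma inner_norm: "norm (x - c) \<le> r \<Longrightarrow> norm x \<le> r + s"
  using norm_triangle_ineq[of "x - c" c] norm_c by simp

lemma grad_u: "x \<in> \<Omega> \<Longrightarrow> GDERIV u x :> G x"
  using lap has_laplacian_imp_GDERIV by blast

text \<open>On the shell near the outer sphere, \<open>u\<close> dominates a Gaussian, which decreases in the
  outward direction.\<close>

lemma u_pos_outer:
  assumes "norm x = R1" shows "0 < u x"
proof -
  \<comment> \<open>Halfway between \<open>R0 + s\<close> and \<open>R1\<close>, so that the shell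
    \<open>R2 <= norm x <= R1\<close> avoids the hole.\<close>
  define R2 where "R2 = (R0 + s + R1) / 2"
  have R2: "R0 + s < R2" "R2 < R1" "0 < R2" using sR R0 s by (auto simp: R2_def)
  define S where "S = cball (0::'a) R1 - ball 0 R2"
  have S: "x \<in> S \<longleftrightarrow> norm x \<le> R1 \<and> R2 \<le> norm x" for x by (auto simp: S_def)
  have SK: "S \<subseteq> K" using outer_dist[of R2] R2 by (fastforce simp: S K_iff)
  have S\<Omega>: "x \<in> S \<Longrightarrow> norm x < R1 \<Longrightarrow> x \<in> \<Omega>" for x
    using outer_dist[of R2 x] R2 by (simp add: S \<Omega>_iff)
  have cS: "compact S" unfolding S_def by (intro compact_diff) auto
  have "sphere 0 R2 \<subseteq> \<Omega>" using S\<Omega> R2 by (auto simp: S)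
  then obtain m where m: "0 < m" "\<And>x. x \<in> sphere 0 R2 \<Longrightarrow> m \<le> u x"
    using compact_pos_lower_bound[of "sphere 0 R2" u] u_cont u_pos
    by (metis \<Omega>_K compact_sphere continuous_on_subset subset_iff)
  \<comment> \<open>Gives \<open>\<alpha> * (norm z)^2 > DIM('a)\<close> for
    \<open>norm z > R2\<close>, hence a positive Laplacian of the Gaussian.\<close>
  define \<alpha> where "\<alpha> = real DIM('a) / R2\<^sup>2"
  have \<alpha>: "\<alpha> > 0" using R2 by (simp add: \<alpha>_def)
  define E where "E x = exp (- \<alpha> * (norm (x - 0))\<^sup>2)" for x :: 'a
  \<comment> \<open>Normalised so that \<open>\<kappa> * E x = m\<close>, the lower bound of
    \<open>u\<close>, on the sphere \<open>norm x = R2\<close>.\<close>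
  define \<kappa> where "\<kappa> = m * exp (\<alpha> * R2\<^sup>2)"
  have \<kappa>: "\<kappa> > 0" using m by (simp add: \<kappa>_def)
  have E: "E x > 0" for x by (simp add: E_def)
  define f where "f x = u x - \<kappa> * E x" for x
  define F where "F x = G x - \<kappa> *\<^sub>R ((- 2 * \<alpha> * E x) *\<^sub>R (x - 0))" for x
  have fc: "continuous_on S f" and Fc: "continuous_on S F"
    unfolding f_def F_def E_def
    by (intro continuous_intros continuous_on_subset[OF u_cont SK] continuous_on_subset[OF G_cont SK])+
  have lapf: "has_laplacian f F (- \<tau> * u x - \<kappa> * (E x * (4 * \<alpha>\<^sup>2 * (norm (x - 0))\<^sup>2 - 2 * DIM('a) * \<alpha>))) x"
    if "x \<in> \<Omega>" for x
    unfolding f_def F_def E_def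
    by (intro has_laplacian_diff has_laplacian_cmult has_laplacian_gaussian lap that)
  have "x \<in> S" using assms R2 by (simp add: S)
  then obtain z where z: "z \<in> S" "\<And>y. y \<in> S \<Longrightarrow> f z \<le> f y"
    using continuous_attains_inf[OF cS _ fc] by blast
  have "0 \<le> f z"
  proof (rule ccontr)
    assume "\<not> 0 \<le> f z"
    moreover have "\<kappa> * E z = m" if "norm z = R2"
      using that by (simp add: \<kappa>_def E_def exp_minus)
    ultimately have "norm z \<noteq> R2" using m(2)[of z] by (auto simp: f_def)
    then have z2: "R2 < norm z" using z(1) by (simp add: S)
    show False
    proof (cases "norm z < R1")
      case True
      have "open (ball (0::'a) R1 - cball 0 R2)" by (intro open_Diff) auto
      then have "\<forall>\<^sub>F y in nhds z. y \<in> ball 0 R1 - cball 0 R2"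
        using True z2 by (intro eventually_nhds_in_open) auto
      then have "\<forall>\<^sub>F y in nhds z. f z \<le> f y"
        by (rule eventually_mono) (auto intro!: z(2) simp: S)
      from laplacian_nonneg_at_min[OF lapf this] S\<Omega>[OF z(1) True]
      have "\<kappa> * (E z * (4 * \<alpha>\<^sup>2 * (norm z)\<^sup>2 - 2 * DIM('a) * \<alpha>)) + \<tau> * u z \<le> 0" by simp
      moreover have "0 \<le> \<tau> * u z" using \<tau> u_pos[OF S\<Omega>[OF z(1) True]] by simp
      moreover have "0 < 4 * \<alpha>\<^sup>2 * (norm z)\<^sup>2 - 2 * DIM('a) * \<alpha>"
      proof -
        have "real DIM('a) = \<alpha> * R2\<^sup>2" using R2 by (simp add: \<alpha>_def)
        moreover have "\<alpha> * R2\<^sup>2 < \<alpha> * (norm z)\<^sup>2" using \<alpha> R2 z2 by (simp add: power_strict_mono)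
        ultimately have "2 * \<alpha> * DIM('a) < 2 * \<alpha> * (2 * (\<alpha> * (norm z)\<^sup>2))"
          using \<alpha> by (intro mult_strict_left_mono) (auto intro: order_less_le_trans)
        then show ?thesis by (simp add: power2_eq_square algebra_simps)
      qed
      then have "0 < \<kappa> * (E z * (4 * \<alpha>\<^sup>2 * (norm z)\<^sup>2 - 2 * DIM('a) * \<alpha>))"
        by (intro mult_pos_pos \<kappa> E)
      ultimately show False by linarith
    next
      case False
      then have nz: "norm z = R1" using z(1) by (simp add: S)
      define t0 where "t0 = (R1 - R2) / R1"
      have t0: "0 < t0" "t0 < 1" using R2 by (auto simp: t0_def field_simps)
      have seg: "z + t *\<^sub>R (- z) \<in> S \<and> z + t *\<^sub>R (- z) \<in> \<Omega>" if "0 < t" "t \<le> t0" for t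
      proof -
        have "z + t *\<^sub>R (- z) = (1 - t) *\<^sub>R z" by (simp add: algebra_simps)
        then have n: "norm (z + t *\<^sub>R (- z)) = (1 - t) * R1" using that t0 nz by simp
        have "t * R1 \<le> R1 - R2" using that R2 t0_def by (simp add: pos_le_divide_eq)
        moreover have "0 < t * R1" using that R2 by simp
        ultimately have "R2 \<le> (1 - t) * R1 \<and> (1 - t) * R1 < R1" by (simp add: algebra_simps)
        then show ?thesis using n S\<Omega> S by simp
      qed
      \<comment> \<open>A boundary minimum has a nonnegative inward derivative, but the Neumann
        condition leaves only the contribution of the Gaussian, which has the opposite sign.\<close>
      have "0 \<le> F z \<bullet> (- z)"
      proof (rule one_sided_derivative_ge[OF fc Fc z(1) t0(1)])
        fix t :: real assume t: "0 < t" "t \<le> t0"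
        show "z + t *\<^sub>R (- z) \<in> S \<and> GDERIV f (z + t *\<^sub>R (- z)) :> F (z + t *\<^sub>R (- z))"
          using seg[OF t] lapf has_laplacian_imp_GDERIV by blast
        show "f z + 0 * t \<le> f (z + t *\<^sub>R (- z))"
          using z(2) seg[OF t] by simp
      qed
      moreover have "F z \<bullet> z = 2 * \<kappa> * \<alpha> * E z * R1\<^sup>2"
        using neumann[OF nz] nz by (simp add: F_def inner_diff_left inner_add_left dot_square_norm)
      moreover have "0 < 2 * \<kappa> * \<alpha> * E z * R1\<^sup>2" using \<kappa> \<alpha> E[of z] R2 by simp
      ultimately show False by simp
    qed
  qed
  then have "0 \<le> f x" using z(2) \<open>x \<in> S\<close> by fastforce
  moreover have "0 < \<kappa> * E x" by (intro mult_pos_pos \<kappa> E)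
  ultimately show ?thesis unfolding f_def by linarith
qed

lemma u_pos': "x \<in> K \<Longrightarrow> R0 < norm (x - c) \<Longrightarrow> 0 < u x"
  using u_pos_outer u_pos by (cases "norm x = R1") (auto simp: K_iff \<Omega>_iff)

lemma u_nonneg: "x \<in> K \<Longrightarrow> 0 \<le> u x"
  using u_pos'[of x] u_inner[of x] by (cases "norm (x - c) = R0") (auto simp: K_iff)

text \<open>Hopf's lemma with a paraboloid as barrier: on a shell around the hole
  \<open>u - \<epsilon> * (norm (x - c))^2\<close> is strictly superharmonic and so minimal on the
  boundary. Hence \<open>u\<close> dominates \<open>\<epsilon> * ((norm (x - c))^2 - R0^2)\<close>,
  which has slope \<open>2 * \<epsilon> * R0^2\<close> along \<open>y - c\<close>.\<close>

lemma grad_inner_pos: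
  assumes y: "norm (y - c) = R0" shows "0 < G y \<bullet> (y - c)"
proof -
  \<comment> \<open>Halfway between \<open>R0\<close> and \<open>R1 - s\<close>, so that the ball of
    radius \<open>R3\<close> about \<open>c\<close> stays inside the large one.\<close>
  define R3 where "R3 = (R0 + R1 - s) / 2"
  have R3: "R0 < R3" "R3 + s < R1" using sR by (auto simp: R3_def field_simps)
  define S where "S = cball c R3 - ball c R0"
  have S: "x \<in> S \<longleftrightarrow> norm (x - c) \<le> R3 \<and> R0 \<le> norm (x - c)" for x
    by (auto simp: S_def dist_norm norm_minus_commute)
  have SK: "S \<subseteq> K" using inner_norm[of _ R3] R3 by (fastforce simp: S K_iff)
  have S\<Omega>: "x \<in> S \<Longrightarrow> R0 < norm (x - c) \<Longrightarrow> x \<in> \<Omega>" for x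
    using inner_norm[of x R3] R3 by (simp add: S \<Omega>_iff)
  have cS: "compact S" unfolding S_def by (intro compact_diff) auto
  have "sphere c R3 \<subseteq> \<Omega>" using S\<Omega> R3 by (auto simp: S dist_norm norm_minus_commute)
  then obtain m where m: "0 < m" "\<And>x. x \<in> sphere c R3 \<Longrightarrow> m \<le> u x"
    using compact_pos_lower_bound[of "sphere c R3" u] u_cont u_pos
    by (metis \<Omega>_K compact_sphere continuous_on_subset subset_iff)
  \<comment> \<open>Chosen so that the barrier equals \<open>m\<close> on the outer sphere of the
    shell.\<close>
  define \<epsilon> where "\<epsilon> = m / (R3\<^sup>2 - R0\<^sup>2)"
  have d: "0 < R3\<^sup>2 - R0\<^sup>2" using R3 R0 by (simp add: power_strict_mono)
  then have \<epsilon>: "0 < \<epsilon>" using m by (simp add: \<epsilon>_def)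
  define f where "f x = u x - \<epsilon> * (norm (x - c))\<^sup>2" for x
  define F where "F x = G x - \<epsilon> *\<^sub>R (2 *\<^sub>R (x - c))" for x
  have fc: "continuous_on S f"
    unfolding f_def by (intro continuous_intros continuous_on_subset[OF u_cont SK])
  have lapf: "has_laplacian f F (- \<tau> * u x - \<epsilon> * (2 * DIM('a))) x" if "x \<in> \<Omega>" for x
    unfolding f_def F_def
    using has_laplacian_diff[OF lap[OF that] has_laplacian_cmult[OF has_laplacian_dist_sq, of \<epsilon> c]]
    by simp
  have yS: "y \<in> S" using y R3 by (simp add: S)
  then obtain z where z: "z \<in> S" "\<And>y. y \<in> S \<Longrightarrow> f z \<le> f y"
    using continuous_attains_inf[OF cS _ fc] by blast
  have "- \<epsilon> * R0\<^sup>2 \<le> f z"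
  proof (rule ccontr)
    assume neg: "\<not> - \<epsilon> * R0\<^sup>2 \<le> f z"
    then have "norm (z - c) \<noteq> R0" using u_inner[of z] by (auto simp: f_def)
    then have z0: "R0 < norm (z - c)" using z(1) by (simp add: S)
    have "norm (z - c) \<noteq> R3"
    proof
      assume "norm (z - c) = R3"
      then have "m - \<epsilon> * R3\<^sup>2 \<le> f z" using m(2)[of z] by (simp add: f_def dist_norm norm_minus_commute)
      moreover have "\<epsilon> * R3\<^sup>2 - \<epsilon> * R0\<^sup>2 = m"
        using d unfolding right_diff_distrib[symmetric] by (simp add: \<epsilon>_def)
      ultimately show False using neg by simp
    qed
    then have z1: "norm (z - c) < R3" using z(1) by (simp add: S)
    have "open (ball c R3 - cball c R0)" by (intro open_Diff) auto
    then have "\<forall>\<^sub>F y in nhds z. y \<in> ball c R3 - cball c R0"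
      using z0 z1 by (intro eventually_nhds_in_open) (auto simp: dist_norm norm_minus_commute)
    then have "\<forall>\<^sub>F y in nhds z. f z \<le> f y"
      by (rule eventually_mono) (auto intro!: z(2) simp: S dist_norm norm_minus_commute)
    from laplacian_nonneg_at_min[OF lapf this] S\<Omega>[OF z(1) z0]
    have "\<epsilon> * (2 * DIM('a)) \<le> - \<tau> * u z" by simp
    moreover have "0 \<le> \<tau> * u z" using \<tau> u_pos[OF S\<Omega>[OF z(1) z0]] by simp
    moreover have "0 < \<epsilon> * (2 * DIM('a))" using \<epsilon> by simp
    ultimately show False by linarith
  qed
  then have lb: "\<epsilon> * ((norm (x - c))\<^sup>2 - R0\<^sup>2) \<le> u x" if "x \<in> S" for x
    using z(2)[OF that] by (simp add: f_def algebra_simps)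
  define t0 where "t0 = (R3 - R0) / R0"
  have t0: "0 < t0" using R3 R0 by (simp add: t0_def)
  have seg: "y + t *\<^sub>R (y - c) \<in> S \<and> y + t *\<^sub>R (y - c) \<in> \<Omega> \<and> norm (y + t *\<^sub>R (y - c) - c) = (1 + t) * R0"
    if "0 < t" "t \<le> t0" for t
  proof -
    have "y + t *\<^sub>R (y - c) - c = (1 + t) *\<^sub>R (y - c)" by (simp add: algebra_simps)
    then have n: "norm (y + t *\<^sub>R (y - c) - c) = (1 + t) * R0" using that y by simp
    have "t * R0 \<le> R3 - R0" using that R0 by (simp add: t0_def pos_le_divide_eq)
    moreover have "0 < t * R0" using that R0 by simp
    ultimately have "R0 < (1 + t) * R0 \<and> (1 + t) * R0 \<le> R3" by (simp add: algebra_simps)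
    then show ?thesis using n S\<Omega> S by simp
  qed
  have "2 * \<epsilon> * R0\<^sup>2 \<le> G y \<bullet> (y - c)"
  proof (rule one_sided_derivative_ge[OF u_cont G_cont _ t0])
    show "y \<in> K" using yS SK by auto
    fix t :: real assume t: "0 < t" "t \<le> t0"
    show "y + t *\<^sub>R (y - c) \<in> K \<and> GDERIV u (y + t *\<^sub>R (y - c)) :> G (y + t *\<^sub>R (y - c))"
      using seg[OF t] grad_u \<Omega>_K by blast
    have "0 \<le> \<epsilon> * (R0 * t)\<^sup>2" using \<epsilon> by simp
    then have "2 * \<epsilon> * R0\<^sup>2 * t \<le> \<epsilon> * (((1 + t) * R0)\<^sup>2 - R0\<^sup>2)"
      by (simp add: power2_eq_square algebra_simps)
    then show "u y + 2 * \<epsilon> * R0\<^sup>2 * t \<le> u (y + t *\<^sub>R (y - c))"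
      using lb seg[OF t] u_inner[OF y] by fastforce
  qed
  moreover have "0 < 2 * \<epsilon> * R0\<^sup>2" using \<epsilon> R0 by simp
  ultimately show ?thesis by linarith
qed

text \<open>The factorisation \<open>u = (\<bar>x - c\<bar>\<^sup>2 - R0\<^sup>2) F\<close> is obtained by integrating the gradient
  along the ray from the inner sphere to \<open>x\<close>.\<close>

lemma u_factorisation:
  obtains F where "continuous_on K F" "\<And>x. x \<in> K \<Longrightarrow> 0 < F x"
    "\<And>x. x \<in> K \<Longrightarrow> u x = ((norm (x - c))\<^sup>2 - R0\<^sup>2) * F x"
proof
  define r where "r x = norm (x - c)" for x
  \<comment> \<open>The segment from the radial projection of \<open>x\<close> to the inner sphere,
    at \<open>t = 0\<close>, to \<open>x\<close>, at \<open>t = 1\<close>.\<close>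
  define p where "p x t = c + ((1 - t) * R0 / r x + t) *\<^sub>R (x - c)" for x t
  define I where "I x = integral (cbox 0 1) (\<lambda>t. G (p x t) \<bullet> (x - c))" for x
  \<comment> \<open>Integration gives \<open>u x = (1 - R0 / r x) * I x\<close>. Dividing by
    \<open>(r x - R0) * (r x + R0)\<close> cancels the zero at \<open>r x = R0\<close> and leaves
    this expression, which is regular on all of \<open>K\<close>.\<close>
  define F where "F x = I x / (r x * (r x + R0))" for x
  have rK: "x \<in> K \<Longrightarrow> R0 \<le> r x" for x by (simp add: K_iff r_def)
  have R01: "R0 + s < R1" using sR by simp
  have pn: "norm (p x t - c) = (1 - t) * R0 + t * r x" if "x \<in> K" "0 \<le> t" "t \<le> 1" for x t
  proof -
    have "norm (p x t - c) = ((1 - t) * R0 / r x + t) * r x"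
      unfolding p_def using that rK[of x] R0 by (simp add: r_def)
    also have "\<dots> = (1 - t) * R0 + t * r x" using that rK[of x] R0 by (simp add: field_simps)
    finally show ?thesis .
  qed
  have pconv: "p x t = (1 - t) *\<^sub>R (c + (R0 / r x) *\<^sub>R (x - c)) + t *\<^sub>R x" for x t
  proof -
    have "c + ((1 - t) * k + t) *\<^sub>R w = (1 - t) *\<^sub>R (c + k *\<^sub>R w) + t *\<^sub>R (c + w)" for k w
      by (simp add: algebra_simps)
    from this[of "R0 / r x" "x - c"] show ?thesis by (simp add: p_def)
  qed
  have q: "norm (c + (R0 / r x) *\<^sub>R (x - c)) < R1" if "x \<in> K" for x
  proof -
    have "norm ((R0 / r x) *\<^sub>R (x - c)) = R0" using rK[OF that] R0 by (cases "x = c") (auto simp: r_def)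
    then show ?thesis using norm_triangle_ineq[of c "(R0 / r x) *\<^sub>R (x - c)"] norm_c R01 by linarith
  qed
  have pR1: "norm (p x t) \<le> (1 - t) * norm (c + (R0 / r x) *\<^sub>R (x - c)) + t * norm x"
    if "x \<in> K" "0 \<le> t" "t \<le> 1" for x t
    unfolding pconv by (rule order_trans[OF norm_triangle_ineq]) (use that in simp)
  have pK: "p x t \<in> K" if "x \<in> K" "0 \<le> t" "t \<le> 1" for x t
  proof -
    have "(1 - t) * norm (c + (R0 / r x) *\<^sub>R (x - c)) + t * norm x \<le> (1 - t) * R1 + t * R1"
      using that q[OF that(1)] by (intro add_mono mult_left_mono) (auto simp: K_iff)
    moreover have "R0 \<le> (1 - t) * R0 + t * r x"
      using mult_left_mono[OF rK[OF that(1)] that(2)] by (simp add: algebra_simps)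
    moreover have "(1 - t) * R1 + t * R1 = R1" by (simp add: algebra_simps)
    ultimately show ?thesis unfolding K_iff pn[OF that] using pR1[OF that] by linarith
  qed
  have p\<Omega>: "p x t \<in> \<Omega>" if "x \<in> K" "0 < t" "t < 1" "R0 < r x" for x t
  proof -
    have "(1 - t) * norm (c + (R0 / r x) *\<^sub>R (x - c)) + t * norm x < (1 - t) * R1 + t * R1"
      using that q[OF that(1)] by (intro add_less_le_mono mult_left_mono mult_strict_left_mono) (auto simp: K_iff)
    moreover have "R0 < (1 - t) * R0 + t * r x"
      using mult_strict_left_mono[OF that(4,2)] by (simp add: algebra_simps)
    moreover have "(1 - t) * R1 + t * R1 = R1" by (simp add: algebra_simps)
    moreover have "norm (p x t - c) = (1 - t) * R0 + t * r x" using pn[of x t] that by simp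
    ultimately show ?thesis unfolding \<Omega>_iff using pR1[of x t] that by auto
  qed
  have rc: "continuous_on A r" for A unfolding r_def by (intro continuous_intros)
  have xc: "x \<noteq> c" if "x \<in> K" for x 
  proof
    assume "x = c" then show False using rK[OF that] R0 by (simp add: r_def)
  qed
  have xc: "x \<noteq> c" if "x \<in> K" for x
  proof
    assume "x = c" then show False using rK[OF that] R0 by (simp add: r_def)
  qed
  have pc: "continuous_on (K \<times> cbox 0 1) (\<lambda>(x, t). p x t)"
    unfolding p_def case_prod_unfold r_def
    by (intro continuous_intros) (use xc in auto)
  have "continuous_on (K \<times> cbox 0 1) (\<lambda>(x, t). G (p x t) \<bullet> (x - c))"
    unfolding case_prod_unfold
    by (intro continuous_intros continuous_on_compose2[OF G_cont pc[unfolded case_prod_unfold]])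
       (use pK in auto)
  then have Ic: "continuous_on K I"
    unfolding I_def by (rule integral_continuous_on_param)
  show "continuous_on K F"
    unfolding F_def using rK R0 by (intro continuous_intros Ic rc) (fastforce simp: mult_eq_0_iff)
  have ueq: "u x = ((r x)\<^sup>2 - R0\<^sup>2) * F x" if x: "x \<in> K" for x
  proof (cases "r x = R0")
    case True then show ?thesis using u_inner[of x] by (simp add: r_def)
  next
    case False
    then have r: "R0 < r x" using rK[OF x] by simp
    have dp: "(p x has_vector_derivative (1 - R0 / r x) *\<^sub>R (x - c)) (at t)" for t
      unfolding p_def has_vector_derivative_def
      using r R0 by (auto intro!: derivative_eq_intros simp: algebra_simps diff_divide_distrib add_divide_distrib)
    have "((\<lambda>t. (1 - R0 / r x) * (G (p x t) \<bullet> (x - c))) has_integral (u (p x 1) - u (p x 0))) {0..1}"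
    proof (rule fundamental_theorem_of_calculus_interior)
      have "continuous_on {0..1} (p x)" unfolding p_def by (intro continuous_intros) (use r R0 in auto)
      then show "continuous_on {0..1} (\<lambda>t. u (p x t))"
        by (rule continuous_on_compose2[OF u_cont]) (use pK x in auto)
      fix t :: real assume t: "t \<in> {0<..<1}"
      have "GDERIV u (p x t) :> G (p x t)" using p\<Omega>[OF x _ _ r] t grad_u by auto
      from has_derivative_compose[OF dp[unfolded has_vector_derivative_def] this[unfolded gderiv_def]]
      show "((\<lambda>t. u (p x t)) has_vector_derivative (1 - R0 / r x) * (G (p x t) \<bullet> (x - c))) (at t)"
        unfolding has_vector_derivative_def
        by (rule has_derivative_eq_rhs) (auto simp: fun_eq_iff inner_commute)
    qed simp
    moreover have "p x 1 = x" by (simp add: p_def)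
    moreover have "u (p x 0) = 0" using pn[OF x, of 0] by (intro u_inner) simp
    ultimately have "((\<lambda>t. (1 - R0 / r x) * (G (p x t) \<bullet> (x - c))) has_integral u x) {0..1}" by simp
    from integral_unique[OF this] have "u x = (1 - R0 / r x) * I x" by (simp add: I_def)
    also have "\<dots> = ((r x)\<^sup>2 - R0\<^sup>2) * F x"
    proof -
      have "(r x)\<^sup>2 - R0\<^sup>2 = (r x + R0) * (r x - R0)" by (simp add: power2_eq_square algebra_simps)
      then show ?thesis using r R0 by (simp add: F_def divide_simps)
    qed
    finally show ?thesis .
  qed
  then show "u x = ((norm (x - c))\<^sup>2 - R0\<^sup>2) * F x" if "x \<in> K" for x using that by (simp add: r_def)
  \<comment> \<open>On the inner sphere the segment degenerates to a point and \<open>I x\<close> is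
    the radial derivative, positive by Hopf's lemma; elsewhere the sign is that of
    \<open>u\<close>.\<close>
  show "0 < F x" if x: "x \<in> K" for x
  proof (cases "r x = R0")
    case True
    then have "p x t = x" for t using R0 by (simp add: p_def add_divide_distrib[symmetric])
    then have "I x = G x \<bullet> (x - c)" by (simp add: I_def)
    then show ?thesis using grad_inner_pos[of x] True R0 by (simp add: F_def r_def)
  next
    case False
    then have r: "R0 < r x" using rK[OF x] by simp
    then have "0 < u x" using u_pos'[OF x] by (simp add: r_def)
    moreover have "0 < (r x)\<^sup>2 - R0\<^sup>2" using r R0 by (simp add: power_strict_mono)
    ultimately show ?thesis using ueq[OF x] by (simp add: zero_less_mult_iff)
  qed
qed

end

section \<open>Reflections and the radial derivative\<close>

lemma reflect_reflect: "norm a = 1 \<Longrightarrow> reflect a (reflect a x) = x"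
  by (simp add: reflect_def inner_diff_right norm_eq_1 algebra_simps)

lemma inner_reflect: "reflect a x \<bullet> y = x \<bullet> reflect a y"
  by (simp add: reflect_def inner_diff_left inner_diff_right inner_commute)

lemma norm_reflect: "norm a = 1 \<Longrightarrow> norm (reflect a x) = norm x"
  unfolding norm_eq_sqrt_inner by (simp add: inner_reflect reflect_reflect norm_eq_1)

lemma continuous_on_reflect [continuous_intros]:
  "continuous_on A f \<Longrightarrow> continuous_on A (\<lambda>x. reflect a (f x))"
  unfolding reflect_def by (intro continuous_intros)

lemma open_ray_start:
  fixes z d :: "'a::real_normed_vector"
  assumes "open W" "z \<in> W"
  obtains t0 where "0 < t0" "\<And>t. 0 < t \<Longrightarrow> t \<le> t0 \<Longrightarrow> z + t *\<^sub>R d \<in> W"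
proof -
  have "((\<lambda>t. z + t *\<^sub>R d) \<longlongrightarrow> z) (at_right 0)"
    by (auto intro!: tendsto_eq_intros)
  from topological_tendstoD[OF this assms] obtain b where "0 < b" "\<forall>t>0. t < b \<longrightarrow> z + t *\<^sub>R d \<in> W"
    unfolding eventually_at_right_field by auto
  then show ?thesis using that[of "b / 2"] by auto
qed

context eccentric_annulus
begin

lemma R1: "0 < R1" using R0 s sR by linarith

section \<open>Comparison of \<open>u\<close> with its reflection in one fixed hyperplane\<close>

context
  fixes a :: 'a
  assumes a: "norm a = 1" and ae: "0 < a \<bullet> e"
begin

text \<open>The closed half on the side of \<open>c\<close>. It is the half that reflects into
  \<open>K\<close>; the opposite half may be reflected into the hole.\<close>

definition "half = {x \<in> K. 0 \<le> a \<bullet> x}"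

lemma ac: "0 < a \<bullet> c" using ae s by (simp add: c_def)

lemma half_K: "x \<in> half \<Longrightarrow> x \<in> K" by (simp add: half_def)

lemma compact_half: "compact half"
proof -
  have "half = K \<inter> {x. 0 \<le> a \<bullet> x}" by (auto simp: half_def)
  then show ?thesis using compact_K by (simp add: compact_Int_closed closed_halfspace_ge)
qed

text \<open>Reflection preserves the norm, so only the cross term with \<open>c\<close> changes. The
  sign of the increment keeps the reflected half in \<open>K\<close>; its exact size is what the
  estimates at the inner sphere use.\<close>

lemma reflect_dist_sq: "(norm (reflect a x - c))\<^sup>2 = (norm (x - c))\<^sup>2 + 4 * (a \<bullet> x) * (a \<bullet> c)"
  using a unfolding power2_norm_eq_inner norm_eq_1
  by (simp add: reflect_def inner_diff_left inner_diff_right inner_commute algebra_simps)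

lemma reflect_K:
  assumes "x \<in> half" shows "reflect a x \<in> K"
proof -
  have "(norm (x - c))\<^sup>2 \<le> (norm (reflect a x - c))\<^sup>2"
    using assms ac unfolding reflect_dist_sq by (simp add: half_def)
  then have "norm (x - c) \<le> norm (reflect a x - c)" by (rule power2_le_imp_le) simp
  then show ?thesis using assms by (simp add: half_def K_iff norm_reflect[OF a])
qed

lemma reflect_\<Omega>:
  assumes "x \<in> \<Omega>" "0 \<le> a \<bullet> x" shows "reflect a x \<in> \<Omega>"
proof -
  have "(norm (x - c))\<^sup>2 \<le> (norm (reflect a x - c))\<^sup>2"
    using assms ac unfolding reflect_dist_sq by simp
  then have "norm (x - c) \<le> norm (reflect a x - c)" by (rule power2_le_imp_le) simp
  then show ?thesis using assms by (simp add: \<Omega>_iff norm_reflect[OF a])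
qed

lemma reflect_fixed: "a \<bullet> x = 0 \<Longrightarrow> reflect a x = x" by (simp add: reflect_def)

lemma neumann_reflect: "norm x = R1 \<Longrightarrow> reflect a (G (reflect a x)) \<bullet> x = 0"
  by (simp add: inner_reflect neumann norm_reflect[OF a])

lemma u_reflect_cont: "continuous_on half (\<lambda>x. u (reflect a x))"
  by (rule continuous_on_compose2[OF u_cont]) (auto intro!: continuous_intros reflect_K)

lemma G_reflect_cont: "continuous_on half (\<lambda>x. G (reflect a x))"
  by (rule continuous_on_compose2[OF G_cont]) (auto intro!: continuous_intros reflect_K)

lemma half_cont: "continuous_on half u" "continuous_on half G"
  using u_cont G_cont by (auto elim!: continuous_on_subset simp: half_K)

lemma lap_reflect:
  "x \<in> \<Omega> \<Longrightarrow> 0 \<le> a \<bullet> x \<Longrightarrow>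
    has_laplacian (\<lambda>x. u (reflect a x)) (\<lambda>x. reflect a (G (reflect a x))) (- \<tau> * u (reflect a x)) x"
  by (rule has_laplacian_reflection[OF a lap[OF reflect_\<Omega>]])

lemma inward_outer:
  assumes z: "norm z = R1" "0 < a \<bullet> z" and W: "open W" "z \<in> W"
  obtains t0 where "0 < t0"
    "\<And>t. 0 < t \<Longrightarrow> t \<le> t0 \<Longrightarrow> z + t *\<^sub>R (- z) \<in> W \<inter> \<Omega> \<and> 0 < a \<bullet> (z + t *\<^sub>R (- z))"
proof -
  have "R0 < norm (z - c)" using outer_dist[of R1 z] z sR by simp
  then have "z \<in> W \<inter> - cball c R0" using W by (simp add: dist_norm norm_minus_commute)
  then obtain t0 where t0: "0 < t0" "\<And>t. 0 < t \<Longrightarrow> t \<le> t0 \<Longrightarrow> z + t *\<^sub>R (- z) \<in> W \<inter> - cball c R0"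
    using open_ray_start[of "W \<inter> - cball c R0" z "- z"] W by (auto simp: open_Int)
  show ?thesis
  proof (rule that[of "min t0 (1/2)"])
    fix t assume t: "0 < t" "t \<le> min t0 (1/2)"
    have eq: "z + t *\<^sub>R (- z) = (1 - t) *\<^sub>R z" by (simp add: algebra_simps)
    have "norm (z + t *\<^sub>R (- z)) < R1" unfolding eq using t z R1 by simp
    moreover have "0 < a \<bullet> (z + t *\<^sub>R (- z))" unfolding eq using t z by simp
    ultimately show "z + t *\<^sub>R (- z) \<in> W \<inter> \<Omega> \<and> 0 < a \<bullet> (z + t *\<^sub>R (- z))"
      using t0(2)[of t] t by (auto simp: \<Omega>_iff dist_norm norm_minus_commute)
  qed (use t0 in simp)
qed

text \<open>Where the hyperplane meets the inner sphere both sides tend to 0, so the factorisation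
  of \<open>u\<close> is compared instead. If \<open>x\<close> is close to the hyperplane, uniform
  continuity makes the second factors nearly equal while the first one grows. If not, the reflected
  point has a definite distance from the inner sphere, whereas \<open>u x\<close> is small.\<close>

lemma reflect_near_inner:
  assumes \<epsilon>: "0 < \<epsilon>"
  obtains \<rho> where "0 < \<rho>"
    "\<And>x. x \<in> half \<Longrightarrow> (norm (x - c))\<^sup>2 \<le> R0\<^sup>2 + \<rho> \<Longrightarrow> (1 - \<epsilon>) * u x \<le> u (reflect a x)"
proof (cases "\<epsilon> \<ge> 1")
  case True
  have "(1 - \<epsilon>) * u x \<le> u (reflect a x)" if "x \<in> half" for x
    using True u_nonneg[OF half_K[OF that]] u_nonneg[OF reflect_K[OF that]]
    by (smt (verit) mult_nonpos_nonneg)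
  then show ?thesis using that[of 1] by simp
next
  case False
  obtain F where F: "continuous_on K F" "\<And>x. x \<in> K \<Longrightarrow> 0 < F x"
    "\<And>x. x \<in> K \<Longrightarrow> u x = ((norm (x - c))\<^sup>2 - R0\<^sup>2) * F x"
    by (rule u_factorisation) blast
  obtain m where m: "0 < m" "\<And>x. x \<in> K \<Longrightarrow> m \<le> F x"
    using compact_pos_lower_bound[OF compact_K F(1,2)] by blast
  obtain M where M: "0 < M" "\<And>x. x \<in> K \<Longrightarrow> norm (F x) \<le> M"
    using compact_norm_bound[OF compact_K F(1)] by blast
  have "uniformly_continuous_on K F" by (rule compact_uniformly_continuous[OF F(1) compact_K])
  then obtain d where d: "0 < d" "\<And>x y. x \<in> K \<Longrightarrow> y \<in> K \<Longrightarrow> dist y x < d \<Longrightarrow> dist (F y) (F x) < \<epsilon> * m"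
    unfolding uniformly_continuous_on_def using \<epsilon> m(1) by (metis mult_pos_pos)
  \<comment> \<open>Chosen so that \<open>\<rho> * M\<close>, the bound for \<open>u x\<close>,
    equals the lower bound \<open>2 * d * (a \<bullet> c) * m\<close> of the reflected value away
    from the hyperplane.\<close>
  define \<rho> where "\<rho> = 2 * d * (a \<bullet> c) * m / M"
  show ?thesis
  proof (rule that[of \<rho>])
    show "0 < \<rho>" using d ac m M by (simp add: \<rho>_def)
    fix x assume x: "x \<in> half" "(norm (x - c))\<^sup>2 \<le> R0\<^sup>2 + \<rho>"
    let ?g = "(norm (x - c))\<^sup>2 - R0\<^sup>2"
    have g: "0 \<le> ?g" using half_K[OF x(1)] R0 by (simp add: K_iff power_mono)
    have ax: "0 \<le> a \<bullet> x" using x by (simp add: half_def)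
    have uref: "u (reflect a x) = (?g + 4 * (a \<bullet> x) * (a \<bullet> c)) * F (reflect a x)"
      using F(3)[OF reflect_K[OF x(1)]] unfolding reflect_dist_sq by (simp add: algebra_simps)
    have Fpos: "0 < F (reflect a x)" "0 < F x" using F(2) reflect_K half_K x(1) by auto
    show "(1 - \<epsilon>) * u x \<le> u (reflect a x)"
    \<comment> \<open>The reflection moves \<open>x\<close> by exactly
      \<open>2 * (a \<bullet> x)\<close>.\<close>
    proof (cases "2 * (a \<bullet> x) < d")
      case True
      have "dist (reflect a x) x = 2 * (a \<bullet> x)" using a ax by (simp add: reflect_def dist_norm)
      then have "dist (F (reflect a x)) (F x) < \<epsilon> * m" using d(2) reflect_K half_K x(1) True by simp
      moreover have "\<epsilon> * m \<le> \<epsilon> * F x" using \<epsilon> m(2)[OF half_K[OF x(1)]] by simp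
      ultimately have "(1 - \<epsilon>) * F x \<le> F (reflect a x)" by (simp add: dist_real_def algebra_simps)
      then have "?g * ((1 - \<epsilon>) * F x) \<le> ?g * F (reflect a x)" by (rule mult_left_mono[OF _ g])
      also have "\<dots> \<le> u (reflect a x)"
        unfolding uref using ax ac Fpos by (intro mult_right_mono) auto
      finally show ?thesis using F(3)[OF half_K[OF x(1)]] by (simp add: mult_ac)
    next
      case False
      have "(1 - \<epsilon>) * u x \<le> u x" using u_nonneg[OF half_K[OF x(1)]] \<epsilon> by (simp add: algebra_simps)
      also have "u x \<le> \<rho> * M"
        using F(3)[OF half_K[OF x(1)]] x(2) M(2)[OF half_K[OF x(1)]] g Fpos \<open>0 < \<rho>\<close>
        by (simp add: mult_mono)
      also have "\<rho> * M = (2 * d * (a \<bullet> c)) * m" using M by (simp add: \<rho>_def)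
      also have "\<dots> \<le> (?g + 4 * (a \<bullet> x) * (a \<bullet> c)) * F (reflect a x)"
      proof (rule mult_mono)
        have "2 * d * (a \<bullet> c) \<le> 2 * (2 * (a \<bullet> x)) * (a \<bullet> c)"
          using False ac by (intro mult_right_mono mult_left_mono) auto
        also have "\<dots> = 4 * (a \<bullet> x) * (a \<bullet> c)" by simp
        finally show "2 * d * (a \<bullet> c) \<le> ?g + 4 * (a \<bullet> x) * (a \<bullet> c)" using g by linarith
      qed (use m(1) m(2)[OF reflect_K[OF x(1)]] g ac ax in auto)
      finally show ?thesis unfolding uref .
    qed
  qed
qed

text \<open>The quotient \<open>(u \<circ> reflect a - u) / u\<close> satisfies an elliptic equation without zeroth order
  term, so it obeys a minimum principle whatever the size of \<open>\<tau>\<close>; the auxiliary function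
  \<open>1 - exp (- \<mu> (a \<bullet> x))\<close> makes both the equation and the Neumann condition strict.\<close>

lemma reflect_ge_approx:
  assumes \<epsilon>: "0 < \<epsilon>" and x: "x \<in> half"
  shows "(1 - 2 * \<epsilon>) * u x \<le> u (reflect a x)"
proof -
  obtain \<rho> where \<rho>: "0 < \<rho>"
    "\<And>x. x \<in> half \<Longrightarrow> (norm (x - c))\<^sup>2 \<le> R0\<^sup>2 + \<rho> \<Longrightarrow> (1 - \<epsilon>) * u x \<le> u (reflect a x)"
    using reflect_near_inner[OF \<epsilon>] by blast
  \<comment> \<open>Away from the inner sphere \<open>u\<close> is bounded below, which makes the
    quotient continuous; the rest is covered by \<open>reflect_near_inner\<close>.\<close>
  define S where "S = half \<inter> {x. R0\<^sup>2 + \<rho> \<le> (norm (x - c))\<^sup>2}"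
  have "closed {x. R0\<^sup>2 + \<rho> \<le> (norm (x - c))\<^sup>2}"
    by (intro closed_Collect_le continuous_intros)
  then have cS: "compact S" unfolding S_def by (rule compact_Int_closed[OF compact_half])
  have Sh: "S \<subseteq> half" by (simp add: S_def)
  have Sr: "R0 < norm (y - c)" if "y \<in> S" for y
    by (rule power2_less_imp_less) (use that \<rho> in \<open>auto simp: S_def\<close>)
  have up: "0 < u y" if "y \<in> S" for y
    using u_pos'[OF _ Sr[OF that]] half_K that by (auto simp: S_def)
  note contS = half_cont[THEN continuous_on_subset[OF _ Sh]]
    u_reflect_cont[THEN continuous_on_subset[OF _ Sh]] G_reflect_cont[THEN continuous_on_subset[OF _ Sh]]
  obtain \<eta> where \<eta>: "0 < \<eta>" "\<And>y. y \<in> S \<Longrightarrow> \<eta> \<le> u y"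
    using compact_pos_lower_bound[OF cS contS(1) up] by blast
  obtain M where M: "0 < M" "\<And>y. y \<in> K \<Longrightarrow> norm (G y) \<le> M"
    using compact_norm_bound[OF compact_K G_cont] by blast
  \<comment> \<open>Ensures \<open>\<mu> * u >= 2 * M + 1\<close>, which exceeds
    \<open>2 * (a \<bullet> G y)\<close> on \<open>S\<close>.\<close>
  define \<mu> where "\<mu> = (2 * M + 1) / \<eta>"
  have \<mu>: "0 < \<mu>" using M \<eta> by (simp add: \<mu>_def)
  define E where "E y = exp (- \<mu> * (a \<bullet> y))" for y
  have E: "0 < E y" for y by (simp add: E_def)
  define q where "q y = (u (reflect a y) - u y) / u y + \<epsilon> * (1 - E y)" for y
  show ?thesis
  proof (cases "x \<in> S")
    case False
    then have "(1 - \<epsilon>) * u x \<le> u (reflect a x)" using x by (intro \<rho>(2)) (auto simp: S_def)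
    moreover have "0 \<le> \<epsilon> * u x" using \<epsilon> u_nonneg[OF half_K[OF x]] by simp
    ultimately show ?thesis by (simp add: algebra_simps)
  next
    case True
    have "continuous_on S q"
      unfolding q_def E_def by (intro continuous_intros contS) (use up in force)
    then obtain z where z: "z \<in> S" "\<And>y. y \<in> S \<Longrightarrow> q z \<le> q y"
      using continuous_attains_inf[OF cS] True by blast
    define m where "m = q z"
    have "- \<epsilon> \<le> m"
    proof (rule ccontr)
      assume neg: "\<not> - \<epsilon> \<le> m"
      have zh: "z \<in> half" using z Sh by auto
      have az: "0 < a \<bullet> z"
      proof (rule ccontr)
        assume "\<not> 0 < a \<bullet> z"
        then have "a \<bullet> z = 0" using zh by (simp add: half_def)
        then show False using neg \<epsilon> by (simp add: m_def q_def E_def reflect_fixed)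
      qed
      have zr: "R0\<^sup>2 + \<rho> < (norm (z - c))\<^sup>2"
      proof (rule ccontr)
        assume "\<not> R0\<^sup>2 + \<rho> < (norm (z - c))\<^sup>2"
        then have "- \<epsilon> * u z \<le> u (reflect a z) - u z"
          using \<rho>(2)[OF zh] by (simp add: algebra_simps)
        then have "- \<epsilon> \<le> (u (reflect a z) - u z) / u z" using up[OF z(1)] by (simp only: pos_le_divide_eq)
        moreover have "0 \<le> \<epsilon> * (1 - E z)" using \<epsilon> az \<mu> by (simp add: E_def)
        ultimately show False using neg by (simp add: m_def q_def)
      qed
      define W where "W = {y. R0\<^sup>2 + \<rho> < (norm (y - c))\<^sup>2}"
      have W: "open W" "z \<in> W"
        unfolding W_def using zr by (auto intro!: open_Collect_less continuous_intros)
      \<comment> \<open>This is \<open>u * (q - m)\<close> written without division: nonnegative on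
        \<open>S\<close> and zero at \<open>z\<close>.\<close>
      define f where "f y = u (reflect a y) - u y + \<epsilon> * ((1 - E y) * u y) - m * u y" for y
      define F where "F y = reflect a (G (reflect a y)) - G y
        + \<epsilon> *\<^sub>R ((1 - E y) *\<^sub>R G y + u y *\<^sub>R (0 - (- \<mu> * E y) *\<^sub>R a)) - m *\<^sub>R G y" for y
      have fz: "f z = 0"
        using up[OF z(1)] by (simp add: f_def m_def q_def field_simps)
      have fpos: "0 \<le> f y" if "y \<in> S" for y
      proof -
        have "m * u y \<le> q y * u y" using z(2)[OF that] up[OF that] by (simp add: m_def)
        also have "\<dots> = u (reflect a y) - u y + \<epsilon> * ((1 - E y) * u y)"
          using up[OF that] by (simp add: q_def field_simps)
        finally show ?thesis by (simp add: f_def)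
      qed
      have lapE: "has_laplacian (\<lambda>y. E y) (\<lambda>y. (- \<mu> * E y) *\<^sub>R a) (\<mu>\<^sup>2 * E y) y" for y
      proof -
        have 1: "((\<lambda>t. exp (- \<mu> * t)) has_real_derivative - \<mu> * exp (- \<mu> * t)) (at t)" for t :: real
          by (auto intro!: derivative_eq_intros)
        have 2: "((\<lambda>t. - \<mu> * exp (- \<mu> * t)) has_real_derivative \<mu>\<^sup>2 * exp (- \<mu> * t)) (at t)" for t :: real
          by (auto intro!: derivative_eq_intros simp: power2_eq_square)
        show ?thesis
          by (rule has_laplacian_subst[OF has_laplacian_compose[OF has_laplacian_inner[of a] 1 2]])
             (use a in \<open>auto simp: E_def norm_eq_1\<close>)
      qed
      have lapf: "has_laplacian f F (- \<tau> * u (reflect a y) - (- \<tau> * u y)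
          + \<epsilon> * ((1 - E y) * (- \<tau> * u y) + u y * (0 - \<mu>\<^sup>2 * E y) + 2 * ((0 - (- \<mu> * E y) *\<^sub>R a) \<bullet> G y))
          - m * (- \<tau> * u y)) y" if "y \<in> \<Omega>" "0 \<le> a \<bullet> y" for y
        unfolding f_def F_def
        by (intro has_laplacian_diff has_laplacian_add has_laplacian_cmult has_laplacian_mult
            has_laplacian_const lapE lap lap_reflect that)
      show False
      proof (cases "norm z < R1")
        case True
        then have z\<Omega>: "z \<in> \<Omega>" using Sr[OF z(1)] by (simp add: \<Omega>_iff)
        have "open (\<Omega> \<inter> W \<inter> {y. 0 < a \<bullet> y})"
          by (intro open_Int open_\<Omega> W open_halfspace_gt)
        then have "\<forall>\<^sub>F y in nhds z. y \<in> \<Omega> \<inter> W \<inter> {y. 0 < a \<bullet> y}"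
          by (rule eventually_nhds_in_open) (use z\<Omega> W az in auto)
        then have "\<forall>\<^sub>F y in nhds z. f z \<le> f y"
          by (rule eventually_mono) (auto simp: fz S_def W_def half_def \<Omega>_K intro!: fpos)
        \<comment> \<open>As \<open>f z = 0\<close>, the zeroth order term disappears. What remains
          has the sign of \<open>2 * (a \<bullet> G z) - \<mu> * u z\<close>, negative by the choice
          of \<mu>.\<close>
        from laplacian_nonneg_at_min[OF lapf[OF z\<Omega> less_imp_le[OF az]] this]
        have "0 \<le> - \<tau> * f z + \<epsilon> * \<mu> * E z * (2 * (a \<bullet> G z) - \<mu> * u z)"
          by (simp add: f_def algebra_simps power2_eq_square)
        then have "0 \<le> \<epsilon> * \<mu> * E z * (2 * (a \<bullet> G z) - \<mu> * u z)" using fz by simp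
        moreover have "0 < \<epsilon> * \<mu> * E z" by (intro mult_pos_pos \<epsilon> \<mu> E)
        ultimately have "0 \<le> 2 * (a \<bullet> G z) - \<mu> * u z" by (simp add: zero_le_mult_iff)
        moreover have "a \<bullet> G z \<le> M"
          using norm_cauchy_schwarz[of a "G z"] M(2)[OF half_K[OF zh]] a by simp
        moreover have "2 * M + 1 \<le> \<mu> * u z"
        proof -
          have "\<mu> * \<eta> \<le> \<mu> * u z" using \<eta>(2)[OF z(1)] \<mu> by simp
          then show ?thesis using \<eta>(1) by (simp add: \<mu>_def)
        qed
        ultimately show False by linarith
      next
        case False
        then have nz: "norm z = R1" using half_K[OF zh] by (simp add: K_iff)
        obtain t0 where t0: "0 < t0"
          "\<And>t. 0 < t \<Longrightarrow> t \<le> t0 \<Longrightarrow> z + t *\<^sub>R (- z) \<in> W \<inter> \<Omega> \<and> 0 < a \<bullet> (z + t *\<^sub>R (- z))"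
          using inward_outer[OF nz az W] by blast
        have seg: "z + t *\<^sub>R (- z) \<in> S \<and> z + t *\<^sub>R (- z) \<in> \<Omega> \<and> 0 \<le> a \<bullet> (z + t *\<^sub>R (- z))"
          if "0 < t" "t \<le> t0" for t
          using t0(2)[OF that] by (auto simp: S_def W_def half_def \<Omega>_K)
        have "0 \<le> F z \<bullet> (- z)"
        proof (rule one_sided_derivative_ge[OF _ _ z(1) t0(1)])
          show "continuous_on S f" unfolding f_def E_def by (intro continuous_intros contS)
          show "continuous_on S F" unfolding F_def E_def by (intro continuous_intros contS)
          fix t assume t: "0 < t" "t \<le> t0"
          show "z + t *\<^sub>R (- z) \<in> S \<and> GDERIV f (z + t *\<^sub>R (- z)) :> F (z + t *\<^sub>R (- z))"
            using seg[OF t] lapf has_laplacian_imp_GDERIV by blast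
          show "f z + 0 * t \<le> f (z + t *\<^sub>R (- z))" using fpos seg[OF t] fz by simp
        qed
        \<comment> \<open>Both Neumann conditions remove the gradient terms. Only the derivative of
          \<open>E\<close> survives, with a sign that is impossible at a boundary minimum.\<close>
        moreover have "F z \<bullet> z = \<epsilon> * (u z * (\<mu> * E z * (a \<bullet> z)))"
          using neumann[OF nz] neumann_reflect[OF nz]
          by (simp add: F_def inner_diff_left inner_add_left)
        moreover have "0 < \<epsilon> * (u z * (\<mu> * E z * (a \<bullet> z)))"
          by (intro mult_pos_pos \<epsilon> \<mu> E az up z(1))
        ultimately show False by simp
      qed
    qed
    then have "- \<epsilon> \<le> q x" using z(2)[OF True] by (simp add: m_def)
    \<comment> \<open>The auxiliary function costs a second \<epsilon>, whence the factor 2 in the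
      statement.\<close>
    moreover have "\<epsilon> * (1 - E x) \<le> \<epsilon>" using \<epsilon> E[of x] by (simp add: algebra_simps)
    ultimately have "- 2 * \<epsilon> \<le> (u (reflect a x) - u x) / u x" by (simp add: q_def)
    then have "- 2 * \<epsilon> * u x \<le> u (reflect a x) - u x" using up[OF True] by (simp only: pos_le_divide_eq)
    then show ?thesis by (simp add: algebra_simps)
  qed
qed

text \<open>The limit \<open>\<epsilon> \<rightarrow> 0\<close>, carried out with a single value:
  for a quarter of the relative defect the approximate inequality bounds the defect by half of
  itself.\<close>

lemma reflect_ge:
  assumes x: "x \<in> half" shows "u x \<le> u (reflect a x)"
proof (rule ccontr)
  assume neg: "\<not> u x \<le> u (reflect a x)"
  then have ux: "0 < u x" using u_nonneg[OF reflect_K[OF x]] by linarith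
  define \<epsilon> where "\<epsilon> = (u x - u (reflect a x)) / (4 * u x)"
  have "0 < \<epsilon>" using neg ux by (simp add: \<epsilon>_def)
  from reflect_ge_approx[OF this x] have "u x - u (reflect a x) \<le> 2 * \<epsilon> * u x" by (simp add: algebra_simps)
  also have "\<dots> = (u x - u (reflect a x)) / 2" using ux by (simp add: \<epsilon>_def)
  finally show False using neg by simp
qed

text \<open>The Gaussian weight centred at \<open>c\<close> makes \<open>(a \<bullet> x) exp (- \<alpha> \<bar>x - c\<bar>\<^sup>2)\<close> a strict subsolution
  on the whole half domain, because \<open>0 < a \<bullet> c\<close>.\<close>

lemma reflect_growth:
  obtains \<kappa> where "0 < \<kappa>" "\<And>x. x \<in> half \<Longrightarrow> u x + \<kappa> * (a \<bullet> x) \<le> u (reflect a x)"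
proof -
  obtain F0 where F0: "continuous_on K F0" "\<And>x. x \<in> K \<Longrightarrow> 0 < F0 x"
    "\<And>x. x \<in> K \<Longrightarrow> u x = ((norm (x - c))\<^sup>2 - R0\<^sup>2) * F0 x"
    by (rule u_factorisation) blast
  obtain m where m: "0 < m" "\<And>x. x \<in> K \<Longrightarrow> m \<le> F0 x"
    using compact_pos_lower_bound[OF compact_K F0(1,2)] by blast
  \<comment> \<open>On the inner sphere the reflected value is
    \<open>4 * (a \<bullet> z) * (a \<bullet> c)\<close> times a factor that is at least
    \<open>m\<close>, so it dominates \<open>\<kappa> * (a \<bullet> z)\<close>.\<close>
  define \<kappa> where "\<kappa> = 4 * (a \<bullet> c) * m"
  have \<kappa>: "0 < \<kappa>" using m ac by (simp add: \<kappa>_def)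
  \<comment> \<open>The first summand makes
    \<open>4 * \<alpha> * (norm (x - c))^2 >= 2 * DIM('a) + 4\<close>, which settles the Laplacian.
    The second makes \<open>\<alpha> * ((z - c) \<bullet> z) >= 1\<close> on the outer sphere, which
    settles the normal derivative.\<close>
  define \<alpha> where "\<alpha> = (2 * DIM('a) + 4) / (4 * R0\<^sup>2) + 1 / (R1 * (R1 - s))"
  have R1s: "0 < R1 - s" using sR R0 by linarith
  have "(2 * DIM('a) + 4) / (4 * R0\<^sup>2) \<le> \<alpha>" unfolding \<alpha>_def using R1 R1s by simp
  then have \<alpha>1: "2 * DIM('a) + 4 \<le> \<alpha> * (4 * R0\<^sup>2)" using R0 by (simp add: pos_divide_le_eq)
  have "1 / (R1 * (R1 - s)) \<le> \<alpha>" unfolding \<alpha>_def by simp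
  then have \<alpha>2: "1 \<le> \<alpha> * (R1 * (R1 - s))" using R1 R1s by (simp add: pos_divide_le_eq)
  have \<alpha>: "0 < \<alpha>" unfolding \<alpha>_def using R1 R1s R0 by (intro add_pos_pos divide_pos_pos) auto
  define E where "E x = exp (- \<alpha> * (norm (x - c))\<^sup>2)" for x
  have E: "0 < E x" for x by (simp add: E_def)
  have E1: "E x \<le> 1" for x using \<alpha> by (simp add: E_def)
  define f where "f x = u (reflect a x) - u x - \<kappa> * ((a \<bullet> x) * E x)" for x
  define F where "F x = reflect a (G (reflect a x)) - G x
    - \<kappa> *\<^sub>R ((a \<bullet> x) *\<^sub>R ((- 2 * \<alpha> * E x) *\<^sub>R (x - c)) + E x *\<^sub>R a)" for x
  have fc: "continuous_on half f"
    unfolding f_def E_def by (intro continuous_intros u_reflect_cont half_cont)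
  have Fc: "continuous_on half F"
    unfolding F_def E_def by (intro continuous_intros G_reflect_cont half_cont)
  have lapf: "has_laplacian f F (- \<tau> * u (reflect a x) - (- \<tau> * u x)
      - \<kappa> * ((a \<bullet> x) * (E x * (4 * \<alpha>\<^sup>2 * (norm (x - c))\<^sup>2 - 2 * DIM('a) * \<alpha>)) + E x * 0
        + 2 * (a \<bullet> ((- 2 * \<alpha> * E x) *\<^sub>R (x - c))))) x" if "x \<in> \<Omega>" "0 \<le> a \<bullet> x" for x
    unfolding f_def F_def E_def
    by (intro has_laplacian_diff has_laplacian_cmult has_laplacian_mult has_laplacian_inner
        has_laplacian_gaussian lap lap_reflect that)
  have "0 \<le> f x" if x: "x \<in> half" for x
  proof -
    obtain z where z: "z \<in> half" "\<And>y. y \<in> half \<Longrightarrow> f z \<le> f y"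
      using continuous_attains_inf[OF compact_half _ fc] x by blast
    have "0 \<le> f z"
    proof (rule ccontr)
      assume neg: "\<not> 0 \<le> f z"
      have az: "0 < a \<bullet> z"
      proof (rule ccontr)
        assume "\<not> 0 < a \<bullet> z"
        then have "a \<bullet> z = 0" using z(1) by (simp add: half_def)
        then show False using neg by (simp add: f_def reflect_fixed)
      qed
      have zr: "R0 < norm (z - c)"
      proof (rule ccontr)
        assume "\<not> R0 < norm (z - c)"
        then have r: "norm (z - c) = R0" using half_K[OF z(1)] by (simp add: K_iff)
        have "\<kappa> * ((a \<bullet> z) * E z) \<le> \<kappa> * (a \<bullet> z)" using \<kappa> az E1[of z] by simp
        also have "\<dots> \<le> 4 * (a \<bullet> z) * (a \<bullet> c) * F0 (reflect a z)"
          using m(2)[OF reflect_K[OF z(1)]] az ac by (simp add: \<kappa>_def)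
        also have "\<dots> = u (reflect a z)"
          using F0(3)[OF reflect_K[OF z(1)]] unfolding reflect_dist_sq r by simp
        finally show False using neg u_inner[OF r] by (simp add: f_def)
      qed
      show False
      proof (cases "norm z < R1")
        case True
        then have z\<Omega>: "z \<in> \<Omega>" using zr by (simp add: \<Omega>_iff)
        have "open (\<Omega> \<inter> {y. 0 < a \<bullet> y})" by (intro open_Int open_\<Omega> open_halfspace_gt)
        then have "\<forall>\<^sub>F y in nhds z. y \<in> \<Omega> \<inter> {y. 0 < a \<bullet> y}"
          by (rule eventually_nhds_in_open) (use z\<Omega> az in auto)
        then have "\<forall>\<^sub>F y in nhds z. f z \<le> f y"
          by (rule eventually_mono) (auto simp: half_def \<Omega>_K intro!: z(2))
        \<comment> \<open>The term with \<tau> has the right sign by \<open>reflect_ge\<close>.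
          Strictness is due to \<open>4 * \<alpha> * (a \<bullet> c)\<close>, left over from the
          cross term of the product rule.\<close>
        from laplacian_nonneg_at_min[OF lapf[OF z\<Omega> less_imp_le[OF az]] this]
        have "\<kappa> * E z * ((a \<bullet> z) * (4 * \<alpha>\<^sup>2 * (norm (z - c))\<^sup>2 - 2 * DIM('a) * \<alpha> - 4 * \<alpha>) + 4 * \<alpha> * (a \<bullet> c))
            + \<tau> * (u (reflect a z) - u z) \<le> 0"
          by (simp add: inner_diff_right algebra_simps)
        moreover have "0 \<le> \<tau> * (u (reflect a z) - u z)" using \<tau> reflect_ge[OF z(1)] by simp
        moreover have "0 \<le> (a \<bullet> z) * (4 * \<alpha>\<^sup>2 * (norm (z - c))\<^sup>2 - 2 * DIM('a) * \<alpha> - 4 * \<alpha>)"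
        proof -
          have "\<alpha> * (4 * R0\<^sup>2) \<le> \<alpha> * (4 * (norm (z - c))\<^sup>2)"
            using \<alpha> zr R0 by (simp add: power_mono)
          then have "0 \<le> \<alpha> * (4 * (norm (z - c))\<^sup>2) - (2 * DIM('a) + 4)"
            using \<alpha>1 by linarith
          then have "0 \<le> \<alpha> * (\<alpha> * (4 * (norm (z - c))\<^sup>2) - (2 * DIM('a) + 4))"
            using \<alpha> by (intro mult_nonneg_nonneg) auto
          also have "\<dots> = 4 * \<alpha>\<^sup>2 * (norm (z - c))\<^sup>2 - 2 * DIM('a) * \<alpha> - 4 * \<alpha>"
            by (simp add: algebra_simps power2_eq_square)
          finally show ?thesis using az by simp
        qed
        moreover have "0 < 4 * \<alpha> * (a \<bullet> c)" using \<alpha> ac by simp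
        moreover have "0 < \<kappa> * E z" by (intro mult_pos_pos \<kappa> E)
        ultimately show False by (smt (verit) mult_pos_pos)
      next
        case False
        then have nz: "norm z = R1" using half_K[OF z(1)] by (simp add: K_iff)
        obtain t0 where t0: "0 < t0"
          "\<And>t. 0 < t \<Longrightarrow> t \<le> t0 \<Longrightarrow> z + t *\<^sub>R (- z) \<in> UNIV \<inter> \<Omega> \<and> 0 < a \<bullet> (z + t *\<^sub>R (- z))"
          using inward_outer[OF nz az open_UNIV] by blast
        have seg: "z + t *\<^sub>R (- z) \<in> half \<and> z + t *\<^sub>R (- z) \<in> \<Omega> \<and> 0 \<le> a \<bullet> (z + t *\<^sub>R (- z))"
          if "0 < t" "t \<le> t0" for t
          using t0(2)[OF that] by (auto simp: half_def \<Omega>_K)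
        have "0 \<le> F z \<bullet> (- z)"
        proof (rule one_sided_derivative_ge[OF fc Fc z(1) t0(1)])
          fix t assume t: "0 < t" "t \<le> t0"
          show "z + t *\<^sub>R (- z) \<in> half \<and> GDERIV f (z + t *\<^sub>R (- z)) :> F (z + t *\<^sub>R (- z))"
            using seg[OF t] lapf has_laplacian_imp_GDERIV by blast
          show "f z + 0 * t \<le> f (z + t *\<^sub>R (- z))" using z(2) seg[OF t] by simp
        qed
        \<comment> \<open>The outward decay of the Gaussian has to beat the outward growth of
          \<open>a \<bullet> x\<close>, which is the -1 in the bracket.\<close>
        moreover have "F z \<bullet> z = \<kappa> * E z * (a \<bullet> z) * (2 * \<alpha> * ((z - c) \<bullet> z) - 1)"
          using neumann[OF nz] neumann_reflect[OF nz]
          by (simp add: F_def inner_diff_left inner_add_left algebra_simps)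
        moreover have "0 < 2 * \<alpha> * ((z - c) \<bullet> z) - 1"
        proof -
          have "c \<bullet> z \<le> s * R1" using norm_cauchy_schwarz[of c z] nz norm_c by simp
          then have "R1 * (R1 - s) \<le> (z - c) \<bullet> z"
            using nz by (simp add: inner_diff_left dot_square_norm power2_eq_square algebra_simps)
          then have "\<alpha> * (R1 * (R1 - s)) \<le> \<alpha> * ((z - c) \<bullet> z)" using \<alpha> by simp
          then show ?thesis using \<alpha>2 by linarith
        qed
        moreover have "0 < \<kappa> * E z * (a \<bullet> z)" by (intro mult_pos_pos \<kappa> E az)
        ultimately show False by (smt (verit) inner_minus_right mult_pos_pos)
      qed
    qed
    then show ?thesis using z(2)[OF x] by linarith
  qed
  note fpos = this
  \<comment> \<open>On \<open>half\<close> the distance to \<open>c\<close> is at most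
    \<open>R1 + s\<close>, so the Gaussian is at least this exponential and can be replaced by a
    constant.\<close>
  define \<kappa>' where "\<kappa>' = \<kappa> * exp (- \<alpha> * (R1 + s)\<^sup>2)"
  show ?thesis
  proof (rule that[of \<kappa>'])
    show "0 < \<kappa>'" using \<kappa> by (simp add: \<kappa>'_def)
    fix x assume x: "x \<in> half"
    have "norm (x - c) \<le> R1 + s"
      using norm_triangle_ineq4[of x c] norm_c half_K[OF x] by (simp add: K_iff)
    then have "exp (- \<alpha> * (R1 + s)\<^sup>2) \<le> E x" unfolding E_def using \<alpha> by (simp add: power_mono)
    then have "(a \<bullet> x) * exp (- \<alpha> * (R1 + s)\<^sup>2) \<le> (a \<bullet> x) * E x"
      using x by (intro mult_left_mono) (auto simp: half_def)
    then have "\<kappa> * ((a \<bullet> x) * exp (- \<alpha> * (R1 + s)\<^sup>2)) \<le> \<kappa> * ((a \<bullet> x) * E x)"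
      by (rule mult_left_mono) (use \<kappa> in simp)
    then have "\<kappa>' * (a \<bullet> x) \<le> \<kappa> * ((a \<bullet> x) * E x)" by (simp add: \<kappa>'_def mult_ac)
    then show "u x + \<kappa>' * (a \<bullet> x) \<le> u (reflect a x)" using fpos[OF x] by (simp add: f_def)
  qed
qed

text \<open>The difference of reflected function and \<open>u\<close> vanishes on the hyperplane and
  grows at least like \<open>\<kappa> * (a \<bullet> x)\<close>. At \<open>y\<close> a reflection
  only flips the \<open>a\<close>-component of the gradient, so the derivative of the difference is
  \<open>- 2 * (G y \<bullet> a)\<close>.\<close>

lemma grad_outer_neg:
  assumes y: "norm y = R1" "a \<bullet> y = 0" shows "G y \<bullet> a < 0"
proof -
  obtain \<kappa> where \<kappa>: "0 < \<kappa>" "\<And>x. x \<in> half \<Longrightarrow> u x + \<kappa> * (a \<bullet> x) \<le> u (reflect a x)"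
    using reflect_growth by blast
  \<comment> \<open>The direction \<open>a\<close> is tangent to the outer sphere at
    \<open>y\<close> and would leave the ball; subtracting \<open>y\<close> tilts it inwards. As
    \<open>a \<bullet> y = 0\<close>, the tilt changes neither \<open>a \<bullet> d = 1\<close> nor
    the derivative of the difference.\<close>
  define d where "d = a - y"
  have "R0 < norm (y - c)" using outer_dist[of R1 y] y sR by simp
  then have "y \<in> - cball c R0" by (simp add: dist_norm norm_minus_commute)
  then obtain t1 where t1: "0 < t1" "\<And>t. 0 < t \<Longrightarrow> t \<le> t1 \<Longrightarrow> y + t *\<^sub>R d \<in> - cball c R0"
    using open_ray_start[of "- cball c R0" y d] by auto
  \<comment> \<open>Makes \<open>t^2 * (R1^2 + 1) <= t * R1^2\<close>, so that the squared norm,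
    \<open>R1^2 - 2 * t * R1^2 + t^2 * (R1^2 + 1)\<close>, stays below \<open>R1^2\<close>.\<close>
  define t0 where "t0 = min t1 (R1\<^sup>2 / (R1\<^sup>2 + 1))"
  have t0: "0 < t0" using t1 R1 by (simp add: t0_def divide_pos_pos add_pos_pos)
  have aa: "a \<bullet> a = 1" using a by (simp add: norm_eq_1)
  have yy: "y \<bullet> y = R1\<^sup>2" using y by (simp add: dot_square_norm)
  have seg: "y + t *\<^sub>R d \<in> \<Omega> \<and> a \<bullet> (y + t *\<^sub>R d) = t" if t: "0 < t" "t \<le> t0" for t
  proof -
    have "t * (R1\<^sup>2 + 1) \<le> R1\<^sup>2" using t R1 by (simp add: t0_def pos_le_divide_eq add_pos_pos)
    then have "t * (t * (R1\<^sup>2 + 1)) \<le> t * R1\<^sup>2" using t by simp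
    moreover have "0 < t * R1\<^sup>2" using t R1 by simp
    moreover have "(norm (y + t *\<^sub>R d))\<^sup>2 = R1\<^sup>2 - 2 * (t * R1\<^sup>2) + t * (t * (R1\<^sup>2 + 1))"
      using yy aa unfolding power2_norm_eq_inner d_def
      by (simp add: inner_add_left inner_add_right inner_diff_left inner_diff_right
          y(2) y(2)[unfolded inner_commute[of a]] algebra_simps power2_eq_square)
    ultimately have "(norm (y + t *\<^sub>R d))\<^sup>2 < R1\<^sup>2" by linarith
    then have "norm (y + t *\<^sub>R d) < R1" by (rule power2_less_imp_less) (use R1 in simp)
    moreover have "y + t *\<^sub>R d \<in> - cball c R0" using t1(2) t by (simp add: t0_def)
    ultimately show ?thesis using y aa
      by (simp add: \<Omega>_iff dist_norm norm_minus_commute d_def inner_add_right inner_diff_right)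
  qed
  have yh: "y \<in> half" using y \<open>R0 < norm (y - c)\<close> by (simp add: half_def K_iff)
  have "\<kappa> \<le> (reflect a (G (reflect a y)) - G y) \<bullet> d"
  proof (rule one_sided_derivative_ge[OF _ _ yh t0])
    show "continuous_on half (\<lambda>x. u (reflect a x) - u x)" by (intro continuous_intros u_reflect_cont half_cont)
    show "continuous_on half (\<lambda>x. reflect a (G (reflect a x)) - G x)"
      by (intro continuous_intros G_reflect_cont half_cont)
    fix t assume t: "0 < t" "t \<le> t0"
    let ?x = "y + t *\<^sub>R d"
    have x: "?x \<in> \<Omega>" "a \<bullet> ?x = t" using seg[OF t] by auto
    then have xh: "?x \<in> half" using t \<Omega>_K by (simp add: half_def)
    have "GDERIV (\<lambda>x. u (reflect a x) - u x) ?x :> reflect a (G (reflect a ?x)) - G ?x"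
      using x t by (intro GDERIV_diff grad_u has_laplacian_imp_GDERIV[OF lap_reflect]) auto
    then show "?x \<in> half \<and> GDERIV (\<lambda>x. u (reflect a x) - u x) ?x :> reflect a (G (reflect a ?x)) - G ?x"
      using xh by simp
    show "u (reflect a y) - u y + \<kappa> * t \<le> u (reflect a ?x) - u ?x"
      using \<kappa>(2)[OF xh] reflect_fixed[OF y(2)] x(2) by simp
  qed
  also have "\<dots> = - 2 * (G y \<bullet> a)"
    unfolding reflect_fixed[OF y(2)] using y aa
    by (simp add: reflect_def d_def inner_diff_right inner_commute algebra_simps)
  finally show ?thesis using \<kappa>(1) by simp
qed

end

section \<open>Sign of the radial derivative on the outer sphere and in the interior\<close>

text \<open>The normal of the hyperplane is the component \<open>w\<close> of \<open>e\<close>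
  orthogonal to \<open>y\<close>, so that the hyperplane contains \<open>y\<close>. It vanishes only
  at the two excluded poles, and \<open>w \<bullet> e = w \<bullet> w > 0\<close>. The remaining
  component of \<open>e\<close> is parallel to \<open>y\<close> and is killed by the Neumann
  condition.\<close>

lemma grad_outer_e_neg:
  assumes y: "norm y = R1" "y \<noteq> R1 *\<^sub>R e" "y \<noteq> - (R1 *\<^sub>R e)" shows "G y \<bullet> e < 0"
proof -
  define w where "w = e - ((e \<bullet> y) / R1\<^sup>2) *\<^sub>R y"
  have yy: "y \<bullet> y = R1\<^sup>2" using y by (simp add: dot_square_norm)
  have wy: "w \<bullet> y = 0" using yy R1 by (simp add: w_def inner_diff_left)
  have w0: "w \<noteq> 0"
  proof
    assume "w = 0"
    then have ek: "e = ((e \<bullet> y) / R1\<^sup>2) *\<^sub>R y" by (simp add: w_def)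
    define k where "k = (e \<bullet> y) / R1\<^sup>2"
    have ek: "e = k *\<^sub>R y" using ek by (simp add: k_def)
    have "\<bar>k\<bar> * R1 = 1" using arg_cong[OF ek, of norm] e y by simp
    then have "R1 * k = 1 \<or> R1 * k = -1" by (auto simp: abs_if mult.commute split: if_splits)
    moreover have "R1 *\<^sub>R e = (R1 * k) *\<^sub>R y" using ek by simp
    ultimately show False using y(2,3) by auto
  qed
  have "w \<bullet> w = w \<bullet> e" using wy by (subst (2) w_def) (simp add: inner_diff_right)
  then have we: "0 < w \<bullet> e" using w0 by (metis inner_gt_zero_iff)
  have "G y \<bullet> sgn w < 0"
  proof (rule grad_outer_neg)
    show "norm (sgn w) = 1" using w0 by (simp add: norm_sgn)
    show "0 < sgn w \<bullet> e" using we w0 by (simp add: sgn_div_norm)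
    show "sgn w \<bullet> y = 0" using wy by (simp add: sgn_div_norm)
  qed fact
  then have "G y \<bullet> w < 0" using w0 by (simp add: sgn_div_norm mult_less_0_iff field_simps)
  then show ?thesis using neumann[OF y(1)] by (simp add: w_def inner_diff_right)
qed

lemma radial_outer:
  assumes y: "norm y = R1"
  shows "0 \<le> G y \<bullet> (y - c)" and "y \<noteq> R1 *\<^sub>R e \<Longrightarrow> y \<noteq> - (R1 *\<^sub>R e) \<Longrightarrow> 0 < G y \<bullet> (y - c)"
proof -
  have eq: "G y \<bullet> (y - c) = - s * (G y \<bullet> e)"
    using neumann[OF y] by (simp add: inner_diff_right c_def)
  show pos: "0 < G y \<bullet> (y - c)" if "y \<noteq> R1 *\<^sub>R e" "y \<noteq> - (R1 *\<^sub>R e)"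
    unfolding eq using grad_outer_e_neg[OF y that] s by (simp add: mult_pos_neg)
  \<comment> \<open>At the poles \<open>e\<close> is parallel to \<open>y\<close>, so the Neumann
    condition itself gives equality.\<close>
  have "G y \<bullet> e = 0" if "y = R1 *\<^sub>R e \<or> y = - (R1 *\<^sub>R e)"
    using neumann[OF y] that R1 by auto
  then show "0 \<le> G y \<bullet> (y - c)" using pos eq by fastforce
qed

text \<open>As \<open>G\<close> is only known to be once differentiable, the Laplacian of \<open>G x \<bullet> (x - c)\<close> is
  replaced by that of the difference quotients of the dilations of \<open>u\<close> about \<open>c\<close>.\<close>

lemma no_interior_min:
  assumes \<tau>': "0 < \<tau>" and z: "z \<in> \<Omega>" and eq: "G z \<bullet> (z - c) = m * u z"
    and ge: "\<And>x. x \<in> \<Omega> \<Longrightarrow> m * u x \<le> G x \<bullet> (x - c)"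
  shows False
proof -
  obtain r2 where r2: "0 < r2" "cball z r2 \<subseteq> \<Omega>"
    using open_\<Omega> z open_contains_cball by blast
  define r where "r = r2 / 2"
  have r: "0 < r" using r2 by (simp add: r_def)
  let ?B = "cball z r2"
  have BK: "?B \<subseteq> K" using r2 \<Omega>_K by auto
  have rB: "cball z r \<subseteq> ?B" using r2 by (auto simp: r_def)
  obtain \<eta> where \<eta>: "0 < \<eta>" "\<And>y. y \<in> ?B \<Longrightarrow> \<eta> \<le> u y"
    using compact_pos_lower_bound[OF compact_cball continuous_on_subset[OF u_cont BK]] u_pos r2(2) by blast
  \<comment> \<open>The penalty \<open>\<delta> * (norm (x - z))^2\<close> forces the minimum off
    the boundary of the small ball and adds \<open>\<delta> * (2 * DIM('a))\<close>, at most
    \<open>\<tau> * \<eta>\<close>, to the Laplacian.\<close>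
  define \<delta> where "\<delta> = \<tau> * \<eta> / (\<tau> * r\<^sup>2 + 2 * DIM('a))"
  have den: "0 < \<tau> * r\<^sup>2 + 2 * DIM('a)" using \<tau>' by (simp add: add_nonneg_pos)
  have \<delta>: "0 < \<delta>" using \<tau>' \<eta> den by (simp add: \<delta>_def)
  have \<delta>eq: "\<delta> * (\<tau> * r\<^sup>2 + 2 * DIM('a)) = \<tau> * \<eta>" using den by (simp add: \<delta>_def)
  define \<epsilon> where "\<epsilon> = min (\<delta> * r\<^sup>2 / 4) (\<eta> / 2)"
  have \<epsilon>: "0 < \<epsilon>" "\<epsilon> \<le> \<delta> * r\<^sup>2 / 4" "\<epsilon> \<le> \<eta> / 2" using \<delta> r \<eta> by (auto simp: \<epsilon>_def)
  define D where "D = R1 + s"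
  have D: "0 < D" using R1 s by (simp add: D_def)
  have xD: "norm (x - c) \<le> D" if "x \<in> K" for x
    using norm_triangle_ineq4[of x c] norm_c that by (simp add: K_iff D_def)
  have "uniformly_continuous_on K G" by (rule compact_uniformly_continuous[OF G_cont compact_K])
  then obtain d where d: "0 < d" "\<And>x y. x \<in> K \<Longrightarrow> y \<in> K \<Longrightarrow> dist y x < d \<Longrightarrow> dist (G y) (G x) < \<epsilon> / D"
    unfolding uniformly_continuous_on_def using \<epsilon>(1) D by (metis divide_pos_pos)
  \<comment> \<open>A dilation moves points of \<open>K\<close> by at most \<open>h * D\<close>:
    less than \<open>d\<close>, for the uniform continuity of \<open>G\<close>, and at most
    \<open>r\<close>, to stay in the ball of radius \<open>2 * r\<close>.\<close>
  define h where "h = min (d / (2 * D)) (r / D)"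
  have h: "0 < h" using d D r by (simp add: h_def)
  have hD: "h * D < d" "h * D \<le> r"
  proof -
    have "h \<le> d / (2 * D)" "h \<le> r / D" by (simp_all add: h_def)
    then have "h * (2 * D) \<le> d" "h * D \<le> r" using D by (simp_all add: pos_le_divide_eq)
    then show "h * D < d" "h * D \<le> r" using d by auto
  qed
  define t where "t = 1 + h"
  define p where "p \<theta> x = c + \<theta> *\<^sub>R (x - c)" for \<theta> x
  have px: "norm (p \<theta> x - x) \<le> h * D" if "1 \<le> \<theta>" "\<theta> \<le> t" "x \<in> K" for \<theta> x
  proof -
    have "p \<theta> x - x = (\<theta> - 1) *\<^sub>R (x - c)" by (simp add: p_def algebra_simps)
    then have "norm (p \<theta> x - x) = (\<theta> - 1) * norm (x - c)" using that by simp
    also have "\<dots> \<le> h * D" using that xD[of x] h by (intro mult_mono) (auto simp: t_def)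
    finally show ?thesis .
  qed
  have pB: "p \<theta> x \<in> ?B" if "1 \<le> \<theta>" "\<theta> \<le> t" "x \<in> cball z r" for \<theta> x
  proof -
    have "norm (p \<theta> x - x) \<le> r" using px[OF that(1,2)] that(3) rB BK hD by force
    moreover have "norm (z - p \<theta> x) \<le> norm (z - x) + norm (p \<theta> x - x)"
      using norm_triangle_ineq4[of "z - x" "p \<theta> x - x"] by simp
    ultimately show ?thesis using that(3) by (simp add: r_def dist_norm)
  qed
  have quot: "\<bar>(u (p t x) - u x) / h - G x \<bullet> (x - c)\<bar> \<le> \<epsilon>" if x: "x \<in> cball z r" for x
  proof -
    have "\<exists>\<theta>>1. \<theta> < t \<and> u (p t x) - u (p 1 x) = (t - 1) * (G (p \<theta> x) \<bullet> (x - c))"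
    proof (rule MVT2)
      show "1 < t" using h by (simp add: t_def)
      fix \<theta> assume "1 \<le> \<theta>" "\<theta> \<le> t"
      then have "GDERIV u (p \<theta> x) :> G (p \<theta> x)" using pB[OF _ _ x] r2 grad_u by blast
      then show "((\<lambda>\<theta>. u (p \<theta> x)) has_real_derivative G (p \<theta> x) \<bullet> (x - c)) (at \<theta>)"
        unfolding p_def by (rule GDERIV_along_line)
    qed
    then obtain \<theta> where \<theta>: "1 < \<theta>" "\<theta> < t" "u (p t x) - u (p 1 x) = (t - 1) * (G (p \<theta> x) \<bullet> (x - c))"
      by auto
    have xK: "x \<in> K" using x rB BK by auto
    have "(u (p t x) - u x) / h = G (p \<theta> x) \<bullet> (x - c)"
      using \<theta>(3) h by (simp add: p_def t_def)
    then have "\<bar>(u (p t x) - u x) / h - G x \<bullet> (x - c)\<bar> = \<bar>(G (p \<theta> x) - G x) \<bullet> (x - c)\<bar>"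
      by (simp add: inner_diff_left)
    also have "\<dots> \<le> norm (G (p \<theta> x) - G x) * norm (x - c)" by (rule Cauchy_Schwarz_ineq2)
    also have "\<dots> \<le> \<epsilon> / D * D"
    proof (rule mult_mono)
      have "dist (p \<theta> x) x < d" using px[of \<theta> x] \<theta> xK hD by (simp add: dist_norm)
      moreover have "p \<theta> x \<in> K" using pB[OF _ _ x] \<theta> BK by auto
      ultimately show "norm (G (p \<theta> x) - G x) \<le> \<epsilon> / D" using d(2)[OF xK] by (simp add: dist_norm less_imp_le)
    qed (use xD[OF xK] \<epsilon> D in auto)
    finally show ?thesis using D by simp
  qed
  \<comment> \<open>Up to an error \<epsilon> this is \<open>G x \<bullet> (x - c) - m * u x\<close>
    plus the penalty: at most \<epsilon> at \<open>z\<close>, but at least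
    \<open>\<delta> * r^2 - \<epsilon>\<close> on the boundary of the ball.\<close>
  define f where "f x = (1 / h) * (u (p t x) - u x) - m * u x + \<delta> * (norm (x - z))\<^sup>2" for x
  define F where "F x = (1 / h) *\<^sub>R (t *\<^sub>R G (p t x) - G x) - m *\<^sub>R G x + \<delta> *\<^sub>R (2 *\<^sub>R (x - z))" for x
  have lapf: "has_laplacian f F ((1 / h) * (t\<^sup>2 * (- \<tau> * u (p t x)) - (- \<tau> * u x)) - m * (- \<tau> * u x)
      + \<delta> * (2 * DIM('a))) x" if "x \<in> cball z r" for x
  proof -
    have 1: "p t x \<in> \<Omega>" using pB[of t x] that h r2 by (auto simp: t_def)
    have "x \<in> \<Omega>" using that rB r2 by auto
    then have "has_laplacian f F ((1 / h) * (t\<^sup>2 * (- \<tau> * u (p t x)) - (- \<tau> * u x)) - m * (- \<tau> * u x)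
      + \<delta> * real (2 * DIM('a))) x"
      unfolding f_def F_def p_def
      by (intro has_laplacian_add has_laplacian_diff has_laplacian_cmult has_laplacian_dist_sq lap
          has_laplacian_dilation) (use 1 in \<open>auto simp: p_def\<close>)
    then show ?thesis by simp
  qed
  have fge: "- \<epsilon> + \<delta> * (norm (x - z))\<^sup>2 \<le> f x" if "x \<in> cball z r" for x
  proof -
    have "x \<in> \<Omega>" using that rB r2 by blast
    then show ?thesis using quot[OF that] ge[of x] unfolding f_def by (auto simp: abs_le_iff)
  qed
  have fz: "f z \<le> \<epsilon>" using quot[of z] eq r unfolding f_def by (auto simp: abs_le_iff)
  have fc: "continuous_on (cball z r) f"
    using lapf has_laplacian_imp_GDERIV unfolding gderiv_def
    by (intro continuous_at_imp_continuous_on) (blast intro: has_derivative_continuous)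
  obtain x where x: "x \<in> cball z r" "\<And>y. y \<in> cball z r \<Longrightarrow> f x \<le> f y"
    using continuous_attains_inf[OF compact_cball _ fc] r by auto
  have fx: "f x \<le> \<epsilon>" using x(2)[of z] fz r by auto
  have "norm (x - z) < r"
  proof (rule ccontr)
    assume "\<not> norm (x - z) < r"
    then have "norm (x - z) = r" using x(1) by (simp add: dist_norm norm_minus_commute)
    then have "\<delta> * r\<^sup>2 \<le> 2 * \<epsilon>" using fge[OF x(1)] fx by simp
    moreover have "0 < \<delta> * r\<^sup>2" using \<delta> r by simp
    ultimately show False using \<epsilon>(2) by simp
  qed
  then have "\<forall>\<^sub>F y in nhds x. y \<in> ball z r"
    by (intro eventually_nhds_in_open) (auto simp: dist_norm norm_minus_commute)
  then have "\<forall>\<^sub>F y in nhds x. f x \<le> f y"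
    by (rule eventually_mono) (auto intro!: x(2))
  from laplacian_nonneg_at_min[OF lapf[OF x(1)] this]
  have L: "0 \<le> (1 / h) * (t\<^sup>2 * (- \<tau> * u (p t x)) - (- \<tau> * u x)) - m * (- \<tau> * u x) + \<delta> * (2 * DIM('a))" .
  \<comment> \<open>Since \<open>t^2 - 1 = h * (t + 1)\<close>, division by \<open>h\<close> leaves
    the source \<open>(t + 1) * u (p t x) >= 2 * \<eta>\<close>, which outweighs the error
    \<epsilon> and the penalty.\<close>
  also have "\<dots> = - \<tau> * (f x - \<delta> * (norm (x - z))\<^sup>2) - \<tau> * ((t + 1) * u (p t x)) + \<delta> * (2 * DIM('a))"
    using h by (simp add: f_def t_def field_simps power2_eq_square)
  also have "\<dots> \<le> \<tau> * \<epsilon> - \<tau> * (2 * \<eta>) + \<delta> * (2 * DIM('a))"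
  proof -
    have "- (f x - \<delta> * (norm (x - z))\<^sup>2) \<le> \<epsilon>" using fge[OF x(1)] by simp
    then have "\<tau> * (- (f x - \<delta> * (norm (x - z))\<^sup>2)) \<le> \<tau> * \<epsilon>" using \<tau>' by simp
    moreover have "2 * \<eta> \<le> (t + 1) * u (p t x)"
      using \<eta>(2)[OF pB[OF _ _ x(1)], of t] h \<eta>(1) by (intro mult_mono) (auto simp: t_def)
    then have "\<tau> * (2 * \<eta>) \<le> \<tau> * ((t + 1) * u (p t x))" using \<tau>' by simp
    ultimately show ?thesis by linarith
  qed
  also have "\<dots> < 0"
  proof -
    have "\<tau> * \<epsilon> \<le> \<tau> * (\<eta> / 2)" using \<tau>' \<epsilon>(3) by simp
    moreover have "0 \<le> \<delta> * (\<tau> * r\<^sup>2)" using \<delta> \<tau>' by simp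
    moreover have "0 < \<tau> * \<eta>" using \<tau>' \<eta> by simp
    ultimately show ?thesis using \<delta>eq by (simp add: algebra_simps)
  qed
  finally show False by simp
qed

text \<open>The quotient is minimised over the compact set \<open>T\<close> where the radial
  derivative is not positive. By Hopf's lemma \<open>T\<close> avoids the inner sphere, so
  \<open>u\<close> is positive on it, and outside \<open>T\<close> the lower bound
  \<open>m * u\<close> with \<open>m \<le> 0\<close> is automatic.\<close>

lemma radial_derivative_pos:
  assumes \<tau>': "0 < \<tau>" and x: "x \<in> K" "x \<noteq> R1 *\<^sub>R e" "x \<noteq> - (R1 *\<^sub>R e)"
  shows "0 < G x \<bullet> (x - c)"
proof -
  define T where "T = {x \<in> K. G x \<bullet> (x - c) \<le> 0}"
  have interior: "0 < G y \<bullet> (y - c)" if y: "y \<in> \<Omega>" for y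
  proof (rule ccontr)
    assume neg: "\<not> 0 < G y \<bullet> (y - c)"
    then have yT: "y \<in> T" using y \<Omega>_K by (simp add: T_def)
    have Wc: "continuous_on K (\<lambda>x. G x \<bullet> (x - c))" by (intro continuous_intros G_cont)
    have "closed T"
      using continuous_closed_preimage[OF Wc compact_imp_closed[OF compact_K] closed_atMost[of 0]]
      by (simp add: T_def vimage_def Int_def conj_commute)
    then have cT: "compact T"
      using compact_Int_closed[OF compact_K] by (metis (no_types, lifting) T_def inf.absorb2 mem_Collect_eq subsetI)
    have TK: "T \<subseteq> K" by (auto simp: T_def)
    have up: "0 < u x" if "x \<in> T" for x
    proof (rule u_pos')
      show "x \<in> K" using that TK by blast
      have "norm (x - c) \<noteq> R0" using that grad_inner_pos[of x] by (auto simp: T_def)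
      then show "R0 < norm (x - c)" using \<open>x \<in> K\<close> by (simp add: K_iff)
    qed
    have "continuous_on T (\<lambda>x. (G x \<bullet> (x - c)) / u x)"
      by (intro continuous_intros continuous_on_subset[OF u_cont TK] continuous_on_subset[OF G_cont TK])
         (use up in force)
    then obtain z where z: "z \<in> T" "\<And>x. x \<in> T \<Longrightarrow> (G z \<bullet> (z - c)) / u z \<le> (G x \<bullet> (x - c)) / u x"
      using continuous_attains_inf[OF cT] yT by blast
    define m where "m = (G z \<bullet> (z - c)) / u z"
    have m0: "m \<le> 0" using z(1) up[OF z(1)] by (simp add: m_def T_def divide_nonpos_pos)
    have ge: "m * u x \<le> G x \<bullet> (x - c)" if "x \<in> \<Omega>" for x
    proof (cases "x \<in> T")
      case True
      then show ?thesis using z(2)[OF True] up[OF True] by (simp add: m_def pos_le_divide_eq)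
    next
      case False
      then have "0 < G x \<bullet> (x - c)" using that \<Omega>_K by (auto simp: T_def)
      moreover have "m * u x \<le> 0" using m0 u_pos[OF that] by (simp add: mult_nonpos_nonneg)
      ultimately show ?thesis by linarith
    qed
    have "\<exists>z'\<in>\<Omega>. G z' \<bullet> (z' - c) = m * u z'"
    proof (cases "z \<in> \<Omega>")
      case True
      then show ?thesis using up[OF z(1)] by (intro bexI[of _ z]) (auto simp: m_def)
    next
      case False
      have "R0 \<noteq> norm (z - c)" using z(1) grad_inner_pos[of z] by (auto simp: T_def)
      then have "norm z = R1" using z(1) False by (auto simp: T_def K_iff \<Omega>_iff)
      \<comment> \<open>A minimum on the outer sphere forces \<open>m = 0\<close>, and then the
        interior point \<open>y\<close> attains it as well.\<close>
      from radial_outer(1)[OF this] have "0 \<le> m" using up[OF z(1)] by (simp add: m_def)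
      then have "m = 0" using m0 by simp
      then show ?thesis using ge[OF y] neg y by (intro bexI[of _ y]) auto
    qed
    then show False using no_interior_min[OF \<tau>' _ _ ge] by blast
  qed
  show ?thesis
  proof (cases "norm x = R1")
    case True then show ?thesis using radial_outer(2) x by blast
  next
    case False
    show ?thesis
    proof (cases "norm (x - c) = R0")
      case True then show ?thesis by (rule grad_inner_pos)
    next
      case inner: False
      show ?thesis by (rule interior) (use x(1) False inner in \<open>auto simp: K_iff \<Omega>_iff\<close>)
    qed
  qed
qed

end

section \<open>Test functions\<close>

lemma grad_eq:
  assumes "GDERIV f x :> D" shows "grad f x = D"
  unfolding grad_def
proof (rule the_equality)
  fix E assume "GDERIV f x :> E"
  with assms have "(\<lambda>h. h \<bullet> E) = (\<lambda>h. h \<bullet> D)"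
    unfolding gderiv_def using has_derivative_unique by blast
  from fun_cong[OF this, of "E - D"] have "(E - D) \<bullet> E = (E - D) \<bullet> D" .
  then have "(E - D) \<bullet> (E - D) = 0" by (simp add: inner_diff_right)
  then show "E = D" by simp
qed fact

lemma GDERIV_grad:
  assumes "f differentiable (at x)" shows "GDERIV f x :> grad f x"
proof -
  obtain f' where f': "(f has_derivative f') (at x)" using assms unfolding differentiable_def by blast
  interpret f': bounded_linear f' by (rule has_derivative_bounded_linear[OF f'])
  have "f' h = h \<bullet> (\<Sum>b\<in>Basis. f' b *\<^sub>R b)" for h
  proof -
    have "f' h = f' (\<Sum>b\<in>Basis. (h \<bullet> b) *\<^sub>R b)" by (simp add: euclidean_representation)
    then show ?thesis by (simp add: f'.sum f'.scaleR inner_sum_right mult.commute)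
  qed
  then have "f' = (\<lambda>h. h \<bullet> (\<Sum>b\<in>Basis. f' b *\<^sub>R b))" by (rule ext)
  then have "GDERIV f x :> (\<Sum>b\<in>Basis. f' b *\<^sub>R b)"
    using f' unfolding gderiv_def by simp
  with grad_eq[OF this] show ?thesis by simp
qed

lemma GDERIV_imp_differentiable: "GDERIV f x :> D \<Longrightarrow> f differentiable (at x)"
  unfolding gderiv_def differentiable_def by blast

lemma GDERIV_transform:
  assumes "GDERIV f x :> D" "open S" "x \<in> S" "\<And>y. y \<in> S \<Longrightarrow> f y = g y"
  shows "GDERIV g x :> D"
  using assms(1) unfolding gderiv_def
  by (rule has_derivative_transform_within_open[OF _ assms(2,3)]) (rule assms(4))

lemma C_k_on_SucD: "C_k_on (Suc k) f S \<Longrightarrow> C_k_on k f S"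
proof (induction k arbitrary: f)
  case 0
  then show ?case
    by (simp add: continuous_at_imp_continuous_on differentiable_imp_continuous_within)
next
  case (Suc k)
  from Suc.prems show ?case by (auto intro: Suc.IH)
qed

lemma C_k_on_const: "C_k_on k (\<lambda>x. c) UNIV"
proof (induction k arbitrary: c)
  case (Suc k)
  have "grad (\<lambda>x. c) x = 0" for x :: 'a by (rule grad_eq[OF GDERIV_const])
  then show ?case using Suc by simp
qed simp

lemma C_k_on_inner: "C_k_on k (\<lambda>x. x \<bullet> a) UNIV"
proof (cases k)
  case (Suc j)
  have D: "GDERIV (\<lambda>x. x \<bullet> a) x :> a" for x
    unfolding gderiv_def by (auto intro!: derivative_eq_intros)
  have "grad (\<lambda>x. x \<bullet> a) x = a" for x by (rule grad_eq[OF D])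
  then show ?thesis
    using GDERIV_imp_differentiable[OF D] by (simp add: Suc C_k_on_const)
qed (auto intro!: continuous_intros)

lemma C_k_on_add: "C_k_on k f UNIV \<Longrightarrow> C_k_on k g UNIV \<Longrightarrow> C_k_on k (\<lambda>x. f x + g x) UNIV"
proof (induction k arbitrary: f g)
  case (Suc k)
  then have "GDERIV (\<lambda>x. f x + g x) x :> grad f x + grad g x" for x
    by (intro GDERIV_add GDERIV_grad) auto
  then have "grad (\<lambda>x. f x + g x) = (\<lambda>x. grad f x + grad g x)" by (auto intro: grad_eq)
  then show ?case using Suc by (auto simp: inner_add_left)
qed (simp add: continuous_on_add)

lemma C_k_on_mult: "C_k_on k f UNIV \<Longrightarrow> C_k_on k g UNIV \<Longrightarrow> C_k_on k (\<lambda>x. f x * g x) UNIV"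
proof (induction k arbitrary: f g)
  case (Suc k)
  then have D: "GDERIV (\<lambda>x. f x * g x) x :> f x *\<^sub>R grad g x + g x *\<^sub>R grad f x" for x
    by (intro GDERIV_mult GDERIV_grad) auto
  then have eq: "grad (\<lambda>x. f x * g x) = (\<lambda>x. f x *\<^sub>R grad g x + g x *\<^sub>R grad f x)"
    by (auto intro: grad_eq)
  have "C_k_on k (\<lambda>x. f x * (grad g x \<bullet> b) + g x * (grad f x \<bullet> b)) UNIV" if "b \<in> Basis" for b
    using Suc.prems that by (intro C_k_on_add Suc.IH C_k_on_SucD[of k f] C_k_on_SucD[of k g]) auto
  then show ?case unfolding eq C_k_on.simps
    using GDERIV_imp_differentiable[OF D] by (auto simp: inner_add_left)
qed (simp add: continuous_on_mult)

lemma C_k_on_prod: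
  "finite I \<Longrightarrow> (\<And>i. i \<in> I \<Longrightarrow> C_k_on k (f i) UNIV) \<Longrightarrow> C_k_on k (\<lambda>x. \<Prod>i\<in>I. f i x) UNIV"
  by (induction rule: finite_induct) (auto intro: C_k_on_mult C_k_on_const)

text \<open>The family \<open>exp (- 1 / t) / t ^ n\<close>, extended by zero, is closed under differentiation up to
  linear combinations.\<close>

definition flat :: "nat \<Rightarrow> real \<Rightarrow> real" where
  "flat n t = (if 0 < t then exp (- 1 / t) / t ^ n else 0)"

lemma flat_tendsto_0: "(flat n \<longlongrightarrow> 0) (at_right 0)"
proof -
  have "((\<lambda>x. x ^ n / exp x) \<longlongrightarrow> (0::real)) at_top" by (rule tendsto_power_div_exp_0)
  then have "((\<lambda>t. inverse t ^ n / exp (inverse t)) \<longlongrightarrow> (0::real)) (at_right 0)"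
    by (rule filterlim_compose[OF _ filterlim_inverse_at_top_right])
  then show ?thesis
  proof (rule Lim_transform_eventually)
    show "\<forall>\<^sub>F t in at_right 0. inverse t ^ n / exp (inverse t) = flat n t"
      unfolding eventually_at_right_field
      by (auto intro!: exI[of _ 1] simp: flat_def exp_minus field_simps)
  qed
qed

text \<open>At 0 the right-hand difference quotient of \<open>flat n\<close> is
  \<open>flat (Suc n)\<close> itself, so the limit of the whole family at 0 settles the only
  delicate point.\<close>

lemma DERIV_flat:
  "(flat n has_real_derivative flat (n + 2) t - n * flat (n + 1) t) (at t)"
proof -
  consider "t > 0" | "t < 0" | "t = 0" by linarith
  then show ?thesis
  proof cases
    case 1
    have D: "((\<lambda>t. exp (- 1 / t) / t ^ n) has_real_derivative flat (n + 2) t - n * flat (n + 1) t) (at t)"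
    proof -
      have E: "((\<lambda>t. exp (- 1 / t)) has_real_derivative exp (- 1 / t) / t\<^sup>2) (at t)"
        using 1 by (auto intro!: derivative_eq_intros simp: power2_eq_square)
      have "real n * t ^ (n - 1) = real n * t ^ n / t" using 1 by (cases n) auto
      then have P: "((\<lambda>t. t ^ n) has_real_derivative real n * t ^ n / t) (at t)"
        using DERIV_pow[of n t] by simp
      show ?thesis
        by (rule DERIV_cong[OF DERIV_divide[OF E P]])
           (use 1 in \<open>auto simp: flat_def field_simps power2_eq_square\<close>)
    qed
    show ?thesis
      by (rule has_field_derivative_transform_within_open[OF D open_greaterThan[of 0]])
         (use 1 in \<open>auto simp: flat_def\<close>)
  next
    case 2
    have "((\<lambda>t. 0) has_real_derivative flat (n + 2) t - n * flat (n + 1) t) (at t)"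
      using 2 by (auto simp: flat_def)
    then show ?thesis
      by (rule has_field_derivative_transform_within_open[OF _ open_lessThan[of 0]])
         (use 2 in \<open>auto simp: flat_def\<close>)
  next
    case 3
    have "((\<lambda>h. (flat n (0 + h) - flat n 0) / h) \<longlongrightarrow> 0) (at 0)"
    proof (rule filterlim_split_at)
      have "\<forall>\<^sub>F h::real in at_left 0. h < 0" by (auto simp: eventually_at_left_field intro: exI[of _ "-1"])
      then have "\<forall>\<^sub>F h in at_left 0. 0 = (flat n (0 + h) - flat n 0) / h"
        by eventually_elim (auto simp: flat_def)
      then show "((\<lambda>h. (flat n (0 + h) - flat n 0) / h) \<longlongrightarrow> 0) (at_left 0)"
        by (rule Lim_transform_eventually[OF tendsto_const])
      have "\<forall>\<^sub>F h::real in at_right 0. 0 < h" by (auto simp: eventually_at_right_field intro: exI[of _ 1])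
      then have "\<forall>\<^sub>F h in at_right 0. flat (Suc n) h = (flat n (0 + h) - flat n 0) / h"
        by eventually_elim (auto simp: flat_def field_simps)
      then show "((\<lambda>h. (flat n (0 + h) - flat n 0) / h) \<longlongrightarrow> 0) (at_right 0)"
        by (rule Lim_transform_eventually[OF flat_tendsto_0])
    qed
    then show ?thesis using 3 by (simp add: DERIV_def flat_def)
  qed
qed

text \<open>The induction keeps \<open>n\<close> arbitrary, because every derivative raises the
  index by 1 and 2.\<close>

lemma C_k_on_flat:
  assumes p: "\<And>k. C_k_on k p UNIV"
  shows "C_k_on k (\<lambda>x. flat n (p x)) UNIV"
proof (induction k arbitrary: n)
  case 0
  have "isCont (flat n) t" for t using DERIV_flat DERIV_isCont by blast
  then have "continuous_on UNIV (flat n)" by (simp add: continuous_at_imp_continuous_on)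
  then show ?case using continuous_on_compose2[of UNIV "flat n" UNIV p] p[of 0] by simp
next
  case (Suc k)
  have "p differentiable (at x)" for x using p[of 1] by simp
  then have D: "GDERIV (\<lambda>x. flat n (p x)) x :>
      (flat (n + 2) (p x) - n * flat (n + 1) (p x)) *\<^sub>R grad p x" for x
    by (intro GDERIV_DERIV_compose GDERIV_grad DERIV_flat)
  have eq: "grad (\<lambda>x. flat n (p x)) x = (flat (n + 2) (p x) + (- n) * flat (n + 1) (p x)) *\<^sub>R grad p x" for x
    using grad_eq[OF D] by simp
  have "C_k_on k (\<lambda>x. (flat (n + 2) (p x) + (- n) * flat (n + 1) (p x)) * (grad p x \<bullet> b)) UNIV"
    if "b \<in> Basis" for b
    using p[of "Suc k"] that by (intro C_k_on_mult C_k_on_add C_k_on_const Suc.IH) auto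
  then show ?case unfolding C_k_on.simps eq
    using GDERIV_imp_differentiable[OF D] by simp
qed

text \<open>A smooth product bump. In a nonempty box the argument of \<open>flat\<close> is positive
  exactly inside, and there the factor \<open>Suc m\<close> drives \<open>exp (- 1 / t)\<close> to
  1, so the limit is the indicator of the box.\<close>

definition box_bump :: "nat \<Rightarrow> 'a::euclidean_space \<Rightarrow> 'a \<Rightarrow> 'a \<Rightarrow> real" where
  "box_bump m a b x = (\<Prod>i\<in>Basis. flat 0 (Suc m * ((x \<bullet> i - a \<bullet> i) * (b \<bullet> i - x \<bullet> i))))"

lemma box_bump_test:
  assumes "box a b \<noteq> {}" "cbox a b \<subseteq> \<Omega>"
  shows "box_bump m a b \<in> test_functions \<Omega>"
proof -
  have C: "C_k_on k (\<lambda>x. Suc m * ((x \<bullet> i + - (a \<bullet> i)) * (b \<bullet> i + (- 1) * (x \<bullet> i)))) UNIV" for k i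
    by (intro C_k_on_mult C_k_on_add C_k_on_const C_k_on_inner)
  have "C_k_on k (box_bump m a b) UNIV" for k
    unfolding box_bump_def using C_k_on_flat[OF C]
    by (intro C_k_on_prod) auto
  moreover have "{x. box_bump m a b x \<noteq> 0} \<subseteq> cbox a b"
  proof
    fix x assume x: "x \<in> {x. box_bump m a b x \<noteq> 0}"
    have "a \<bullet> i \<le> x \<bullet> i \<and> x \<bullet> i \<le> b \<bullet> i" if "i \<in> Basis" for i
    proof -
      have "flat 0 (Suc m * ((x \<bullet> i - a \<bullet> i) * (b \<bullet> i - x \<bullet> i))) \<noteq> 0"
        using x that by (auto simp: box_bump_def)
      then have "0 < (x \<bullet> i - a \<bullet> i) * (b \<bullet> i - x \<bullet> i)"
        by (auto simp: flat_def zero_less_mult_iff split: if_splits)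
      moreover have "a \<bullet> i < b \<bullet> i" using assms(1) that by (simp add: box_ne_empty)
      ultimately show ?thesis by (auto simp: zero_less_mult_iff)
    qed
    then show "x \<in> cbox a b" by (simp add: mem_box)
  qed
  then have cl: "closure {x. box_bump m a b x \<noteq> 0} \<subseteq> cbox a b"
    by (simp add: closure_minimal closed_cbox)
  moreover have "compact (closure {x. box_bump m a b x \<noteq> 0})"
    using cl by (meson bounded_cbox bounded_subset closed_closure compact_eq_bounded_closed)
  ultimately show ?thesis using assms(2) by (auto simp: test_functions_def)
qed

lemma box_bump_bounds: "0 \<le> box_bump m a b x" "box_bump m a b x \<le> 1"
  unfolding box_bump_def by (auto intro!: prod_nonneg prod_le_1 simp: flat_def)

lemma box_bump_tendsto:
  assumes "box a b \<noteq> {}"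
  shows "(\<lambda>m. box_bump m a b x) \<longlonglongrightarrow> indicator (box a b) x"
proof (cases "x \<in> box a b")
  case True
  have "(\<lambda>m. flat 0 (Suc m * ((x \<bullet> i - a \<bullet> i) * (b \<bullet> i - x \<bullet> i)))) \<longlonglongrightarrow> 1" if "i \<in> Basis" for i
  proof -
    let ?y = "(x \<bullet> i - a \<bullet> i) * (b \<bullet> i - x \<bullet> i)"
    have y: "0 < ?y" using True that by (simp add: mem_box)
    have "(\<lambda>m. exp (- (inverse ?y) * inverse (real (Suc m)))) \<longlonglongrightarrow> exp (- (inverse ?y) * 0)"
      by (intro tendsto_intros LIMSEQ_inverse_real_of_nat)
    moreover have "flat 0 (Suc m * ?y) = exp (- (inverse ?y) * inverse (real (Suc m)))" for m
    proof -
      have "0 < real (Suc m) * ?y" by (rule mult_pos_pos[OF _ y]) simp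
      moreover have "flat 0 z = exp (- 1 / z)" if "0 < z" for z using that by (simp add: flat_def)
      ultimately have "flat 0 (real (Suc m) * ?y) = exp (- 1 / (real (Suc m) * ?y))" by blast
      then show ?thesis by (simp add: divide_inverse)
    qed
    ultimately show ?thesis by simp
  qed
  then have "(\<lambda>m. box_bump m a b x) \<longlonglongrightarrow> (\<Prod>i\<in>(Basis::'a set). 1)"
    unfolding box_bump_def by (intro tendsto_prod)
  then show ?thesis using True by simp
next
  case False
  then obtain i where i: "i \<in> Basis" "\<not> (a \<bullet> i < x \<bullet> i \<and> x \<bullet> i < b \<bullet> i)" by (auto simp: mem_box)
  have "a \<bullet> i < b \<bullet> i" using assms i(1) by (simp add: box_ne_empty)
  then have "(x \<bullet> i - a \<bullet> i) * (b \<bullet> i - x \<bullet> i) \<le> 0" using i(2) by (auto simp: mult_le_0_iff)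
  then have "real (Suc m) * ((x \<bullet> i - a \<bullet> i) * (b \<bullet> i - x \<bullet> i)) \<le> 0" for m
    by (rule mult_nonneg_nonpos[rotated]) simp
  then have "flat 0 (real (Suc m) * ((x \<bullet> i - a \<bullet> i) * (b \<bullet> i - x \<bullet> i))) = 0" for m
    unfolding flat_def by (meson not_less)
  then have "box_bump m a b x = 0" for m unfolding box_bump_def using i(1) by (intro prod_zero) auto
  then show ?thesis using False by simp
qed

text \<open>Boxes form an intersection-stable generator of the Borel sets, so the integral vanishes
  over every Borel set and the density is zero. A Borel representative \<open>g\<close> is taken
  because the induction runs over Borel sets.\<close>

lemma box_integrals_zero_imp_AE_zero:
  fixes f :: "'a::euclidean_space \<Rightarrow> real"
  assumes f: "integrable lebesgue f"
    and zero: "\<And>a b. (LINT x:box a b|lebesgue. f x) = 0"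
  shows "AE x in lebesgue. f x = 0"
proof -
  obtain g where g: "g \<in> borel_measurable lborel" "AE x in lborel. f x = g x"
    using completion_ex_borel_measurable_real[of f lborel] f by auto
  have AE: "AE x in lebesgue. f x = g x" using g(2) by (rule AE_completion)
  have gi: "integrable lborel g"
  proof -
    have "g \<in> borel_measurable lebesgue" using g(1) by (rule measurable_completion)
    then have "integrable lebesgue g" using f AE by (blast intro: integrable_cong_AE_imp)
    then show ?thesis using integrable_completion[OF g(1)] by simp
  qed
  have set_eq: "(LINT x:A|lborel. g x) = (LINT x:A|lebesgue. f x)" if A[measurable]: "A \<in> sets borel" for A
  proof -
    have "(LINT x:A|lborel. g x) = (LINT x:A|lebesgue. g x)"
      unfolding set_lebesgue_integral_def using g(1) by (subst integral_completion) auto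
    also have "\<dots> = (LINT x:A|lebesgue. f x)"
      unfolding set_lebesgue_integral_def
    proof (rule integral_cong_AE)
      show "(\<lambda>x. indicat_real A x *\<^sub>R g x) \<in> borel_measurable lebesgue"
        using g(1) by (intro measurable_completion) auto
      show "(\<lambda>x. indicat_real A x *\<^sub>R f x) \<in> borel_measurable lebesgue"
        using f by (intro borel_measurable_scaleR borel_measurable_indicator) auto
      show "AE x in lebesgue. indicat_real A x *\<^sub>R g x = indicat_real A x *\<^sub>R f x"
        using AE by eventually_elim simp
    qed
    finally show ?thesis .
  qed
  have gs: "set_integrable lborel A g" if "A \<in> sets borel" for A
    unfolding set_integrable_def using that gi by (intro integrable_mult_indicator) auto
  \<comment> \<open>The whole space is exhausted by boxes; this total integral is what the
    complement step of the induction requires.\<close>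
  have g0: "(LINT x|lborel. g x) = 0"
  proof -
    define B where "B n = box (- real (Suc n) *\<^sub>R One) (real (Suc n) *\<^sub>R One :: 'a)" for n
    have "(\<lambda>n. LINT x|lborel. indicat_real (B n) x *\<^sub>R g x) \<longlonglongrightarrow> (LINT x|lborel. g x)"
    proof (rule integral_dominated_convergence[where w = "\<lambda>x. norm (g x)"])
      show "AE x in lborel. (\<lambda>n. indicat_real (B n) x *\<^sub>R g x) \<longlonglongrightarrow> g x"
      proof (rule AE_I2)
        fix x :: 'a
        obtain N where N: "norm x < real N" using reals_Archimedean2 by blast
        have "x \<in> B n" if "n \<ge> N" for n
        proof -
          have "\<bar>x \<bullet> i\<bar> < real (Suc n)" if "i \<in> Basis" for i
            using Basis_le_norm[OF that, of x] N \<open>n \<ge> N\<close> by simp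
          then have "- real (Suc n) < x \<bullet> i \<and> x \<bullet> i < real (Suc n)" if "i \<in> Basis" for i
            using that by (simp only: abs_less_iff) fastforce
          then show ?thesis by (simp add: B_def mem_box)
        qed
        then have "\<forall>\<^sub>F n in sequentially. indicat_real (B n) x *\<^sub>R g x = g x"
          unfolding eventually_sequentially by (intro exI[of _ N]) auto
        then show "(\<lambda>n. indicat_real (B n) x *\<^sub>R g x) \<longlonglongrightarrow> g x" by (rule tendsto_eventually)
      qed
      show "g \<in> borel_measurable lborel" by (rule g(1))
      show "(\<lambda>x. indicat_real (B n) x *\<^sub>R g x) \<in> borel_measurable lborel" for n
        using gs[of "B n"] unfolding set_integrable_def B_def by simp
      show "integrable lborel (\<lambda>x. norm (g x))" using gi by (rule integrable_norm)
      show "AE x in lborel. norm (indicat_real (B n) x *\<^sub>R g x) \<le> norm (g x)" for n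
        by (rule AE_I2) (simp add: indicator_def)
    qed
    moreover have "(LINT x|lborel. indicat_real (B n) x *\<^sub>R g x) = 0" for n
      using set_eq[of "B n"] zero unfolding B_def set_lebesgue_integral_def by simp
    ultimately show ?thesis by (simp add: LIMSEQ_const_iff)
  qed
  have all: "(LINT x:A|lborel. g x) = 0" if A: "A \<in> sets borel" for A
  proof -
    have "Int_stable (range (\<lambda>(a, b). box a b :: 'a set))" by (auto simp: Int_stable_def box_Int_box)
    moreover have "(range (\<lambda>(a, b). box a b :: 'a set)) \<subseteq> Pow UNIV" by auto
    moreover have "A \<in> sigma_sets UNIV (range (\<lambda>(a, b). box a b))"
      using A unfolding borel_eq_box by simp
    ultimately show ?thesis
    proof (induction rule: sigma_sets_induct_disjoint)
      case (basic A) then obtain a b where "A = box a b" by auto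
      then show ?case using set_eq[of A] zero[of a b] by simp
    next
      case empty then show ?case by (simp add: set_lebesgue_integral_def)
    next
      case (compl A)
      then have A: "A \<in> sets borel" by (simp add: borel_eq_box)
      have "(LINT x:UNIV - A|lborel. g x) + (LINT x:A|lborel. g x) = (LINT x:(UNIV - A) \<union> A|lborel. g x)"
        by (rule set_integral_Un[symmetric]) (use gs A in auto)
      also have "(UNIV - A) \<union> A = UNIV" by auto
      finally show ?case using compl g0 by (simp add: set_lebesgue_integral_def)
    next
      case (union F)
      then have F: "F i \<in> sets borel" for i by (auto simp: borel_eq_box subset_eq)
      have UF: "(\<Union>i. F i) \<in> sets borel" using F by auto
      have "(LINT x:(\<Union>i. F i)|lborel. g x) = (\<Sum>i. LINT x:F i|lborel. g x)"
        by (rule lebesgue_integral_countable_add)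
           (use F gs[OF UF] union(1) in \<open>auto simp: disjoint_family_on_def\<close>)
      then show ?case using union by simp
    qed
  qed
  have "AE x in lborel. g x = 0"
    by (rule density_unique_real[OF gi, where f' = "\<lambda>_. 0"]) (use all in \<open>auto simp: set_lebesgue_integral_def\<close>)
  then have "AE x in lebesgue. g x = 0" by (rule AE_completion)
  with AE show ?thesis by eventually_elim (rule trans)
qed

section \<open>Weak gradients\<close>

lemma set_lebesgue_integral_lborel:
  fixes f :: "'a::euclidean_space \<Rightarrow> 'b::euclidean_space"
  assumes "(\<lambda>x. indicator A x *\<^sub>R f x) \<in> borel_measurable borel"
  shows "(LINT x:A|lebesgue. f x) = (LINT x|lborel. indicator A x *\<^sub>R f x)"
  unfolding set_lebesgue_integral_def using assms by (subst integral_completion) auto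

lemma integrable_continuous_compact_support:
  fixes f :: "'a::euclidean_space \<Rightarrow> 'b::euclidean_space"
  assumes "continuous_on UNIV f" "compact T" "\<And>x. x \<notin> T \<Longrightarrow> f x = 0"
  shows "integrable lborel f"
proof -
  have "integrable lborel (\<lambda>x. indicator T x *\<^sub>R f x)"
    using assms by (intro borel_integrable_compact) (auto intro: continuous_on_subset)
  also have "(\<lambda>x. indicator T x *\<^sub>R f x) = f" using assms(3) by (auto simp: indicator_def fun_eq_iff)
  finally show ?thesis .
qed

lemma integral_translate:
  fixes f :: "'a::euclidean_space \<Rightarrow> 'b::{banach, second_countable_topology}"
  assumes [measurable]: "f \<in> borel_measurable borel"
  shows "(LINT x|lborel. f (x + c)) = (LINT x|lborel. f x)"
proof -
  have "(LINT x|lborel. f x) = (LINT x|distr lborel borel ((+) c). f x)" by (simp only: lborel_distr_plus)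
  also have "\<dots> = (LINT x|lborel. f (c + x))" by (subst integral_distr) auto
  finally show ?thesis by (simp add: add.commute)
qed

text \<open>By translation invariance the difference quotients of \<open>f\<close> have integral zero.\<close>

lemma integral_grad_compact_support:
  fixes f :: "'a::euclidean_space \<Rightarrow> real"
  assumes D: "\<And>x. GDERIV f x :> F x" and F: "continuous_on UNIV F"
    and T: "compact T" "\<And>x. x \<notin> T \<Longrightarrow> f x = 0" "\<And>x. x \<notin> T \<Longrightarrow> F x = 0"
  shows "(LINT x|lborel. F x) = 0"
proof -
  have fc: "continuous_on UNIV f"
    using D unfolding gderiv_def
    by (intro continuous_at_imp_continuous_on) (blast intro: has_derivative_continuous)
  have fi: "integrable lborel f" and Fi: "integrable lborel F"
    using fc F T by (auto intro: integrable_continuous_compact_support)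
  obtain M where M: "0 < M" "\<And>x. x \<in> T \<Longrightarrow> norm (F x) \<le> M"
  proof -
    have "bounded (F ` T)"
      using F T(1) by (meson compact_continuous_image compact_imp_bounded continuous_on_subset top_greatest)
    then show ?thesis using that unfolding bounded_pos by auto
  qed
  have FM: "norm (F x) \<le> M" for x using M T(3) by (cases "x \<in> T") auto
  obtain r where r: "\<And>x. x \<in> T \<Longrightarrow> norm x \<le> r" using compact_imp_bounded[OF T(1)] unfolding bounded_iff by auto
  have "(LINT x|lborel. F x) \<bullet> b = 0" if b: "b \<in> Basis" for b
  proof -
    define h where "h n = inverse (real (Suc n))" for n
    have h: "0 < h n" "h n \<le> 1" for n by (auto simp: h_def field_simps)
    have h0: "h \<longlonglongrightarrow> 0" unfolding h_def by (rule LIMSEQ_inverse_real_of_nat)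
    define q where "q n x = (f (x + h n *\<^sub>R b) - f x) / h n" for n x
    have line: "((\<lambda>t. f (x + t *\<^sub>R b)) has_real_derivative F (x + t *\<^sub>R b) \<bullet> b) (at t)" for x t
      by (rule GDERIV_along_line[OF D])
    \<comment> \<open>As steps are at most 1, the quotients are bounded by \<open>M\<close> and
      supported in one ball of radius \<open>r + 1\<close>, which provides the dominating
      function.\<close>
    have mean: "\<exists>z. z > 0 \<and> z < h n \<and> q n x = F (x + z *\<^sub>R b) \<bullet> b" for n x
    proof -
      have "\<exists>z>0. z < h n \<and> f (x + h n *\<^sub>R b) - f (x + 0 *\<^sub>R b) = (h n - 0) * (F (x + z *\<^sub>R b) \<bullet> b)"
        by (rule MVT2) (use h line in auto)
      then show ?thesis using h[of n] by (auto simp: q_def)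
    qed
    have qm: "q n \<in> borel_measurable borel" for n
      unfolding q_def
      by (intro borel_measurable_continuous_onI continuous_intros continuous_on_compose2[OF fc]) (use h[of n] in auto)
    have "(\<lambda>n. LINT x|lborel. q n x) \<longlonglongrightarrow> (LINT x|lborel. F x \<bullet> b)"
    proof (rule integral_dominated_convergence[where w = "\<lambda>x. indicat_real (cball 0 (r + 1)) x * M"])
      show "(\<lambda>x. F x \<bullet> b) \<in> borel_measurable lborel" using Fi by auto
      show "q n \<in> borel_measurable lborel" for n using qm by simp
      show "integrable lborel (\<lambda>x. indicat_real (cball 0 (r + 1) :: 'a set) x * M)"
        using borel_integrable_compact[of "cball 0 (r + 1) :: 'a set" "\<lambda>_. M"] by simp
      show "AE x in lborel. (\<lambda>n. q n x) \<longlonglongrightarrow> F x \<bullet> b"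
      proof (rule AE_I2)
        fix x
        have "((\<lambda>k. (f (x + (0 + k) *\<^sub>R b) - f (x + 0 *\<^sub>R b)) / k) \<longlongrightarrow> F (x + 0 *\<^sub>R b) \<bullet> b) (at 0)"
          using line[of x 0] unfolding DERIV_def .
        then have "((\<lambda>k. (f (x + k *\<^sub>R b) - f x) / k) \<longlongrightarrow> F x \<bullet> b) (at 0)" by simp
        moreover have "filterlim h (at 0) sequentially"
          using h0 h by (auto simp: filterlim_at less_imp_neq[symmetric] intro!: always_eventually)
        ultimately show "(\<lambda>n. q n x) \<longlonglongrightarrow> F x \<bullet> b"
          unfolding q_def by (rule filterlim_compose)
      qed
      show "AE x in lborel. norm (q n x) \<le> indicat_real (cball 0 (r + 1)) x * M" for n
      proof (rule AE_I2)
        fix x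
        obtain z where z: "0 < z" "z < h n" "q n x = F (x + z *\<^sub>R b) \<bullet> b" using mean by blast
        have "\<bar>F (x + z *\<^sub>R b) \<bullet> b\<bar> \<le> M"
          using FM[of "x + z *\<^sub>R b"] Basis_le_norm[OF b, of "F (x + z *\<^sub>R b)"] by linarith
        moreover have "x \<in> cball 0 (r + 1)" if "q n x \<noteq> 0"
        proof -
          have "x + z *\<^sub>R b \<in> T" using T(3) that z(3) by force
          then have "norm (x + z *\<^sub>R b) \<le> r" by (rule r)
          moreover have "norm (z *\<^sub>R b) \<le> 1" using z b h(2)[of n] by simp
          ultimately show ?thesis using norm_triangle_ineq4[of "x + z *\<^sub>R b" "z *\<^sub>R b"] by simp
        qed
        ultimately show "norm (q n x) \<le> indicat_real (cball 0 (r + 1)) x * M"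
          using z(3) M(1) by (cases "q n x = 0") auto
      qed
    qed
    moreover have "(LINT x|lborel. q n x) = 0" for n
    proof -
      have fm: "f \<in> borel_measurable borel" using fi by simp
      have "integrable lborel (\<lambda>x. f (x + h n *\<^sub>R b))"
      proof (rule integrable_continuous_compact_support)
        show "continuous_on UNIV (\<lambda>x. f (x + h n *\<^sub>R b))"
          by (intro continuous_on_compose2[OF fc] continuous_intros) auto
        show "compact ((\<lambda>x. x - h n *\<^sub>R b) ` T)"
          by (intro compact_continuous_image continuous_intros T)
        show "f (x + h n *\<^sub>R b) = 0" if "x \<notin> (\<lambda>x. x - h n *\<^sub>R b) ` T" for x
        proof (rule T(2))
          show "x + h n *\<^sub>R b \<notin> T"
          proof
            assume "x + h n *\<^sub>R b \<in> T"
            then have "x + h n *\<^sub>R b - h n *\<^sub>R b \<in> (\<lambda>x. x - h n *\<^sub>R b) ` T" by (rule imageI)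
            then show False using that by simp
          qed
        qed
      qed
      then have "(LINT x|lborel. q n x) = ((LINT x|lborel. f (x + h n *\<^sub>R b)) - (LINT x|lborel. f x)) / h n"
        unfolding q_def using fi by simp
      then show ?thesis using integral_translate[OF fm] by simp
    qed
    ultimately have "(LINT x|lborel. F x \<bullet> b) = 0" by (simp add: LIMSEQ_const_iff)
    then show ?thesis using Fi by simp
  qed
  then show ?thesis by (simp add: euclidean_eq_iff[where 'a='a])
qed

text \<open>Extended by zero, the product \<open>\<phi> * \<psi>\<close> is continuously
  differentiable on the whole space, since \<Omega> and the complement of \<open>T\<close> are open
  and cover it. Its gradient therefore has integral zero.\<close>

lemma integration_by_parts:
  fixes \<phi> \<psi> :: "'a::euclidean_space \<Rightarrow> real"
  assumes \<Omega>: "open \<Omega>"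
    and \<phi>: "\<And>x. x \<in> \<Omega> \<Longrightarrow> GDERIV \<phi> x :> \<Phi> x" "continuous_on \<Omega> \<Phi>"
    and \<psi>: "\<And>x. GDERIV \<psi> x :> \<Psi> x" "continuous_on UNIV \<Psi>"
    and T: "compact T" "T \<subseteq> \<Omega>" "\<And>x. x \<notin> T \<Longrightarrow> \<psi> x = 0"
  shows "(LINT x:\<Omega>|lebesgue. \<phi> x *\<^sub>R \<Psi> x) = - (LINT x:\<Omega>|lebesgue. \<psi> x *\<^sub>R \<Phi> x)"
proof -
  have opT: "open (- T)" using T(1) by (simp add: compact_imp_closed open_Compl)
  have \<Psi>0: "\<Psi> x = 0" if "x \<notin> T" for x
  proof -
    have "GDERIV \<psi> x :> 0"
      by (rule GDERIV_transform[OF GDERIV_const opT]) (use that T(3) in auto)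
    from grad_eq[OF this] grad_eq[OF \<psi>(1)] show ?thesis by simp
  qed
  have ext_cont: "continuous_on UNIV (\<lambda>x. indicat_real \<Omega> x *\<^sub>R g x)"
    if g: "continuous_on \<Omega> g" "\<And>x. x \<notin> T \<Longrightarrow> g x = 0" for g :: "'a \<Rightarrow> 'b::real_normed_vector"
  proof -
    have "continuous_on \<Omega> (\<lambda>x. indicat_real \<Omega> x *\<^sub>R g x)"
      using g(1) by (rule continuous_on_eq) simp
    moreover have "continuous_on (- T) (\<lambda>x. indicat_real \<Omega> x *\<^sub>R g x)"
      by (rule continuous_on_eq[OF continuous_on_const[of _ 0]]) (use g(2) in auto)
    ultimately have "continuous_on (\<Omega> \<union> - T) (\<lambda>x. indicat_real \<Omega> x *\<^sub>R g x)"
      using \<Omega> opT by (intro continuous_on_open_Un)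
    moreover have "\<Omega> \<union> - T = UNIV" using T(2) by auto
    ultimately show ?thesis by simp
  qed
  have cont: "continuous_on \<Omega> \<phi>" "continuous_on UNIV \<psi>"
    using \<phi>(1)[unfolded gderiv_def, THEN has_derivative_continuous]
      \<psi>(1)[unfolded gderiv_def, THEN has_derivative_continuous]
    by (simp_all add: continuous_at_imp_continuous_on)
  have cont\<Omega>: "continuous_on \<Omega> \<psi>" "continuous_on \<Omega> \<Psi>"
    using continuous_on_subset[OF cont(2) subset_UNIV] continuous_on_subset[OF \<psi>(2) subset_UNIV] .
  have c1: "continuous_on UNIV (\<lambda>x. indicat_real \<Omega> x *\<^sub>R (\<phi> x *\<^sub>R \<Psi> x))"
    and c2: "continuous_on UNIV (\<lambda>x. indicat_real \<Omega> x *\<^sub>R (\<psi> x *\<^sub>R \<Phi> x))"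
    by (intro ext_cont continuous_on_scaleR cont cont\<Omega> \<phi>(2); simp add: \<Psi>0 T(3))+
  have i1: "integrable lborel (\<lambda>x. indicat_real \<Omega> x *\<^sub>R (\<phi> x *\<^sub>R \<Psi> x))"
    by (rule integrable_continuous_compact_support[OF c1 T(1)]) (simp add: \<Psi>0)
  have i2: "integrable lborel (\<lambda>x. indicat_real \<Omega> x *\<^sub>R (\<psi> x *\<^sub>R \<Phi> x))"
    by (rule integrable_continuous_compact_support[OF c2 T(1)]) (simp add: T(3))
  have "(LINT x|lborel. indicat_real \<Omega> x *\<^sub>R (\<phi> x *\<^sub>R \<Psi> x) + indicat_real \<Omega> x *\<^sub>R (\<psi> x *\<^sub>R \<Phi> x)) = 0"
  proof (rule integral_grad_compact_support[where f = "\<lambda>x. indicat_real \<Omega> x * (\<phi> x * \<psi> x)", OF _ _ T(1)])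
    show "continuous_on UNIV (\<lambda>x. indicat_real \<Omega> x *\<^sub>R (\<phi> x *\<^sub>R \<Psi> x) + indicat_real \<Omega> x *\<^sub>R (\<psi> x *\<^sub>R \<Phi> x))"
      by (intro continuous_on_add c1 c2)
    fix x
    show "GDERIV (\<lambda>x. indicat_real \<Omega> x * (\<phi> x * \<psi> x)) x :>
        indicat_real \<Omega> x *\<^sub>R (\<phi> x *\<^sub>R \<Psi> x) + indicat_real \<Omega> x *\<^sub>R (\<psi> x *\<^sub>R \<Phi> x)"
    proof (cases "x \<in> \<Omega>")
      case True
      have "GDERIV (\<lambda>x. \<phi> x * \<psi> x) x :> \<phi> x *\<^sub>R \<Psi> x + \<psi> x *\<^sub>R \<Phi> x"
        by (rule GDERIV_mult[OF \<phi>(1)[OF True] \<psi>(1)])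
      then have "GDERIV (\<lambda>x. indicat_real \<Omega> x * (\<phi> x * \<psi> x)) x :> \<phi> x *\<^sub>R \<Psi> x + \<psi> x *\<^sub>R \<Phi> x"
        by (rule GDERIV_transform[OF _ \<Omega> True]) simp
      then show ?thesis using True by simp
    next
      case False
      then have "x \<in> - T" using T(2) by auto
      then have "GDERIV (\<lambda>x. indicat_real \<Omega> x * (\<phi> x * \<psi> x)) x :> 0"
        by (rule GDERIV_transform[OF GDERIV_const opT]) (simp add: T(3))
      then show ?thesis using False by simp
    qed
  qed (auto simp: \<Psi>0 T(3))
  then have "(LINT x|lborel. indicat_real \<Omega> x *\<^sub>R (\<phi> x *\<^sub>R \<Psi> x)) = - (LINT x|lborel. indicat_real \<Omega> x *\<^sub>R (\<psi> x *\<^sub>R \<Phi> x))"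
    unfolding Bochner_Integration.integral_add[OF i1 i2] eq_neg_iff_add_eq_0 .
  then show ?thesis
    unfolding set_lebesgue_integral_lborel[OF borel_measurable_continuous_onI[OF c1]]
      set_lebesgue_integral_lborel[OF borel_measurable_continuous_onI[OF c2]] .
qed

lemma test_function_props:
  assumes "\<phi> \<in> test_functions \<Omega>"
  obtains T where "compact T" "T \<subseteq> \<Omega>" "\<And>x. x \<notin> T \<Longrightarrow> \<phi> x = 0"
    "\<And>x. GDERIV \<phi> x :> grad \<phi> x" "continuous_on UNIV (grad \<phi>)" "continuous_on UNIV \<phi>"
proof
  let ?T = "closure {x. \<phi> x \<noteq> 0}"
  show "compact ?T" "?T \<subseteq> \<Omega>" using assms by (auto simp: test_functions_def)
  show "\<phi> x = 0" if "x \<notin> ?T" for x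
    using that closure_subset[of "{x. \<phi> x \<noteq> 0}"] by auto
  have C: "C_k_on 1 \<phi> UNIV" "C_k_on 0 \<phi> UNIV" using assms by (auto simp only: test_functions_def)
  show "GDERIV \<phi> x :> grad \<phi> x" for x using C(1) by (simp add: GDERIV_grad)
  show "continuous_on UNIV (grad \<phi>)"
    using C(1) by (subst continuous_on_componentwise) simp
  show "continuous_on UNIV \<phi>" using C(2) by simp
qed

text \<open>The fundamental lemma of the calculus of variations: bumps converge boundedly to
  indicators of boxes, which gives vanishing integrals over all boxes in \<Omega>, and countably
  many such boxes cover \<Omega>.\<close>

lemma test_functions_zero_imp_AE_zero:
  fixes g :: "'a::euclidean_space \<Rightarrow> 'a"
  assumes \<Omega>: "open \<Omega>" and g: "set_integrable lebesgue \<Omega> g"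
    and zero: "\<And>\<phi>. \<phi> \<in> test_functions \<Omega> \<Longrightarrow> (LINT x:\<Omega>|lebesgue. \<phi> x *\<^sub>R g x) = 0"
  shows "AE x in lebesgue. x \<in> \<Omega> \<longrightarrow> g x = 0"
proof -
  define f where "f x = indicat_real \<Omega> x *\<^sub>R g x" for x
  have fi: "integrable lebesgue f" using g by (simp add: set_integrable_def f_def[abs_def])
  have boxes: "(LINT x:box a b|lebesgue. f x) = 0" if ab: "cbox a b \<subseteq> \<Omega>" for a b
  proof (cases "box a b = {}")
    case False
    have "(\<lambda>m. LINT x|lebesgue. box_bump m a b x *\<^sub>R f x) \<longlonglongrightarrow> (LINT x|lebesgue. indicat_real (box a b) x *\<^sub>R f x)"
    proof (rule integral_dominated_convergence[where w = "\<lambda>x. norm (f x)"])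
      have "continuous_on UNIV (box_bump m a b)" for m
        using test_function_props[OF box_bump_test[OF False ab]] by metis
      then have "box_bump m a b \<in> borel_measurable lebesgue" for m
        by (intro measurable_completion) (simp add: borel_measurable_continuous_onI)
      then show "(\<lambda>x. box_bump m a b x *\<^sub>R f x) \<in> borel_measurable lebesgue" for m
        using fi by (intro borel_measurable_scaleR) auto
      show "(\<lambda>x. indicat_real (box a b) x *\<^sub>R f x) \<in> borel_measurable lebesgue"
        using fi by (intro borel_measurable_scaleR borel_measurable_indicator) auto
      show "AE x in lebesgue. (\<lambda>m. box_bump m a b x *\<^sub>R f x) \<longlonglongrightarrow> indicat_real (box a b) x *\<^sub>R f x"
        by (intro AE_I2 tendsto_scaleR box_bump_tendsto[OF False] tendsto_const)
      show "AE x in lebesgue. norm (box_bump m a b x *\<^sub>R f x) \<le> norm (f x)" for m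
        using box_bump_bounds[of m a b] by (intro AE_I2) (simp add: mult_left_le_one_le)
    qed (use fi in auto)
    moreover have "(LINT x|lebesgue. box_bump m a b x *\<^sub>R f x) = 0" for m
      using zero[OF box_bump_test[OF False ab, of m]]
      by (simp add: f_def set_lebesgue_integral_def mult.commute)
    ultimately show ?thesis by (simp add: LIMSEQ_const_iff set_lebesgue_integral_def)
  qed (simp add: set_lebesgue_integral_def)
  have local: "AE x in lebesgue. x \<in> cbox a b \<longrightarrow> g x = 0" if ab: "cbox a b \<subseteq> \<Omega>" for a b
  proof -
    \<comment> \<open>Cutting off to one box inside \<Omega> turns the integral over an arbitrary
      box into one over a box whose closure lies in \<Omega>.\<close>
    define h where "h i x = indicat_real (box a b) x * (f x \<bullet> i)" for i x
    have "AE x in lebesgue. h i x = 0" if i: "i \<in> Basis" for i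
    proof (rule box_integrals_zero_imp_AE_zero)
      have ib: "integrable lebesgue (\<lambda>x. indicat_real A x *\<^sub>R f x)" if "A \<in> sets lebesgue" for A
        by (rule integrable_mult_indicator[OF that fi])
      have "integrable lebesgue (\<lambda>x. (indicat_real (box a b) x *\<^sub>R f x) \<bullet> i)"
        by (intro integrable_inner_left ib) auto
      then show "integrable lebesgue (h i)" by (simp add: h_def[abs_def])
      fix c d
      obtain a' b' where ab': "box c d \<inter> box a b = box a' b'" "cbox a' b' \<subseteq> cbox a b"
      proof
        show "box c d \<inter> box a b = box (\<Sum>i\<in>Basis. max (c \<bullet> i) (a \<bullet> i) *\<^sub>R i) (\<Sum>i\<in>Basis. min (d \<bullet> i) (b \<bullet> i) *\<^sub>R i)"
          by (rule box_Int_box)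
        show "cbox (\<Sum>i\<in>Basis. max (c \<bullet> i) (a \<bullet> i) *\<^sub>R i) (\<Sum>i\<in>Basis. min (d \<bullet> i) (b \<bullet> i) *\<^sub>R i) \<subseteq> cbox a b"
          by (auto simp: mem_box)
      qed
      have "(LINT x:box c d|lebesgue. h i x) = (LINT x|lebesgue. (indicat_real (box c d \<inter> box a b) x *\<^sub>R f x) \<bullet> i)"
        unfolding set_lebesgue_integral_def by (simp add: h_def indicator_inter_arith mult.assoc)
      also have "\<dots> = (LINT x|lebesgue. indicat_real (box a' b') x *\<^sub>R f x) \<bullet> i"
        unfolding ab'(1) by (rule integral_inner_left) (use ib in auto)
      also have "\<dots> = 0" using boxes[of a' b'] ab' ab by (simp add: set_lebesgue_integral_def)
      finally show "(LINT x:box c d|lebesgue. h i x) = 0" .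
    qed
    then have "AE x in lebesgue. \<forall>i\<in>Basis. h i x = 0" by (simp add: AE_finite_all)
    moreover have "negligible (cbox a b - box a b)" by (rule negligible_frontier_interval)
    then have "AE x in lebesgue. x \<notin> cbox a b - box a b"
      by (intro AE_not_in) (simp add: negligible_iff_null_sets)
    ultimately show ?thesis
    proof eventually_elim
      case (elim x)
      show ?case
      proof
        assume "x \<in> cbox a b"
        then have "x \<in> box a b" "x \<in> \<Omega>" using elim(2) ab by auto
        then show "g x = 0" using elim(1) by (simp add: h_def f_def euclidean_eq_iff[where 'a='a])
      qed
    qed
  qed
  obtain \<D> where \<D>: "countable \<D>" "\<D> \<subseteq> Pow \<Omega>" "\<And>X. X \<in> \<D> \<Longrightarrow> \<exists>a b. X = cbox a b" "\<Union>\<D> = \<Omega>"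
    using open_countable_Union_open_cbox[OF \<Omega>] by metis
  have "AE x in lebesgue. \<forall>X\<in>\<D>. x \<in> X \<longrightarrow> g x = 0"
  proof (subst AE_ball_countable[OF \<D>(1)], intro ballI)
    fix X assume X: "X \<in> \<D>"
    then obtain a b where "X = cbox a b" using \<D>(3) by blast
    then show "AE x in lebesgue. x \<in> X \<longrightarrow> g x = 0" using local[of a b] X \<D>(2) by auto
  qed
  then show ?thesis by eventually_elim (use \<D>(4) in blast)
qed

section \<open>Functions on bounded domains and the identification of \<open>wgrad\<close>\<close>

lemma integrable_indicator_lmeasurable:
  "A \<in> fmeasurable M \<Longrightarrow> integrable M (indicat_real A)"
  unfolding fmeasurable_def by (intro integrable_real_indicator) auto

text \<open>On a set of finite measure, \<open>t \<le> 1 + t^2\<close> provides the dominating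
  function.\<close>

lemma L2_on_imp_set_integrable:
  fixes g :: "'a::euclidean_space \<Rightarrow> 'b::euclidean_space"
  assumes "bounded \<Omega>" "\<Omega> \<in> sets lebesgue" "g \<in> L2_on lebesgue \<Omega>"
  shows "set_integrable lebesgue \<Omega> g"
  unfolding set_integrable_def
proof (rule Bochner_Integration.integrable_bound)
  have "\<Omega> \<in> lmeasurable" using assms(1,2) by (rule bounded_set_imp_lmeasurable)
  then have "integrable lebesgue (indicat_real \<Omega>)" by (rule integrable_indicator_lmeasurable)
  moreover have "integrable lebesgue (\<lambda>x. indicat_real \<Omega> x *\<^sub>R (norm (g x))\<^sup>2)"
    using assms(3) by (simp add: L2_on_def set_integrable_def)
  ultimately show "integrable lebesgue (\<lambda>x. indicat_real \<Omega> x + indicat_real \<Omega> x *\<^sub>R (norm (g x))\<^sup>2)"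
    by (rule Bochner_Integration.integrable_add)
  show "(\<lambda>x. indicat_real \<Omega> x *\<^sub>R g x) \<in> borel_measurable lebesgue"
    using assms(3) by (simp add: L2_on_def set_borel_measurable_def)
  have "t \<le> 1 + t\<^sup>2" for t :: real
    using zero_le_power2[of "t - 1 / 2"] by (simp add: power2_eq_square algebra_simps)
  then show "AE x in lebesgue. norm (indicat_real \<Omega> x *\<^sub>R g x)
      \<le> norm (indicat_real \<Omega> x + indicat_real \<Omega> x *\<^sub>R (norm (g x))\<^sup>2)"
    by (intro AE_I2) (auto simp: indicator_def)
qed

lemma bounded_continuous_set_integrable:
  fixes g :: "'a::euclidean_space \<Rightarrow> 'b::euclidean_space"
  assumes "open \<Omega>" "bounded \<Omega>" "continuous_on \<Omega> g" "\<And>x. x \<in> \<Omega> \<Longrightarrow> norm (g x) \<le> M"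
  shows "(\<lambda>x. indicat_real \<Omega> x *\<^sub>R g x) \<in> borel_measurable borel" "set_integrable lebesgue \<Omega> g"
proof -
  show m: "(\<lambda>x. indicat_real \<Omega> x *\<^sub>R g x) \<in> borel_measurable borel"
    using assms by (intro borel_measurable_continuous_on_indicator) auto
  have L: "\<Omega> \<in> lmeasurable" using assms(1,2) by (simp add: lmeasurable_open)
  show "set_integrable lebesgue \<Omega> g"
    unfolding set_integrable_def
  proof (rule Bochner_Integration.integrable_bound)
    show "integrable lebesgue (\<lambda>x. indicat_real \<Omega> x * M)"
      by (intro integrable_mult_left impI integrable_indicator_lmeasurable L)
    show "(\<lambda>x. indicat_real \<Omega> x *\<^sub>R g x) \<in> borel_measurable lebesgue"
      using m by (intro measurable_completion) simp
    show "AE x in lebesgue. norm (indicat_real \<Omega> x *\<^sub>R g x) \<le> norm (indicat_real \<Omega> x * M)"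
    proof (rule AE_I2)
      show "norm (indicat_real \<Omega> x *\<^sub>R g x) \<le> norm (indicat_real \<Omega> x * M)" for x
        using assms(4)[of x] by (cases "x \<in> \<Omega>") auto
    qed
  qed
qed

lemma bounded_continuous_L2:
  fixes g :: "'a::euclidean_space \<Rightarrow> 'b::euclidean_space"
  assumes "open \<Omega>" "bounded \<Omega>" "continuous_on \<Omega> g" "\<And>x. x \<in> \<Omega> \<Longrightarrow> norm (g x) \<le> M"
  shows "g \<in> L2_on lebesgue \<Omega>"
proof -
  have "set_integrable lebesgue \<Omega> (\<lambda>x. (norm (g x))\<^sup>2)"
    using assms by (intro bounded_continuous_set_integrable(2)[where M = "M\<^sup>2"] continuous_intros)
      (auto intro!: power_mono)
  moreover have "(\<lambda>x. indicat_real \<Omega> x *\<^sub>R g x) \<in> borel_measurable lebesgue"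
    using bounded_continuous_set_integrable(1)[OF assms] by (intro measurable_completion) simp
  ultimately show ?thesis by (simp add: L2_on_def set_borel_measurable_def)
qed

lemma C1_closure_props:
  fixes \<phi> :: "'a::euclidean_space \<Rightarrow> real"
  assumes "bounded \<Omega>" "\<phi> \<in> C1_closure \<Omega>"
  obtains M where "\<And>x. x \<in> \<Omega> \<Longrightarrow> GDERIV \<phi> x :> grad \<phi> x" "continuous_on \<Omega> (grad \<phi>)"
    "continuous_on \<Omega> \<phi>" "\<And>x. x \<in> \<Omega> \<Longrightarrow> norm (\<phi> x) \<le> M" "\<And>x. x \<in> \<Omega> \<Longrightarrow> norm (grad \<phi> x) \<le> M"
proof -
  from assms(2) obtain G where G: "continuous_on (closure \<Omega>) G" "\<And>x. x \<in> \<Omega> \<Longrightarrow> G x = grad \<phi> x"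
    and \<phi>: "continuous_on (closure \<Omega>) \<phi>" "\<And>x. x \<in> \<Omega> \<Longrightarrow> \<phi> differentiable (at x)"
    unfolding C1_closure_def by blast
  have K: "compact (closure \<Omega>)" using assms(1) by (simp add: compact_closure)
  obtain M1 where M1: "\<And>x. x \<in> closure \<Omega> \<Longrightarrow> norm (\<phi> x) \<le> M1"
    using compact_imp_bounded[OF compact_continuous_image[OF \<phi>(1) K]] unfolding bounded_iff by auto
  obtain M2 where M2: "\<And>x. x \<in> closure \<Omega> \<Longrightarrow> norm (G x) \<le> M2"
    using compact_imp_bounded[OF compact_continuous_image[OF G(1) K]] unfolding bounded_iff by auto
  show ?thesis
  proof (rule that[of "max M1 M2"])
    show "continuous_on \<Omega> (grad \<phi>)"
      using continuous_on_subset[OF G(1) closure_subset] G(2) by (rule continuous_on_eq)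
    show "norm (grad \<phi> x) \<le> max M1 M2" if "x \<in> \<Omega>" for x
      using M2[of x] G(2)[OF that] that closure_subset by fastforce
    show "norm (\<phi> x) \<le> max M1 M2" if "x \<in> \<Omega>" for x
      using M1[of x] that closure_subset by fastforce
    show "GDERIV \<phi> x :> grad \<phi> x" if "x \<in> \<Omega>" for x using \<phi>(2)[OF that] by (rule GDERIV_grad)
    show "continuous_on \<Omega> \<phi>" using \<phi>(1) closure_subset by (rule continuous_on_subset)
  qed
qed

text \<open>The classical gradient is a weak gradient by integration by parts. The chosen version
  \<open>wgrad\<close> has the same integrals against all test functions, so the two differ on a
  null set only.\<close>

lemma C1_closure_weak_gradient:
  fixes \<phi> :: "'a::euclidean_space \<Rightarrow> real"
  assumes \<Omega>: "open \<Omega>" "bounded \<Omega>" and \<phi>: "\<phi> \<in> C1_closure \<Omega>"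
  shows "has_weak_gradient \<Omega> \<phi> (grad \<phi>)" "\<phi> \<in> H1 \<Omega>"
    "AE x in lebesgue. x \<in> \<Omega> \<longrightarrow> wgrad \<Omega> \<phi> x = grad \<phi> x"
proof -
  obtain M where M: "\<And>x. x \<in> \<Omega> \<Longrightarrow> GDERIV \<phi> x :> grad \<phi> x" "continuous_on \<Omega> (grad \<phi>)"
    "continuous_on \<Omega> \<phi>" "\<And>x. x \<in> \<Omega> \<Longrightarrow> norm (\<phi> x) \<le> M" "\<And>x. x \<in> \<Omega> \<Longrightarrow> norm (grad \<phi> x) \<le> M"
    using C1_closure_props[OF \<Omega>(2) \<phi>] by blast
  have L2: "\<phi> \<in> L2_on lebesgue \<Omega>" "grad \<phi> \<in> L2_on lebesgue \<Omega>"
    by (rule bounded_continuous_L2[OF \<Omega> M(3,4)] bounded_continuous_L2[OF \<Omega> M(2,5)]; assumption)+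
  have "(LINT x:\<Omega>|lebesgue. \<phi> x *\<^sub>R grad \<psi> x) = - (LINT x:\<Omega>|lebesgue. \<psi> x *\<^sub>R grad \<phi> x)"
    if "\<psi> \<in> test_functions \<Omega>" for \<psi>
    using test_function_props[OF that] integration_by_parts[OF \<Omega>(1) M(1,2)] by metis
  then show weak: "has_weak_gradient \<Omega> \<phi> (grad \<phi>)" using L2 by (simp add: has_weak_gradient_def)
  then show "\<phi> \<in> H1 \<Omega>" using L2 by (auto simp: H1_def)
  have w: "has_weak_gradient \<Omega> \<phi> (wgrad \<Omega> \<phi>)" unfolding wgrad_def using weak by (rule someI[where P = "has_weak_gradient \<Omega> \<phi>"])
  have \<Omega>m: "\<Omega> \<in> sets lebesgue" using \<Omega>(1) by simp
  have int: "set_integrable lebesgue \<Omega> (wgrad \<Omega> \<phi>)" "set_integrable lebesgue \<Omega> (grad \<phi>)"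
    using w L2 \<Omega>(2) \<Omega>m by (auto simp: has_weak_gradient_def intro: L2_on_imp_set_integrable)
  have "AE x in lebesgue. x \<in> \<Omega> \<longrightarrow> wgrad \<Omega> \<phi> x - grad \<phi> x = 0"
  proof (rule test_functions_zero_imp_AE_zero[OF \<Omega>(1)])
    show "set_integrable lebesgue \<Omega> (\<lambda>x. wgrad \<Omega> \<phi> x - grad \<phi> x)" using int by (rule set_integral_diff)
    fix \<psi> assume \<psi>: "\<psi> \<in> test_functions \<Omega>"
    obtain T where T: "compact T" "\<And>x. x \<notin> T \<Longrightarrow> \<psi> x = 0" "continuous_on UNIV \<psi>"
      using test_function_props[OF \<psi>] by metis
    obtain B where "\<And>x. x \<in> T \<Longrightarrow> norm (\<psi> x) \<le> B"
      using compact_imp_bounded[OF compact_continuous_image[OF continuous_on_subset[OF T(3) subset_UNIV] T(1)]]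
      unfolding bounded_iff by auto
    then have B: "norm (\<psi> x) \<le> \<bar>B\<bar>" for x using T(2)[of x] by (cases "x \<in> T") fastforce+
    have \<psi>i: "set_integrable lebesgue \<Omega> (\<lambda>x. \<psi> x *\<^sub>R g x)" if g: "set_integrable lebesgue \<Omega> g" for g :: "'a \<Rightarrow> 'a"
      unfolding set_integrable_def
    proof (rule Bochner_Integration.integrable_bound)
      have gi: "integrable lebesgue (\<lambda>x. indicat_real \<Omega> x *\<^sub>R g x)" using g by (simp add: set_integrable_def)
      then show "integrable lebesgue (\<lambda>x. \<bar>B\<bar> *\<^sub>R (indicat_real \<Omega> x *\<^sub>R g x))"
        by (intro integrable_scaleR_right)
      have "\<psi> \<in> borel_measurable lebesgue"
        using T(3) by (intro measurable_completion) (simp add: borel_measurable_continuous_onI)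
      then have "(\<lambda>x. \<psi> x *\<^sub>R (indicat_real \<Omega> x *\<^sub>R g x)) \<in> borel_measurable lebesgue"
        using gi by (rule borel_measurable_scaleR[OF _ borel_measurable_integrable])
      then show "(\<lambda>x. indicat_real \<Omega> x *\<^sub>R (\<psi> x *\<^sub>R g x)) \<in> borel_measurable lebesgue"
        by (simp add: mult.commute)
      show "AE x in lebesgue. norm (indicat_real \<Omega> x *\<^sub>R (\<psi> x *\<^sub>R g x)) \<le> norm (\<bar>B\<bar> *\<^sub>R (indicat_real \<Omega> x *\<^sub>R g x))"
        using B by (intro AE_I2) (auto simp: indicator_def intro!: mult_right_mono)
    qed
    have "(LINT x:\<Omega>|lebesgue. \<psi> x *\<^sub>R wgrad \<Omega> \<phi> x) = (LINT x:\<Omega>|lebesgue. \<psi> x *\<^sub>R grad \<phi> x)"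
      using bspec[OF conjunct2[OF w[unfolded has_weak_gradient_def]] \<psi>]
        bspec[OF conjunct2[OF weak[unfolded has_weak_gradient_def]] \<psi>] by (simp only: neg_equal_iff_equal)
    then show "(LINT x:\<Omega>|lebesgue. \<psi> x *\<^sub>R (wgrad \<Omega> \<phi> x - grad \<phi> x)) = 0"
      unfolding scaleR_diff_right set_integral_diff(2)[OF \<psi>i[OF int(1)] \<psi>i[OF int(2)]] by simp
  qed
  then show "AE x in lebesgue. x \<in> \<Omega> \<longrightarrow> wgrad \<Omega> \<phi> x = grad \<phi> x" by simp
qed

lemma wgrad_measurable:
  assumes "open \<Omega>" "bounded \<Omega>" "f \<in> C1_closure \<Omega>"
  shows "(\<lambda>x. indicat_real \<Omega> x *\<^sub>R grad f x) \<in> borel_measurable lebesgue"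
    "(\<lambda>x. indicat_real \<Omega> x *\<^sub>R wgrad \<Omega> f x) \<in> borel_measurable lebesgue"
proof -
  have g: "has_weak_gradient \<Omega> f (grad f)" using C1_closure_weak_gradient[OF assms] by simp
  then show "(\<lambda>x. indicat_real \<Omega> x *\<^sub>R grad f x) \<in> borel_measurable lebesgue"
    by (simp add: has_weak_gradient_def L2_on_def set_borel_measurable_def)
  have "has_weak_gradient \<Omega> f (wgrad \<Omega> f)"
    unfolding wgrad_def using g by (rule someI[where P = "has_weak_gradient \<Omega> f"])
  then show "(\<lambda>x. indicat_real \<Omega> x *\<^sub>R wgrad \<Omega> f x) \<in> borel_measurable lebesgue"
    by (simp add: has_weak_gradient_def L2_on_def set_borel_measurable_def)
qed

section \<open>The weak formulation\<close>

lemma annular_domain_eq: "0 < R0 \<Longrightarrow> annular_domain R0 R1 c = ball 0 R1 - cball c R0"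
  by (simp add: annular_domain_def)

text \<open>Points inside the large ball are approached by moving away from \<open>c\<close>, points
  of the outer sphere by moving towards the origin. As the two spheres are disjoint, a short move of
  either kind respects the other constraint.\<close>

lemma closure_annular_domain:
  fixes c :: "'a::euclidean_space"
  assumes R0: "0 < R0" and c: "norm c + R0 < R1"
  shows "closure (annular_domain R0 R1 c) = cball 0 R1 - ball c R0"
proof
  have "closed (cball 0 R1 - ball c R0)" by (intro closed_Diff) auto
  moreover have "annular_domain R0 R1 c \<subseteq> cball 0 R1 - ball c R0"
    unfolding annular_domain_eq[OF R0] by auto
  ultimately show "closure (annular_domain R0 R1 c) \<subseteq> cball 0 R1 - ball c R0"
    by (rule closure_minimal[rotated])
  have R1: "0 < R1" using R0 c norm_ge_zero[of c] by linarith
  show "cball 0 R1 - ball c R0 \<subseteq> closure (annular_domain R0 R1 c)"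
  proof
    fix x assume x: "x \<in> cball 0 R1 - ball c R0"
    have ray: "x \<in> closure (annular_domain R0 R1 c)"
      if "\<forall>\<^sub>F t in at_right 0. x + t *\<^sub>R d \<in> annular_domain R0 R1 c" for d
    proof (rule Lim_in_closed_set)
      show "\<forall>\<^sub>F t in at_right 0. x + t *\<^sub>R d \<in> closure (annular_domain R0 R1 c)"
        using that by eventually_elim (use closure_subset in blast)
      show "((\<lambda>t. x + t *\<^sub>R d) \<longlongrightarrow> x) (at_right 0)" by (auto intro!: tendsto_eq_intros)
    qed auto
    have line: "((\<lambda>t. x + t *\<^sub>R d) \<longlongrightarrow> x) (at_right 0)" for d by (auto intro!: tendsto_eq_intros)
    have pos: "\<forall>\<^sub>F t in at_right 0. 0 < t \<and> t < (1::real)"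
      by (auto simp: eventually_at_right_field intro: exI[of _ 1])
    show "x \<in> closure (annular_domain R0 R1 c)"
    proof (cases "norm x < R1")
      case True
      have "\<forall>\<^sub>F t in at_right 0. x + t *\<^sub>R (x - c) \<in> ball 0 R1"
        by (rule topological_tendstoD[OF line]) (use True in auto)
      with pos have "\<forall>\<^sub>F t in at_right 0. x + t *\<^sub>R (x - c) \<in> annular_domain R0 R1 c"
      proof eventually_elim
        case (elim t)
        have "x + t *\<^sub>R (x - c) - c = (1 + t) *\<^sub>R (x - c)" by (simp add: algebra_simps)
        then have n: "norm (x + t *\<^sub>R (x - c) - c) = (1 + t) * norm (x - c)" using elim by simp
        have r: "R0 \<le> norm (x - c)" using x by (simp add: dist_norm norm_minus_commute)
        then have "0 < norm (x - c)" using R0 by linarith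
        then have "0 < t * norm (x - c)" using elim by (intro mult_pos_pos) auto
        then have "R0 < (1 + t) * norm (x - c)" using r by (simp add: algebra_simps)
        then show ?case using elim n
          unfolding annular_domain_eq[OF R0] by (simp add: dist_norm norm_minus_commute)
      qed
      then show ?thesis by (rule ray)
    next
      case False
      then have nx: "norm x = R1" using x by simp
      then have "R0 < norm (x - c)" using norm_triangle_ineq2[of x c] c by linarith
      then have "\<forall>\<^sub>F t in at_right 0. x + t *\<^sub>R (- x) \<in> - cball c R0"
        by (intro topological_tendstoD[OF line]) (auto simp: dist_norm norm_minus_commute)
      with pos have "\<forall>\<^sub>F t in at_right 0. x + t *\<^sub>R (- x) \<in> annular_domain R0 R1 c"
      proof eventually_elim
        case (elim t)
        have "x + t *\<^sub>R (- x) = (1 - t) *\<^sub>R x" by (simp add: algebra_simps)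
        then have "norm (x + t *\<^sub>R (- x)) < R1" using elim nx R1 by simp
        then show ?case using elim unfolding annular_domain_eq[OF R0] by simp
      qed
      then show ?thesis by (rule ray)
    qed
  qed
qed

text \<open>The constant sequence witnesses the vanishing trace.\<close>

lemma zero_on_sphere_in_V:
  fixes \<phi> :: "'a::euclidean_space \<Rightarrow> real"
  assumes "open \<Omega>" "bounded \<Omega>" "\<phi> \<in> C1_closure \<Omega>" "\<And>x. x \<in> sphere c r \<Longrightarrow> \<phi> x = 0"
  shows "\<phi> \<in> H1_zero_on_sphere \<Omega> c r"
proof -
  have H: "\<phi> \<in> H1 \<Omega>" using C1_closure_weak_gradient[OF assms(1-3)] by simp
  have "has_trace_on_sphere \<Omega> c r \<phi> (\<lambda>_. 0)"
    unfolding has_trace_on_sphere_def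
  proof (intro conjI exI[of _ "\<lambda>n. \<phi>"] allI)
    show "(\<lambda>_. 0) \<in> L2_on (sphere_measure c r) (sphere c r)"
      by (simp add: L2_on_def set_borel_measurable_def set_integrable_def)
    show "\<phi> \<in> C1_closure \<Omega> \<inter> H1 \<Omega>" using H assms by simp
    show "(\<lambda>n. H1_dist_sq \<Omega> \<phi> \<phi>) \<longlonglongrightarrow> 0"
      by (simp add: H1_dist_sq_def set_lebesgue_integral_def)
    have "(\<lambda>x. indicat_real (sphere c r) x *\<^sub>R (\<phi> x - 0)\<^sup>2) = (\<lambda>x. 0)"
      using assms(4) by (auto simp: indicator_def fun_eq_iff)
    then show "(\<lambda>n. LINT x:sphere c r|sphere_measure c r. (\<phi> x - 0)\<^sup>2) \<longlonglongrightarrow> 0"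
      unfolding set_lebesgue_integral_def by simp
  qed
  then show ?thesis using H by (simp add: H1_zero_on_sphere_def)
qed

lemma open_bounded_annular_domain:
  assumes "0 < R0"
  shows "open (annular_domain R0 R1 c)" "bounded (annular_domain R0 R1 c)"
  unfolding annular_domain_eq[OF assms] by (auto intro!: open_Diff intro: bounded_subset[OF bounded_ball[of 0 R1]])

lemma set_lebesgue_integral_cong_wgrad:
  fixes u \<phi> :: "'a::euclidean_space \<Rightarrow> real"
  assumes \<Omega>: "open \<Omega>" "bounded \<Omega>" and u: "u \<in> C1_closure \<Omega>" and \<phi>: "\<phi> \<in> C1_closure \<Omega>"
  shows "(LINT x:\<Omega>|lebesgue. wgrad \<Omega> u x \<bullet> wgrad \<Omega> \<phi> x) = (LINT x:\<Omega>|lebesgue. grad u x \<bullet> grad \<phi> x)"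
  unfolding set_lebesgue_integral_def
proof (rule integral_cong_AE)
  have eq: "(\<lambda>x. indicat_real \<Omega> x *\<^sub>R (g x \<bullet> h x)) = (\<lambda>x. (indicat_real \<Omega> x *\<^sub>R g x) \<bullet> (indicat_real \<Omega> x *\<^sub>R h x))"
    for g h :: "'a \<Rightarrow> 'a" by (auto simp: indicator_def fun_eq_iff)
  show "(\<lambda>x. indicat_real \<Omega> x *\<^sub>R (wgrad \<Omega> u x \<bullet> wgrad \<Omega> \<phi> x)) \<in> borel_measurable lebesgue"
    unfolding eq by (rule borel_measurable_inner[OF wgrad_measurable(2)[OF \<Omega> u] wgrad_measurable(2)[OF \<Omega> \<phi>]])
  show "(\<lambda>x. indicat_real \<Omega> x *\<^sub>R (grad u x \<bullet> grad \<phi> x)) \<in> borel_measurable lebesgue"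
    unfolding eq by (rule borel_measurable_inner[OF wgrad_measurable(1)[OF \<Omega> u] wgrad_measurable(1)[OF \<Omega> \<phi>]])
  show "AE x in lebesgue. indicat_real \<Omega> x *\<^sub>R (wgrad \<Omega> u x \<bullet> wgrad \<Omega> \<phi> x)
      = indicat_real \<Omega> x *\<^sub>R (grad u x \<bullet> grad \<phi> x)"
    using C1_closure_weak_gradient(3)[OF \<Omega> u] C1_closure_weak_gradient(3)[OF \<Omega> \<phi>]
    by eventually_elim (simp add: indicator_def)
qed

text \<open>The form in which the weak equation is used below. Test functions are unrestricted on
  the outer sphere, and this freedom is what yields the Neumann condition.\<close>

lemma mixed_eigenfunction_weak_form:
  fixes c :: "'a::euclidean_space"
  assumes R0: "0 < R0" and \<Omega>: "\<Omega> = annular_domain R0 R1 c"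
    and u: "mixed_eigenfunction R0 R1 c \<tau> u" "u \<in> C1_closure \<Omega>"
    and \<phi>: "\<phi> \<in> C1_closure \<Omega>" "\<And>x. x \<in> sphere c R0 \<Longrightarrow> \<phi> x = 0"
  shows "(LINT x:\<Omega>|lebesgue. grad u x \<bullet> grad \<phi> x) = \<tau> * (LINT x:\<Omega>|lebesgue. u x * \<phi> x)"
proof -
  note ob = open_bounded_annular_domain[OF R0, of R1 c, folded \<Omega>]
  have "\<phi> \<in> H1_zero_on_sphere \<Omega> c R0" using ob \<phi> by (rule zero_on_sphere_in_V)
  then have "(LINT x:\<Omega>|lebesgue. wgrad \<Omega> u x \<bullet> wgrad \<Omega> \<phi> x) = \<tau> * (LINT x:\<Omega>|lebesgue. u x * \<phi> x)"
    using u(1) unfolding mixed_eigenfunction_def Let_def \<Omega> by blast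
  then show ?thesis unfolding set_lebesgue_integral_cong_wgrad[OF ob u(2) \<phi>(1)] .
qed

lemma C1_imp_C1_closure:
  assumes "\<And>x. GDERIV \<phi> x :> \<Phi> x" "continuous_on UNIV \<Phi>"
  shows "\<phi> \<in> C1_closure \<Omega>"
proof -
  have "continuous_on UNIV \<phi>"
    using assms(1)[unfolded gderiv_def, THEN has_derivative_continuous]
    by (simp add: continuous_at_imp_continuous_on)
  moreover have "\<forall>x\<in>\<Omega>. \<Phi> x = grad \<phi> x" using grad_eq[OF assms(1)] by simp
  ultimately show ?thesis
    unfolding C1_closure_def mem_Collect_eq
    using GDERIV_imp_differentiable[OF assms(1)] continuous_on_subset[OF assms(2) subset_UNIV]
    by (intro conjI ballI exI[of _ \<Phi>]) (auto intro: continuous_on_subset)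
qed

lemma test_function_in_C1_closure:
  assumes "\<psi> \<in> test_functions S" shows "\<psi> \<in> C1_closure \<Omega>"
proof -
  obtain T where "\<And>x. GDERIV \<psi> x :> grad \<psi> x" "continuous_on UNIV (grad \<psi>)"
    using test_function_props[OF assms] by metis
  then show ?thesis by (rule C1_imp_C1_closure)
qed

text \<open>A nonzero value persists on a nonempty open set, and such a set is not
  negligible.\<close>

lemma AE_zero_imp_zero:
  fixes f :: "'a::euclidean_space \<Rightarrow> 'b::real_normed_vector"
  assumes S: "open S" "continuous_on S f" and AE: "AE x in lebesgue. x \<in> S \<longrightarrow> f x = 0" and x: "x \<in> S"
  shows "f x = 0"
proof (rule ccontr)
  assume "f x \<noteq> 0"
  define V where "V = S \<inter> f -` (- {0})"
  have V: "open V" unfolding V_def using S by (intro continuous_open_preimage) auto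
  have "AE x in lebesgue. x \<notin> V" using AE by eventually_elim (auto simp: V_def)
  then have "V \<in> null_sets lebesgue" using V by (subst AE_iff_null_sets) auto
  then have "negligible V" by (simp add: negligible_iff_null_sets)
  moreover have "x \<in> V" using x \<open>f x \<noteq> 0\<close> by (simp add: V_def)
  ultimately show False using open_not_negligible[OF V] by blast
qed

section \<open>The classical equation in the interior\<close>

lemma C_k_on_2_has_laplacian:
  fixes u :: "'a::euclidean_space \<Rightarrow> real"
  assumes S: "open S" and u: "C_k_on 2 u S"
  defines "L \<equiv> \<lambda>x. \<Sum>b\<in>Basis. grad (\<lambda>y. grad u y \<bullet> b) x \<bullet> b"
  shows "\<And>x. x \<in> S \<Longrightarrow> has_laplacian u (grad u) (L x) x" "continuous_on S L"
    "\<And>b x. b \<in> Basis \<Longrightarrow> x \<in> S \<Longrightarrow> GDERIV (\<lambda>y. grad u y \<bullet> b) x :> grad (\<lambda>y. grad u y \<bullet> b) x"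
    "\<And>b. b \<in> Basis \<Longrightarrow> continuous_on S (grad (\<lambda>y. grad u y \<bullet> b))"
proof -
  have u2: "C_k_on (Suc (Suc 0)) u S" using u by (simp only: numeral_2_eq_2)
  have d1: "GDERIV u x :> grad u x" if "x \<in> S" for x using u2 that by (simp add: GDERIV_grad)
  show d2: "GDERIV (\<lambda>y. grad u y \<bullet> b) x :> grad (\<lambda>y. grad u y \<bullet> b) x" if "b \<in> Basis" "x \<in> S" for b x
    using u2 that by (simp add: GDERIV_grad)
  show c2: "continuous_on S (grad (\<lambda>y. grad u y \<bullet> b))" if "b \<in> Basis" for b
    using u2 that by (subst continuous_on_componentwise) simp
  show "continuous_on S L" unfolding L_def using c2 by (intro continuous_intros) auto
  fix x assume x: "x \<in> S"
  let ?H = "\<lambda>h. \<Sum>b\<in>Basis. (h \<bullet> grad (\<lambda>y. grad u y \<bullet> b) x) *\<^sub>R b"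
  have "((\<lambda>y. \<Sum>b\<in>Basis. (grad u y \<bullet> b) *\<^sub>R b) has_derivative ?H) (at x)"
    using d2[OF _ x] unfolding gderiv_def
    by (intro has_derivative_sum has_derivative_scaleR_left) auto
  then have H: "(grad u has_derivative ?H) (at x)" by (simp add: euclidean_representation)
  have "?H b \<bullet> b = grad (\<lambda>y. grad u y \<bullet> b) x \<bullet> b" if "b \<in> Basis" for b
    unfolding inner_sum_left_Basis[OF that] by (rule inner_commute)
  then have "(\<Sum>b\<in>Basis. ?H b \<bullet> b) = L x" unfolding L_def by (intro sum.cong) auto
  moreover have "\<forall>\<^sub>F y in nhds x. GDERIV u y :> grad u y"
    using eventually_nhds_in_open[OF S x] by (rule eventually_mono) (rule d1)
  ultimately show "has_laplacian u (grad u) (L x) x" using H unfolding has_laplacian_def by blast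
qed

lemma set_integrable_compact_support:
  fixes f :: "'a::euclidean_space \<Rightarrow> 'b::euclidean_space"
  assumes T: "compact T" "T \<subseteq> \<Omega>" and f: "continuous_on \<Omega> f" "\<And>x. x \<notin> T \<Longrightarrow> f x = 0"
  shows "set_integrable lebesgue \<Omega> f"
proof -
  have "integrable lborel (\<lambda>x. indicat_real T x *\<^sub>R f x)"
    using T(1) continuous_on_subset[OF f(1) T(2)] by (rule borel_integrable_compact)
  also have "(\<lambda>x. indicat_real T x *\<^sub>R f x) = (\<lambda>x. indicat_real \<Omega> x *\<^sub>R f x)"
    using f(2) T(2) by (auto simp: indicator_def fun_eq_iff)
  finally have i: "integrable lborel (\<lambda>x. indicat_real \<Omega> x *\<^sub>R f x)" .
  then show ?thesis unfolding set_integrable_def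
    using integrable_completion[OF borel_measurable_integrable[OF i]] by simp
qed

text \<open>Integrating by parts in each component shows that \<open>L + \<tau> * u\<close> is
  orthogonal to all test functions; the fundamental lemma and continuity then make it vanish at
  every point.\<close>

lemma mixed_eigenfunction_laplacian:
  fixes c :: "'a::euclidean_space"
  assumes R0: "0 < R0" and \<Omega>: "\<Omega> = annular_domain R0 R1 c"
    and u: "mixed_eigenfunction R0 R1 c \<tau> u" "u \<in> C1_closure \<Omega>" and u2: "C_k_on 2 u \<Omega>"
    and x: "x \<in> \<Omega>"
  shows "has_laplacian u (grad u) (- \<tau> * u x) x"
proof -
  note ob = open_bounded_annular_domain[OF R0, of R1 c, folded \<Omega>]
  define L where "L x = (\<Sum>b\<in>Basis. grad (\<lambda>y. grad u y \<bullet> b) x \<bullet> b)" for x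
  note lap = C_k_on_2_has_laplacian[OF ob(1) u2, folded L_def]
  obtain M where M: "\<And>x. x \<in> \<Omega> \<Longrightarrow> GDERIV u x :> grad u x" "continuous_on \<Omega> (grad u)" "continuous_on \<Omega> u"
    using C1_closure_props[OF ob(2) u(2)] by metis
  \<comment> \<open>Second derivatives may be unbounded near the boundary of \<Omega>. On a small
    ball the function \<open>w\<close> is bounded and hence integrable, as the fundamental lemma
    requires.\<close>
  obtain r where r: "0 < r" "cball x r \<subseteq> \<Omega>" using ob(1) x open_contains_cball by blast
  let ?B = "ball x r"
  have B\<Omega>: "?B \<subseteq> \<Omega>" using r ball_subset_cball by blast
  define w where "w y = L y + \<tau> * u y" for y
  have Lc: "continuous_on \<Omega> L" using lap(2) by (simp add: L_def[abs_def])
  have wc: "continuous_on \<Omega> w" unfolding w_def by (intro continuous_intros Lc M(3))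
  have zero: "set_integrable lebesgue \<Omega> (\<lambda>y. \<psi> y * w y) \<and> (LINT y:\<Omega>|lebesgue. \<psi> y * w y) = 0"
    if \<psi>: "\<psi> \<in> test_functions \<Omega>" for \<psi>
  proof -
    obtain T where T: "compact T" "T \<subseteq> \<Omega>" "\<And>x. x \<notin> T \<Longrightarrow> \<psi> x = 0"
      "\<And>x. GDERIV \<psi> x :> grad \<psi> x" "continuous_on UNIV (grad \<psi>)" "continuous_on UNIV \<psi>"
      using test_function_props[OF \<psi>] by blast
    have g0: "grad \<psi> x = 0" if "x \<notin> T" for x
    proof -
      have "GDERIV \<psi> x :> 0"
        by (rule GDERIV_transform[OF GDERIV_const, of "- T"])
           (use that T(1,3) in \<open>auto simp: compact_imp_closed open_Compl\<close>)
      from grad_eq[OF this] show ?thesis .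
    qed
    note int = set_integrable_compact_support[OF T(1,2)]
    note sub = continuous_on_subset[OF T(5) subset_UNIV] continuous_on_subset[OF T(6) subset_UNIV]
    have "\<psi> \<in> C1_closure \<Omega>" using \<psi> by (rule test_function_in_C1_closure)
    moreover have "\<psi> x = 0" if "x \<in> sphere c R0" for x
      by (rule T(3)) (use that T(2) in \<open>auto simp: \<Omega> annular_domain_eq[OF R0]\<close>)
    ultimately have weak: "(LINT x:\<Omega>|lebesgue. grad u x \<bullet> grad \<psi> x) = \<tau> * (LINT x:\<Omega>|lebesgue. u x * \<psi> x)"
      using mixed_eigenfunction_weak_form[OF R0 \<Omega> u] by blast
    have parts: "(LINT x:\<Omega>|lebesgue. (grad u x \<bullet> b) * (grad \<psi> x \<bullet> b))
        = - (LINT x:\<Omega>|lebesgue. \<psi> x * (grad (\<lambda>y. grad u y \<bullet> b) x \<bullet> b))" if b: "b \<in> Basis" for b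
    proof -
      have i1: "set_integrable lebesgue \<Omega> (\<lambda>x. (grad u x \<bullet> b) *\<^sub>R grad \<psi> x)"
        by (intro int continuous_intros M sub) (simp add: g0)
      have i2: "set_integrable lebesgue \<Omega> (\<lambda>x. \<psi> x *\<^sub>R grad (\<lambda>y. grad u y \<bullet> b) x)"
        by (intro int continuous_intros lap(4)[OF b] sub) (simp add: T(3))
      have "(LINT x:\<Omega>|lebesgue. (grad u x \<bullet> b) *\<^sub>R grad \<psi> x)
          = - (LINT x:\<Omega>|lebesgue. \<psi> x *\<^sub>R grad (\<lambda>y. grad u y \<bullet> b) x)"
        by (rule integration_by_parts[OF ob(1) lap(3)[OF b] lap(4)[OF b] T(4,5,1,2,3)])
      then have "(LINT x:\<Omega>|lebesgue. (grad u x \<bullet> b) *\<^sub>R grad \<psi> x) \<bullet> b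
          = - ((LINT x:\<Omega>|lebesgue. \<psi> x *\<^sub>R grad (\<lambda>y. grad u y \<bullet> b) x) \<bullet> b)" by simp
      moreover have "(LINT x:\<Omega>|lebesgue. f x) \<bullet> b = (LINT x:\<Omega>|lebesgue. f x \<bullet> b)"
        if "set_integrable lebesgue \<Omega> f" for f :: "'a \<Rightarrow> 'a"
        using that unfolding set_lebesgue_integral_def set_integrable_def
        by (subst integral_inner_left[symmetric]) auto
      ultimately show ?thesis using i1 i2 by simp
    qed
    have sumI: "(LINT x:\<Omega>|lebesgue. \<Sum>b\<in>Basis. f b x) = (\<Sum>b\<in>Basis. LINT x:\<Omega>|lebesgue. f b x)"
      if "\<And>b. b \<in> Basis \<Longrightarrow> set_integrable lebesgue \<Omega> (f b)" for f :: "'a \<Rightarrow> 'a \<Rightarrow> real"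
      using that unfolding set_lebesgue_integral_def set_integrable_def scaleR_sum_right
      by (rule Bochner_Integration.integral_sum)
    have "(LINT x:\<Omega>|lebesgue. grad u x \<bullet> grad \<psi> x)
        = (LINT x:\<Omega>|lebesgue. \<Sum>b\<in>Basis. (grad u x \<bullet> b) * (grad \<psi> x \<bullet> b))"
      by (subst euclidean_inner) simp
    also have "\<dots> = (\<Sum>b\<in>Basis. LINT x:\<Omega>|lebesgue. (grad u x \<bullet> b) * (grad \<psi> x \<bullet> b))"
      by (rule sumI, intro int continuous_intros M sub) (simp add: g0)
    also have "\<dots> = - (\<Sum>b\<in>Basis. LINT x:\<Omega>|lebesgue. \<psi> x * (grad (\<lambda>y. grad u y \<bullet> b) x \<bullet> b))"
      using parts by (simp add: sum_negf)
    also have "(\<Sum>b\<in>Basis. LINT x:\<Omega>|lebesgue. \<psi> x * (grad (\<lambda>y. grad u y \<bullet> b) x \<bullet> b))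
        = (LINT x:\<Omega>|lebesgue. \<Sum>b\<in>Basis. \<psi> x * (grad (\<lambda>y. grad u y \<bullet> b) x \<bullet> b))"
      by (rule sumI[symmetric], intro int continuous_intros lap(4) sub) (simp_all add: T(3))
    also have "\<dots> = (LINT x:\<Omega>|lebesgue. \<psi> x * L x)" by (simp add: L_def sum_distrib_left)
    finally have "(LINT x:\<Omega>|lebesgue. \<psi> x * L x) + \<tau> * (LINT x:\<Omega>|lebesgue. u x * \<psi> x) = 0"
      using weak by simp
    moreover have "(LINT x:\<Omega>|lebesgue. \<psi> x * w x)
        = (LINT x:\<Omega>|lebesgue. \<psi> x * L x) + (LINT x:\<Omega>|lebesgue. \<tau> * (u x * \<psi> x))"
    proof -
      have "(LINT x:\<Omega>|lebesgue. \<psi> x * L x + \<tau> * (u x * \<psi> x))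
          = (LINT x:\<Omega>|lebesgue. \<psi> x * L x) + (LINT x:\<Omega>|lebesgue. \<tau> * (u x * \<psi> x))"
        by (rule set_integral_add(2)) (auto intro!: int continuous_intros Lc M(3) sub simp: T(3))
      then show ?thesis by (simp add: w_def algebra_simps)
    qed
    moreover have "set_integrable lebesgue \<Omega> (\<lambda>y. \<psi> y * w y)"
      by (intro int continuous_intros wc sub) (simp add: T(3))
    ultimately show ?thesis by simp
  qed
  obtain b :: 'a where b: "b \<in> Basis" using nonempty_Basis by blast
  \<comment> \<open>The fundamental lemma is stated for vector fields, so the scalar
    \<open>w\<close> is carried by a fixed basis vector.\<close>
  have "AE y in lebesgue. y \<in> ?B \<longrightarrow> w y *\<^sub>R b = 0"
  proof (rule test_functions_zero_imp_AE_zero)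
    have wcB: "continuous_on (cball x r) w" using wc r(2) by (rule continuous_on_subset)
    obtain Mw where "\<forall>v\<in>w ` cball x r. norm v \<le> Mw"
      using compact_imp_bounded[OF compact_continuous_image[OF wcB compact_cball]] unfolding bounded_iff by blast
    then have Mw: "norm (w y) \<le> Mw" if "y \<in> cball x r" for y using that by blast
    show "set_integrable lebesgue ?B (\<lambda>y. w y *\<^sub>R b)"
      using b Mw by (intro bounded_continuous_set_integrable(2)[where M = Mw] continuous_intros
          continuous_on_subset[OF wcB ball_subset_cball]) auto
    fix \<psi> :: "'a \<Rightarrow> real" assume \<psi>: "\<psi> \<in> test_functions ?B"
    then have \<psi>': "\<psi> \<in> test_functions \<Omega>" using B\<Omega> by (auto simp: test_functions_def)
    obtain T where T: "T \<subseteq> ?B" "\<And>x. x \<notin> T \<Longrightarrow> \<psi> x = 0" using test_function_props[OF \<psi>] by metis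
    have "(\<lambda>y. indicat_real ?B y *\<^sub>R (\<psi> y *\<^sub>R (w y *\<^sub>R b))) = (\<lambda>y. (indicat_real \<Omega> y *\<^sub>R (\<psi> y * w y)) *\<^sub>R b)"
    proof
      fix y show "indicat_real ?B y *\<^sub>R (\<psi> y *\<^sub>R (w y *\<^sub>R b)) = (indicat_real \<Omega> y *\<^sub>R (\<psi> y * w y)) *\<^sub>R b"
        using T B\<Omega> by (cases "y \<in> T") (auto simp: subset_iff)
    qed
    then show "(LINT y:?B|lebesgue. \<psi> y *\<^sub>R (w y *\<^sub>R b)) = 0"
      using zero[OF \<psi>'] unfolding set_lebesgue_integral_def set_integrable_def by simp
  qed auto
  moreover have "continuous_on ?B (\<lambda>y. w y *\<^sub>R b)"
    by (intro continuous_on_scaleR continuous_on_subset[OF wc B\<Omega>] continuous_on_const)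
  ultimately have "w x *\<^sub>R b = 0" using r(1) by (intro AE_zero_imp_zero[of ?B]) auto
  then have "w x = 0" using b by (auto simp: nonzero_Basis)
  then have "L x = - \<tau> * u x" by (simp add: w_def)
  then show ?thesis using lap(1)[OF x] by simp
qed

section \<open>Traces\<close>

lemma nn_integral_affine:
  fixes f :: "'a::euclidean_space \<Rightarrow> ennreal"
  assumes [measurable]: "f \<in> borel_measurable borel" and c: "c \<noteq> 0"
  shows "(\<integral>\<^sup>+x. f x \<partial>lborel) = ennreal (\<bar>c\<bar> ^ DIM('a)) * (\<integral>\<^sup>+x. f (t + c *\<^sub>R x) \<partial>lborel)"
  by (subst lborel_affine[OF c, of t])
     (simp add: nn_integral_density nn_integral_distr nn_integral_cmult)

lemma measurable_sgn_vec [measurable]: "(sgn :: 'a::euclidean_space \<Rightarrow> 'a) \<in> borel_measurable borel"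
  unfolding sgn_div_norm[abs_def] by measurable

text \<open>Functions of \<open>sgn x\<close> are invariant under dilations, so only the scaling of
  the volume remains. This takes the place of polar coordinates.\<close>

lemma nn_integral_sgn_ball:
  fixes h :: "'a::euclidean_space \<Rightarrow> ennreal"
  assumes [measurable]: "h \<in> borel_measurable borel" and r: "0 < r"
  shows "(\<integral>\<^sup>+x. h (sgn x) * indicator (ball 0 r) x \<partial>lborel)
    = ennreal (r ^ DIM('a)) * (\<integral>\<^sup>+x. h (sgn x) * indicator (ball 0 1) x \<partial>lborel)"
proof -
  have "(\<integral>\<^sup>+x. h (sgn x) * indicator (ball 0 r) x \<partial>lborel)
      = ennreal (\<bar>r\<bar> ^ DIM('a)) * (\<integral>\<^sup>+x. h (sgn (0 + r *\<^sub>R x)) * indicator (ball 0 r) (0 + r *\<^sub>R x) \<partial>lborel)"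
  proof (rule nn_integral_affine)
    show "(\<lambda>x. h (sgn x) * indicator (ball 0 r) x) \<in> borel_measurable borel"
      by (intro borel_measurable_times_ennreal measurable_compose[OF measurable_sgn_vec assms(1)]
          borel_measurable_indicator) simp
  qed (use r in simp)
  also have "(\<lambda>x. h (sgn (0 + r *\<^sub>R x)) * indicator (ball 0 r) (0 + r *\<^sub>R x))
      = (\<lambda>x::'a. h (sgn x) * indicator (ball 0 1) x)"
    using r by (auto simp: fun_eq_iff indicator_def sgn_scaleR)
  finally show ?thesis using r by simp
qed

locale shell =
  fixes R0 R3 :: real and c :: "'a::euclidean_space"
  assumes R0: "0 < R0" and R03: "R0 < R3"
begin

definition "A = {x. R0 \<le> norm (x - c) \<and> norm (x - c) < R3}"

lemma A_borel [measurable]: "A \<in> sets borel"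
proof -
  have "A = ball c R3 - ball c R0" by (auto simp: A_def dist_norm norm_minus_commute)
  then show ?thesis by simp
qed

text \<open>A lower bound for \<open>R0 / norm (x - c)\<close> over the shell. Being independent of
  \<open>x\<close>, it gives all rays a common parameter interval, which permits the exchange of
  integrals.\<close>

definition "\<theta>0 = R0 / R3"

lemma \<theta>0: "0 < \<theta>0" "\<theta>0 < 1" using R0 R03 by (auto simp: \<theta>0_def)

text \<open>The estimate comes from integrating the derivative of \<open>f\<^sup>2\<close> along rays.\<close>

lemma trace_pointwise:
  assumes f: "continuous_on A f" "continuous_on A F"
    and D: "\<And>x. R0 < norm (x - c) \<Longrightarrow> norm (x - c) < R3 \<Longrightarrow> GDERIV f x :> F x"
    and x: "x \<in> A"
  defines "k \<equiv> \<lambda>y. indicat_real A y * ((f y)\<^sup>2 + (norm (F y))\<^sup>2)"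
  shows "ennreal ((f (c + R0 *\<^sub>R sgn (x - c)))\<^sup>2)
    \<le> ennreal ((f x)\<^sup>2) + ennreal R3 * (\<integral>\<^sup>+\<theta>. ennreal (k (c + \<theta> *\<^sub>R (x - c))) * indicator {\<theta>0..1} \<theta> \<partial>lborel)"
proof -
  define r where "r = norm (x - c)"
  have r: "R0 \<le> r" "r < R3" using x by (auto simp: A_def r_def)
  \<comment> \<open>The parameter at which the ray from \<open>c\<close> through \<open>x\<close>
    meets the inner sphere.\<close>
  define a where "a = R0 / r"
  have a: "0 < a" "a \<le> 1" "\<theta>0 \<le> a" "a * r = R0"
    using R0 r by (auto simp: a_def \<theta>0_def frac_le)
  define p where "p \<theta> = c + \<theta> *\<^sub>R (x - c)" for \<theta>
  have pn: "norm (p \<theta> - c) = \<theta> * r" if "0 \<le> \<theta>" for \<theta> using that by (simp add: p_def r_def)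
  have pA: "p \<theta> \<in> A" if "a \<le> \<theta>" "\<theta> \<le> 1" for \<theta>
  proof -
    have "a * r \<le> \<theta> * r" "\<theta> * r \<le> 1 * r" using that r R0 by (auto intro!: mult_right_mono)
    then show ?thesis using pn[of \<theta>] that a r by (simp add: A_def)
  qed
  have p_cont: "continuous_on S p" for S unfolding p_def by (intro continuous_intros)
  have pa: "p a = c + R0 *\<^sub>R sgn (x - c)"
    by (simp add: p_def a_def r_def sgn_div_norm divide_inverse)
  have p1: "p 1 = x" by (simp add: p_def)
  define g where "g \<theta> = 2 * f (p \<theta>) * (F (p \<theta>) \<bullet> (x - c))" for \<theta>
  have fp: "continuous_on {a..1} (\<lambda>\<theta>. f (p \<theta>))" "continuous_on {a..1} (\<lambda>\<theta>. F (p \<theta>))"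
    using pA by (auto intro!: continuous_on_compose2[OF f(1) p_cont] continuous_on_compose2[OF f(2) p_cont])
  have ftc: "(g has_integral (f (p 1))\<^sup>2 - (f (p a))\<^sup>2) {a..1}"
  proof (rule fundamental_theorem_of_calculus_interior[OF a(2)])
    show "continuous_on {a..1} (\<lambda>\<theta>. (f (p \<theta>))\<^sup>2)" by (intro continuous_intros fp)
    fix \<theta> assume \<theta>: "\<theta> \<in> {a<..<1}"
    have "a * r < \<theta> * r" "\<theta> * r < 1 * r" using \<theta> r R0 by (auto intro!: mult_strict_right_mono)
    then have "GDERIV f (p \<theta>) :> F (p \<theta>)" using pn[of \<theta>] \<theta> a r by (intro D) auto
    then have "((\<lambda>\<theta>. f (p \<theta>)) has_real_derivative F (p \<theta>) \<bullet> (x - c)) (at \<theta>)"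
      unfolding p_def by (rule GDERIV_along_line)
    then have "((\<lambda>\<theta>. (f (p \<theta>))\<^sup>2) has_real_derivative g \<theta>) (at \<theta>)"
      unfolding g_def by (auto intro!: derivative_eq_intros)
    then show "((\<lambda>\<theta>. (f (p \<theta>))\<^sup>2) has_vector_derivative g \<theta>) (at \<theta>)"
      by (simp add: has_real_derivative_iff_has_vector_derivative)
  qed
  have kp: "k (p \<theta>) = (f (p \<theta>))\<^sup>2 + (norm (F (p \<theta>)))\<^sup>2" if "a \<le> \<theta>" "\<theta> \<le> 1" for \<theta>
    using pA[OF that] by (simp add: k_def)
  obtain I where I: "((\<lambda>\<theta>. (f (p \<theta>))\<^sup>2 + (norm (F (p \<theta>)))\<^sup>2) has_integral I) {a..1}"
  proof -
    have "continuous_on {a..1} (\<lambda>\<theta>. (f (p \<theta>))\<^sup>2 + (norm (F (p \<theta>)))\<^sup>2)"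
      by (intro continuous_intros fp)
    then show ?thesis
      using that integrable_continuous_real unfolding integrable_on_def by blast
  qed
  have I0: "0 \<le> I" by (rule has_integral_nonneg[OF I]) simp
  have "(f (p a))\<^sup>2 - (f (p 1))\<^sup>2 \<le> R3 * I"
  proof (rule has_integral_le)
    show "((\<lambda>\<theta>. - g \<theta>) has_integral (f (p a))\<^sup>2 - (f (p 1))\<^sup>2) {a..1}"
      using has_integral_neg[OF ftc] by simp
    show "((\<lambda>\<theta>. R3 * ((f (p \<theta>))\<^sup>2 + (norm (F (p \<theta>)))\<^sup>2)) has_integral R3 * I) {a..1}"
      by (rule has_integral_mult_right[OF I])
    fix \<theta> :: real
    have "- g \<theta> \<le> 2 * \<bar>f (p \<theta>)\<bar> * (norm (F (p \<theta>)) * r)"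
    proof -
      have "- g \<theta> \<le> \<bar>g \<theta>\<bar>" by simp
      also have "\<bar>g \<theta>\<bar> = 2 * \<bar>f (p \<theta>)\<bar> * \<bar>F (p \<theta>) \<bullet> (x - c)\<bar>" by (simp add: g_def abs_mult)
      also have "\<dots> \<le> 2 * \<bar>f (p \<theta>)\<bar> * (norm (F (p \<theta>)) * r)"
        unfolding r_def by (intro mult_left_mono Cauchy_Schwarz_ineq2) auto
      finally show ?thesis .
    qed
    also have "\<dots> = r * (2 * \<bar>f (p \<theta>)\<bar> * norm (F (p \<theta>)))" by simp
    also have "\<dots> \<le> R3 * ((f (p \<theta>))\<^sup>2 + (norm (F (p \<theta>)))\<^sup>2)"
    proof (rule mult_mono)
      show "2 * \<bar>f (p \<theta>)\<bar> * norm (F (p \<theta>)) \<le> (f (p \<theta>))\<^sup>2 + (norm (F (p \<theta>)))\<^sup>2"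
        using sum_squares_bound[of "\<bar>f (p \<theta>)\<bar>" "norm (F (p \<theta>))"] by simp
    qed (use r R0 in auto)
    finally show "- g \<theta> \<le> R3 * ((f (p \<theta>))\<^sup>2 + (norm (F (p \<theta>)))\<^sup>2)" .
  qed
  then have "ennreal ((f (p a))\<^sup>2) \<le> ennreal ((f x)\<^sup>2 + R3 * I)" by (intro ennreal_leI) (simp add: p1)
  also have "\<dots> = ennreal ((f x)\<^sup>2) + ennreal R3 * ennreal I"
    using I0 R0 R03 by (simp add: ennreal_plus ennreal_mult)
  also have "ennreal I = (\<integral>\<^sup>+\<theta>. ennreal ((f (p \<theta>))\<^sup>2 + (norm (F (p \<theta>)))\<^sup>2) * indicator {a..1} \<theta> \<partial>lborel)"
    by (rule nn_integral_has_integral_lebesgue'[OF _ I, symmetric]) simp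
  also have "\<dots> \<le> (\<integral>\<^sup>+\<theta>. ennreal (k (p \<theta>)) * indicator {\<theta>0..1} \<theta> \<partial>lborel)"
    by (rule nn_integral_mono) (use kp a in \<open>auto simp: indicator_def\<close>)
  finally show ?thesis unfolding pa unfolding p_def by (simp add: add_left_mono mult_left_mono)
qed

text \<open>The pointwise estimate is integrated over the shell. For fixed \<theta> the dilation by
  \<theta> costs a factor \<open>1 / \<theta> ^ DIM('a)\<close>, bounded through \<theta>0. On the
  left, a function of the direction alone integrates over the shell to
  \<open>R3 ^ DIM('a) - R0 ^ DIM('a)\<close> times its integral over the unit ball.\<close>

lemma trace_inequality:
  assumes f: "continuous_on A f" "continuous_on A F"
    and D: "\<And>x. R0 < norm (x - c) \<Longrightarrow> norm (x - c) < R3 \<Longrightarrow> GDERIV f x :> F x"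
    and sph: "continuous_on (sphere c R0) f"
  defines "k \<equiv> \<lambda>y. indicat_real A y * ((f y)\<^sup>2 + (norm (F y))\<^sup>2)"
  shows "ennreal (R3 ^ DIM('a) - R0 ^ DIM('a)) *
      (\<integral>\<^sup>+z. ennreal ((f (c + R0 *\<^sub>R sgn z))\<^sup>2) * indicator (ball 0 1) z \<partial>lborel)
    \<le> ennreal (1 + R3 / \<theta>0 ^ DIM('a)) * (\<integral>\<^sup>+y. ennreal (k y) \<partial>lborel)"
proof -
  have k_cont: "(\<lambda>y. indicat_real A y *\<^sub>R ((f y)\<^sup>2 + (norm (F y))\<^sup>2)) \<in> borel_measurable borel"
    by (intro borel_measurable_continuous_on_indicator continuous_intros f) simp
  then have [measurable]: "k \<in> borel_measurable borel" by (simp add: k_def)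
  have k0: "0 \<le> k y" for y by (simp add: k_def)
  \<comment> \<open>Cutting \<open>f\<close> down to the sphere gives a Borel function; the value at
    \<open>z = 0\<close>, where \<open>sgn z\<close> leaves the unit sphere, affects a null set
    only.\<close>
  define H where "H v = indicat_real (sphere 0 1) v *\<^sub>R (f (c + R0 *\<^sub>R v))\<^sup>2" for v
  have "continuous_on (sphere 0 1) (\<lambda>v. (f (c + R0 *\<^sub>R v))\<^sup>2)"
    by (intro continuous_intros continuous_on_compose2[OF sph]) (use R0 in \<open>auto simp: dist_norm\<close>)
  then have [measurable]: "H \<in> borel_measurable borel"
    unfolding H_def[abs_def] by (intro borel_measurable_continuous_on_indicator) auto
  have Hs: "H (sgn z) = (f (c + R0 *\<^sub>R sgn z))\<^sup>2" if "z \<noteq> 0" for z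
    using that by (simp add: H_def norm_sgn)
  define N where "N = (\<integral>\<^sup>+z. ennreal (H (sgn z)) * indicator (ball 0 1) z \<partial>lborel)"
  have "AE z in lborel. z \<noteq> (0::'a)" by (rule AE_lborel_singleton)
  then have Neq: "(\<integral>\<^sup>+z. ennreal ((f (c + R0 *\<^sub>R sgn z))\<^sup>2) * indicator (ball 0 1) z \<partial>lborel) = N"
    unfolding N_def by (intro nn_integral_cong_AE) (auto simp: Hs)
  have Nball: "(\<integral>\<^sup>+z. ennreal (H (sgn z)) * indicator (ball 0 r) z \<partial>lborel) = ennreal (r ^ DIM('a)) * N"
    if "0 < r" for r
    unfolding N_def by (rule nn_integral_sgn_ball[OF _ that]) measurable
  \<comment> \<open>Finiteness allows the inner ball to be cancelled when the shell is written as a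
    difference of two balls.\<close>
  have Nfin: "N < \<infinity>"
  proof -
    have "bounded ((\<lambda>v. (f (c + R0 *\<^sub>R v))\<^sup>2) ` sphere 0 1)"
      using \<open>continuous_on (sphere 0 1) (\<lambda>v. (f (c + R0 *\<^sub>R v))\<^sup>2)\<close>
      by (intro compact_imp_bounded compact_continuous_image) auto
    then obtain B where B: "\<And>v. v \<in> sphere 0 1 \<Longrightarrow> (f (c + R0 *\<^sub>R v))\<^sup>2 \<le> B"
      unfolding bounded_iff by fastforce
    have "H v \<le> max B 0" for v using B[of v] by (cases "v \<in> sphere 0 1") (auto simp: H_def)
    then have "N \<le> (\<integral>\<^sup>+z. ennreal (max B 0) * indicator (ball (0::'a) 1) z \<partial>lborel)"
      unfolding N_def by (intro nn_integral_mono mult_right_mono ennreal_leI) auto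
    also have "\<dots> < \<infinity>"
      using emeasure_bounded_finite[of "ball (0::'a) 1"]
      by (simp add: nn_integral_cmult_indicator ennreal_mult_less_top)
    finally show ?thesis .
  qed
  define S where "S = {z :: 'a. R0 \<le> norm z \<and> norm z < R3}"
  have S_eq: "S = ball 0 R3 - ball 0 R0" by (auto simp: S_def)
  have [measurable]: "S \<in> sets borel" "\<And>r. ball (0::'a) r \<in> sets borel" by (simp_all add: S_eq)
  define J where "J = (\<integral>\<^sup>+z. ennreal (H (sgn z)) * indicator S z \<partial>lborel)"
  have split: "ennreal (R3 ^ DIM('a)) * N = J + ennreal (R0 ^ DIM('a)) * N"
  proof -
    have "ennreal (R3 ^ DIM('a)) * N = (\<integral>\<^sup>+z. ennreal (H (sgn z)) * indicator (ball 0 R3) z \<partial>lborel)"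
      using Nball[of R3] R0 R03 by simp
    also have "\<dots> = (\<integral>\<^sup>+z. ennreal (H (sgn z)) * indicator S z
        + ennreal (H (sgn z)) * indicator (ball 0 R0) z \<partial>lborel)"
      using R03 by (intro nn_integral_cong) (auto simp: S_def indicator_def)
    also have "\<dots> = J + ennreal (R0 ^ DIM('a)) * N"
      unfolding J_def Nball[OF R0, symmetric] by (rule nn_integral_add) measurable
    finally show ?thesis .
  qed
  have pw: "R0 ^ DIM('a) \<le> R3 ^ DIM('a)" using R0 R03 by (simp add: power_mono)
  have "ennreal (R3 ^ DIM('a) - R0 ^ DIM('a)) * N = J"
  proof -
    have "ennreal (R3 ^ DIM('a)) = ennreal (R3 ^ DIM('a) - R0 ^ DIM('a)) + ennreal (R0 ^ DIM('a))"
      using pw R0 by (subst ennreal_plus[symmetric]) auto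
    then have "ennreal (R3 ^ DIM('a) - R0 ^ DIM('a)) * N + ennreal (R0 ^ DIM('a)) * N = J + ennreal (R0 ^ DIM('a)) * N"
      using split by (simp add: distrib_right)
    moreover have "ennreal (R0 ^ DIM('a)) * N \<noteq> top" using Nfin by (simp add: ennreal_mult_eq_top_iff)
    ultimately show ?thesis by (metis ennreal_add_left_cancel add.commute infinity_ennreal_def)
  qed
  also have "J = (\<integral>\<^sup>+x. ennreal (H (sgn (x - c))) * indicator A x \<partial>lborel)"
  proof -
    have "(\<integral>\<^sup>+x. ennreal (H (sgn (x - c))) * indicator A x \<partial>lborel)
        = ennreal (\<bar>1\<bar> ^ DIM('a)) * (\<integral>\<^sup>+x. ennreal (H (sgn (c + 1 *\<^sub>R x - c))) * indicator A (c + 1 *\<^sub>R x) \<partial>lborel)"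
      by (rule nn_integral_affine) auto
    then show ?thesis unfolding J_def by (simp add: A_def S_def indicator_def)
  qed
  also have "\<dots> \<le> (\<integral>\<^sup>+x. ennreal (k x) +
      ennreal R3 * (\<integral>\<^sup>+\<theta>. ennreal (k (c + \<theta> *\<^sub>R (x - c))) * indicator {\<theta>0..1} \<theta> \<partial>lborel) \<partial>lborel)"
  proof (rule nn_integral_mono)
    fix x
    show "ennreal (H (sgn (x - c))) * indicator A x \<le> ennreal (k x) +
      ennreal R3 * (\<integral>\<^sup>+\<theta>. ennreal (k (c + \<theta> *\<^sub>R (x - c))) * indicator {\<theta>0..1} \<theta> \<partial>lborel)"
    proof (cases "x \<in> A")
      case True
      then have "x - c \<noteq> 0" using R0 by (auto simp: A_def)
      then have "ennreal (H (sgn (x - c))) \<le> ennreal ((f x)\<^sup>2) + ennreal R3 *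
          (\<integral>\<^sup>+\<theta>. ennreal (k (c + \<theta> *\<^sub>R (x - c))) * indicator {\<theta>0..1} \<theta> \<partial>lborel)"
        using trace_pointwise[OF f D True] by (simp add: Hs k_def)
      also have "ennreal ((f x)\<^sup>2) \<le> ennreal (k x)" using True by (intro ennreal_leI) (simp add: k_def)
      finally show ?thesis using True by (simp add: add_right_mono)
    qed simp
  qed
  also have "\<dots> = (\<integral>\<^sup>+x. ennreal (k x) \<partial>lborel) + ennreal R3 *
      (\<integral>\<^sup>+x. (\<integral>\<^sup>+\<theta>. ennreal (k (c + \<theta> *\<^sub>R (x - c))) * indicator {\<theta>0..1} \<theta> \<partial>lborel) \<partial>lborel)"
    by (subst nn_integral_add) (auto simp: nn_integral_cmult)
  also have "(\<integral>\<^sup>+x. (\<integral>\<^sup>+\<theta>. ennreal (k (c + \<theta> *\<^sub>R (x - c))) * indicator {\<theta>0..1} \<theta> \<partial>lborel) \<partial>lborel)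
      = (\<integral>\<^sup>+\<theta>. (\<integral>\<^sup>+x. ennreal (k (c + \<theta> *\<^sub>R (x - c))) * indicator {\<theta>0..1} \<theta> \<partial>lborel) \<partial>lborel)"
    by (rule lborel_pair.Fubini'[symmetric]) measurable
  also have "\<dots> \<le> (\<integral>\<^sup>+\<theta>. ennreal (1 / \<theta>0 ^ DIM('a)) * (\<integral>\<^sup>+y. ennreal (k y) \<partial>lborel) * indicator {\<theta>0..1} \<theta> \<partial>lborel)"
  proof (rule nn_integral_mono)
    fix \<theta> :: real
    show "(\<integral>\<^sup>+x. ennreal (k (c + \<theta> *\<^sub>R (x - c))) * indicator {\<theta>0..1} \<theta> \<partial>lborel)
        \<le> ennreal (1 / \<theta>0 ^ DIM('a)) * (\<integral>\<^sup>+y. ennreal (k y) \<partial>lborel) * indicator {\<theta>0..1} \<theta>"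
    proof (cases "\<theta> \<in> {\<theta>0..1}")
      case True
      then have \<theta>: "0 < \<theta>" "\<theta>0 \<le> \<theta>" using \<theta>0 by auto
      have "(\<integral>\<^sup>+y. ennreal (k y) \<partial>lborel) = ennreal (\<bar>\<theta>\<bar> ^ DIM('a)) *
          (\<integral>\<^sup>+x. ennreal (k ((c - \<theta> *\<^sub>R c) + \<theta> *\<^sub>R x)) \<partial>lborel)"
        by (rule nn_integral_affine) (use \<theta> in auto)
      then have eq: "(\<integral>\<^sup>+y. ennreal (k y) \<partial>lborel) = ennreal (\<theta> ^ DIM('a)) *
          (\<integral>\<^sup>+x. ennreal (k (c + \<theta> *\<^sub>R (x - c))) \<partial>lborel)"
        using \<theta> by (simp add: algebra_simps)
      have "(\<integral>\<^sup>+x. ennreal (k (c + \<theta> *\<^sub>R (x - c))) \<partial>lborel)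
          = ennreal (1 / \<theta> ^ DIM('a)) * (\<integral>\<^sup>+y. ennreal (k y) \<partial>lborel)"
        unfolding eq mult.assoc[symmetric] using \<theta> by (simp add: ennreal_mult[symmetric])
      also have "\<dots> \<le> ennreal (1 / \<theta>0 ^ DIM('a)) * (\<integral>\<^sup>+y. ennreal (k y) \<partial>lborel)"
        using \<theta> \<theta>0 by (intro mult_right_mono ennreal_leI divide_left_mono power_mono mult_pos_pos) auto
      finally show ?thesis using True by simp
    qed simp
  qed
  also have "\<dots> = ennreal (1 / \<theta>0 ^ DIM('a)) * (\<integral>\<^sup>+y. ennreal (k y) \<partial>lborel) * ennreal (1 - \<theta>0)"
    using \<theta>0 by (subst nn_integral_cmult_indicator) auto
  also have "\<dots> \<le> ennreal (1 / \<theta>0 ^ DIM('a)) * (\<integral>\<^sup>+y. ennreal (k y) \<partial>lborel) * ennreal 1"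
    using \<theta>0 by (intro mult_left_mono ennreal_leI) auto
  finally have "ennreal (R3 ^ DIM('a) - R0 ^ DIM('a)) * N \<le> (\<integral>\<^sup>+x. ennreal (k x) \<partial>lborel) + ennreal R3 *
      (ennreal (1 / \<theta>0 ^ DIM('a)) * (\<integral>\<^sup>+y. ennreal (k y) \<partial>lborel))"
    by (simp add: add_left_mono mult_left_mono)
  also have "\<dots> = ennreal (1 + R3 / \<theta>0 ^ DIM('a)) * (\<integral>\<^sup>+y. ennreal (k y) \<partial>lborel)"
  proof -
    have "ennreal (1 + R3 / \<theta>0 ^ DIM('a)) = 1 + ennreal R3 * ennreal (1 / \<theta>0 ^ DIM('a))"
      using R0 R03 \<theta>0 by (subst ennreal_plus) (auto simp: ennreal_mult[symmetric])
    then show ?thesis by (simp add: distrib_right mult.assoc)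
  qed
  finally show ?thesis unfolding Neq .
qed

end

section \<open>From a vanishing trace to vanishing boundary values\<close>

text \<open>A bridge between the distance built from \<open>wgrad\<close> and the nonnegative
  integral of classical gradients in the trace inequality.\<close>

lemma H1_dist_sq_C1_closure:
  fixes u \<phi> :: "'a::euclidean_space \<Rightarrow> real"
  assumes \<Omega>: "open \<Omega>" "bounded \<Omega>" and u: "u \<in> C1_closure \<Omega>" and \<phi>: "\<phi> \<in> C1_closure \<Omega>"
  shows "(\<integral>\<^sup>+x. ennreal (indicat_real \<Omega> x * ((\<phi> x - u x)\<^sup>2 + (norm (grad \<phi> x - grad u x))\<^sup>2)) \<partial>lborel)
    = ennreal (H1_dist_sq \<Omega> \<phi> u)"
proof -
  obtain M where "\<And>x. x \<in> \<Omega> \<Longrightarrow> GDERIV u x :> grad u x"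
    and M: "continuous_on \<Omega> (grad u)" "continuous_on \<Omega> u"
      "\<And>x. x \<in> \<Omega> \<Longrightarrow> norm (u x) \<le> M" "\<And>x. x \<in> \<Omega> \<Longrightarrow> norm (grad u x) \<le> M"
    by (rule C1_closure_props[OF \<Omega>(2) u]) (rule that, assumption+)
  obtain N where "\<And>x. x \<in> \<Omega> \<Longrightarrow> GDERIV \<phi> x :> grad \<phi> x"
    and N: "continuous_on \<Omega> (grad \<phi>)" "continuous_on \<Omega> \<phi>"
      "\<And>x. x \<in> \<Omega> \<Longrightarrow> norm (\<phi> x) \<le> N" "\<And>x. x \<in> \<Omega> \<Longrightarrow> norm (grad \<phi> x) \<le> N"
    by (rule C1_closure_props[OF \<Omega>(2) \<phi>]) (rule that, assumption+)
  have bnd: "norm ((norm (a - b))\<^sup>2) \<le> (N + M)\<^sup>2" if "norm a \<le> N" "norm b \<le> M" for a b :: "'b::real_normed_vector"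
  proof -
    have "norm (a - b) \<le> N + M" using norm_triangle_ineq4[of a b] that by linarith
    then show ?thesis by (simp add: power_mono)
  qed
  have i1: "(\<lambda>x. indicat_real \<Omega> x *\<^sub>R (\<phi> x - u x)\<^sup>2) \<in> borel_measurable borel"
    "set_integrable lebesgue \<Omega> (\<lambda>x. (\<phi> x - u x)\<^sup>2)"
  proof -
    have c: "continuous_on \<Omega> (\<lambda>x. (\<phi> x - u x)\<^sup>2)" by (intro continuous_intros M N)
    have b: "norm ((\<phi> x - u x)\<^sup>2) \<le> (N + M)\<^sup>2" if "x \<in> \<Omega>" for x
      using bnd[OF N(3)[OF that] M(3)[OF that]] by simp
    show "(\<lambda>x. indicat_real \<Omega> x *\<^sub>R (\<phi> x - u x)\<^sup>2) \<in> borel_measurable borel"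
      "set_integrable lebesgue \<Omega> (\<lambda>x. (\<phi> x - u x)\<^sup>2)"
      by (rule bounded_continuous_set_integrable[OF \<Omega> c b], assumption)+
  qed
  have i2: "(\<lambda>x. indicat_real \<Omega> x *\<^sub>R (norm (grad \<phi> x - grad u x))\<^sup>2) \<in> borel_measurable borel"
    "set_integrable lebesgue \<Omega> (\<lambda>x. (norm (grad \<phi> x - grad u x))\<^sup>2)"
  proof -
    have c: "continuous_on \<Omega> (\<lambda>x. (norm (grad \<phi> x - grad u x))\<^sup>2)" by (intro continuous_intros M N)
    have b: "norm ((norm (grad \<phi> x - grad u x))\<^sup>2) \<le> (N + M)\<^sup>2" if "x \<in> \<Omega>" for x
      by (rule bnd[OF N(4)[OF that] M(4)[OF that]])
    show "(\<lambda>x. indicat_real \<Omega> x *\<^sub>R (norm (grad \<phi> x - grad u x))\<^sup>2) \<in> borel_measurable borel"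
      "set_integrable lebesgue \<Omega> (\<lambda>x. (norm (grad \<phi> x - grad u x))\<^sup>2)"
      by (rule bounded_continuous_set_integrable[OF \<Omega> c b], assumption)+
  qed
  have weq: "(LINT x:\<Omega>|lebesgue. (norm (wgrad \<Omega> \<phi> x - wgrad \<Omega> u x))\<^sup>2)
      = (LINT x:\<Omega>|lebesgue. (norm (grad \<phi> x - grad u x))\<^sup>2)"
    unfolding set_lebesgue_integral_def
  proof (rule integral_cong_AE)
    have eq: "(\<lambda>x. indicat_real \<Omega> x *\<^sub>R (norm (g x - h x))\<^sup>2)
        = (\<lambda>x. (norm (indicat_real \<Omega> x *\<^sub>R g x - indicat_real \<Omega> x *\<^sub>R h x))\<^sup>2)"
      for g h :: "'a \<Rightarrow> 'a" by (auto simp: indicator_def fun_eq_iff)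
    show "(\<lambda>x. indicat_real \<Omega> x *\<^sub>R (norm (wgrad \<Omega> \<phi> x - wgrad \<Omega> u x))\<^sup>2) \<in> borel_measurable lebesgue"
      unfolding eq
      by (intro borel_measurable_power measurable_compose[OF borel_measurable_diff borel_measurable_norm]
          wgrad_measurable \<Omega> u \<phi>)
    show "(\<lambda>x. indicat_real \<Omega> x *\<^sub>R (norm (grad \<phi> x - grad u x))\<^sup>2) \<in> borel_measurable lebesgue"
      unfolding eq
      by (intro borel_measurable_power measurable_compose[OF borel_measurable_diff borel_measurable_norm]
          wgrad_measurable \<Omega> u \<phi>)
    show "AE x in lebesgue. indicat_real \<Omega> x *\<^sub>R (norm (wgrad \<Omega> \<phi> x - wgrad \<Omega> u x))\<^sup>2
        = indicat_real \<Omega> x *\<^sub>R (norm (grad \<phi> x - grad u x))\<^sup>2"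
      using C1_closure_weak_gradient(3)[OF \<Omega> u] C1_closure_weak_gradient(3)[OF \<Omega> \<phi>]
      by eventually_elim (simp add: indicator_def)
  qed
  have lb: "integrable lborel (\<lambda>x. indicat_real \<Omega> x *\<^sub>R f x) \<and>
      (LINT x:\<Omega>|lebesgue. f x) = (LINT x|lborel. indicat_real \<Omega> x *\<^sub>R f x)"
    if "(\<lambda>x. indicat_real \<Omega> x *\<^sub>R f x) \<in> borel_measurable borel" "set_integrable lebesgue \<Omega> f" for f :: "'a \<Rightarrow> real"
    using that set_lebesgue_integral_lborel[OF that(1)] integrable_completion[of "\<lambda>x. indicat_real \<Omega> x *\<^sub>R f x" lborel]
    by (simp add: set_integrable_def)
  note lb1 = lb[OF i1] and lb2 = lb[OF i2]
  have "(\<integral>\<^sup>+x. ennreal (indicat_real \<Omega> x * ((\<phi> x - u x)\<^sup>2 + (norm (grad \<phi> x - grad u x))\<^sup>2)) \<partial>lborel)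
      = (\<integral>\<^sup>+x. ennreal (indicat_real \<Omega> x *\<^sub>R (\<phi> x - u x)\<^sup>2 + indicat_real \<Omega> x *\<^sub>R (norm (grad \<phi> x - grad u x))\<^sup>2) \<partial>lborel)"
    by (simp add: distrib_left)
  also have "\<dots> = ennreal (LINT x|lborel. indicat_real \<Omega> x *\<^sub>R (\<phi> x - u x)\<^sup>2 + indicat_real \<Omega> x *\<^sub>R (norm (grad \<phi> x - grad u x))\<^sup>2)"
    using lb1 lb2 by (intro nn_integral_eq_integral Bochner_Integration.integrable_add) auto
  also have "(LINT x|lborel. indicat_real \<Omega> x *\<^sub>R (\<phi> x - u x)\<^sup>2 + indicat_real \<Omega> x *\<^sub>R (norm (grad \<phi> x - grad u x))\<^sup>2)
      = H1_dist_sq \<Omega> \<phi> u"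
    unfolding H1_dist_sq_def weq using lb1 lb2 by (subst Bochner_Integration.integral_add) auto
  finally show ?thesis .
qed

text \<open>Matches the surface integral of the trace definition with the integral over directions
  in the trace inequality. Both are finite because \<open>g\<close> is bounded on the sphere, so
  passing between real and extended values loses nothing.\<close>

lemma sphere_integral:
  fixes c :: "'a::euclidean_space" and g :: "'a \<Rightarrow> real"
  assumes r: "0 < r" and g: "continuous_on (sphere c r) g"
  shows "(\<integral>\<^sup>+z. ennreal ((g (c + r *\<^sub>R sgn z))\<^sup>2) * indicator (ball 0 1) z \<partial>lborel)
    = ennreal ((LINT x:sphere c r|sphere_measure c r. (g x)\<^sup>2) / (real DIM('a) * r ^ (DIM('a) - 1)))"
proof -
  define D where "D = real DIM('a) * r ^ (DIM('a) - 1)"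
  have D: "0 < D" using r by (simp add: D_def)
  define h where "h x = indicat_real (sphere c r) x *\<^sub>R (g x)\<^sup>2" for x
  have [measurable]: "h \<in> borel_measurable borel"
    unfolding h_def[abs_def] by (intro borel_measurable_continuous_on_indicator continuous_intros g) auto
  have h0: "0 \<le> h x" for x by (simp add: h_def)
  let ?T = "\<lambda>z::'a. c + r *\<^sub>R sgn z"
  have T: "?T \<in> borel_measurable borel" by measurable
  then have T': "?T \<in> measurable (restrict_space lborel (ball 0 1)) borel"
    by (intro measurable_restrict_space1) simp
  have sets: "sets (sphere_measure c r) = sets borel" by (simp add: sphere_measure_def)
  have "(\<integral>\<^sup>+x. ennreal (h x) \<partial>sphere_measure c r)
      = ennreal D * (\<integral>\<^sup>+x. ennreal (h x) \<partial>distr (restrict_space lborel (ball 0 1)) borel ?T)"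
    unfolding sphere_measure_def D_def[symmetric] by (subst nn_integral_scale_measure) auto
  also have "(\<integral>\<^sup>+x. ennreal (h x) \<partial>distr (restrict_space lborel (ball 0 1)) borel ?T)
      = (\<integral>\<^sup>+z. ennreal (h (?T z)) \<partial>restrict_space lborel (ball 0 1))"
    by (rule nn_integral_distr[OF T']) measurable
  also have "\<dots> = (\<integral>\<^sup>+z. ennreal (h (?T z)) * indicator (ball 0 1) z \<partial>lborel)"
    by (rule nn_integral_restrict_space) simp
  also have "\<dots> = (\<integral>\<^sup>+z. ennreal ((g (?T z))\<^sup>2) * indicator (ball 0 1) z \<partial>lborel)"
  proof (rule nn_integral_cong_AE)
    have "AE z in lborel. z \<noteq> (0::'a)" by (rule AE_lborel_singleton)
    then show "AE z in lborel. ennreal (h (?T z)) * indicator (ball 0 1) z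
        = ennreal ((g (?T z))\<^sup>2) * indicator (ball 0 1) z"
      by eventually_elim (use r in \<open>simp add: h_def dist_norm norm_sgn\<close>)
  qed
  finally have eq: "(\<integral>\<^sup>+x. ennreal (h x) \<partial>sphere_measure c r)
      = ennreal D * (\<integral>\<^sup>+z. ennreal ((g (?T z))\<^sup>2) * indicator (ball 0 1) z \<partial>lborel)" (is "_ = _ * ?J") .
  have Jfin: "?J < \<infinity>"
  proof -
    have "bounded ((\<lambda>x. (g x)\<^sup>2) ` sphere c r)"
      by (intro compact_imp_bounded compact_continuous_image continuous_intros g) auto
    then obtain B where B: "\<forall>v\<in>(\<lambda>x. (g x)\<^sup>2) ` sphere c r. norm v \<le> B" unfolding bounded_iff by blast
    have "(g (?T z))\<^sup>2 \<le> max B ((g c)\<^sup>2)" for z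
    proof (cases "z = 0")
      case False
      then have "?T z \<in> sphere c r" using r by (simp add: dist_norm norm_sgn)
      then have "norm ((g (?T z))\<^sup>2) \<le> B" using B by blast
      then show ?thesis by simp
    qed simp
    then have "?J \<le> (\<integral>\<^sup>+z. ennreal (max B ((g c)\<^sup>2)) * indicator (ball (0::'a) 1) z \<partial>lborel)"
      by (intro nn_integral_mono mult_right_mono ennreal_leI) auto
    also have "\<dots> < \<infinity>"
      using emeasure_bounded_finite[of "ball (0::'a) 1"]
      by (simp add: nn_integral_cmult_indicator ennreal_mult_less_top)
    finally show ?thesis .
  qed
  have "(LINT x:sphere c r|sphere_measure c r. (g x)\<^sup>2) = enn2real (\<integral>\<^sup>+x. ennreal (h x) \<partial>sphere_measure c r)"
    unfolding set_lebesgue_integral_def h_def[symmetric]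
    by (rule integral_eq_nn_integral) (use h0 in \<open>simp_all add: measurable_cong_sets[OF sets refl]\<close>)
  also have "\<dots> = D * enn2real ?J" unfolding eq using D by (simp add: enn2real_mult)
  finally have "(LINT x:sphere c r|sphere_measure c r. (g x)\<^sup>2) / D = enn2real ?J" using D by simp
  then show ?thesis using Jfin unfolding D_def by (simp add: less_top)
qed

text \<open>On the sphere the approximations tend to 0 in mean square, and by the trace inequality
  so does their difference to \<open>u\<close>. Thus \<open>u\<close> vanishes in almost every
  direction, and by continuity in every direction.\<close>

lemma trace_zero_imp_zero:
  fixes c :: "'a::euclidean_space"
  assumes R0: "0 < R0" and cR: "norm c + R0 < R1" and \<Omega>: "\<Omega> = annular_domain R0 R1 c"
    and u: "u \<in> C1_closure \<Omega>" and tr: "has_trace_on_sphere \<Omega> c R0 u (\<lambda>_. 0)"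
    and y: "norm (y - c) = R0"
  shows "u y = 0"
proof -
  note ob = open_bounded_annular_domain[OF R0, of R1 c, folded \<Omega>]
  have cl: "closure \<Omega> = cball 0 R1 - ball c R0" unfolding \<Omega> by (rule closure_annular_domain[OF R0 cR])
  define R3 where "R3 = (R0 + (R1 - norm c)) / 2"
  have R3: "R0 < R3" "R3 + norm c < R1" using cR by (auto simp: R3_def field_simps)
  interpret shell R0 R3 c by standard (use R0 R3 in auto)
  have nrm: "norm x < R1" if "norm (x - c) \<le> R3" for x
    using norm_triangle_ineq[of "x - c" c] that R3 by simp
  have A_cl: "A \<subseteq> closure \<Omega>"
    using nrm unfolding A_def cl by (auto simp: dist_norm norm_minus_commute less_imp_le)
  have A_\<Omega>: "x \<in> \<Omega>" if "R0 < norm (x - c)" "norm (x - c) < R3" for x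
    using nrm[of x] that unfolding \<Omega> annular_domain_eq[OF R0] by (auto simp: dist_norm norm_minus_commute)
  have sph_cl: "sphere c R0 \<subseteq> closure \<Omega>"
    using nrm R3 unfolding cl by (auto simp: dist_norm norm_minus_commute less_imp_le)
  from tr obtain \<phi> where \<phi>: "\<And>n::nat. \<phi> n \<in> C1_closure \<Omega>"
    and dist0: "(\<lambda>n. H1_dist_sq \<Omega> (\<phi> n) u) \<longlonglongrightarrow> 0"
    and tr0: "(\<lambda>n. LINT x:sphere c R0|sphere_measure c R0. (\<phi> n x)\<^sup>2) \<longlonglongrightarrow> 0"
    unfolding has_trace_on_sphere_def by auto
  have ext: "\<exists>G. continuous_on (closure \<Omega>) G \<and> (\<forall>x\<in>\<Omega>. G x = grad f x)" "continuous_on (closure \<Omega>) f"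
    "\<And>x. x \<in> \<Omega> \<Longrightarrow> GDERIV f x :> grad f x" if "f \<in> C1_closure \<Omega>" for f
    using that GDERIV_grad by (auto simp: C1_closure_def)
  obtain Gu where Gu: "continuous_on (closure \<Omega>) Gu" "\<And>x. x \<in> \<Omega> \<Longrightarrow> Gu x = grad u x"
    using ext(1)[OF u] by blast
  define J where "J f = (\<integral>\<^sup>+z. ennreal ((f (c + R0 *\<^sub>R sgn z))\<^sup>2) * indicator (ball 0 1) z \<partial>lborel)" for f
  define D where "D = real DIM('a) * R0 ^ (DIM('a) - 1)"
  define E where "E = R3 ^ DIM('a) - R0 ^ DIM('a)"
  have E: "0 < E" using R0 R3 by (simp add: E_def power_strict_mono)
  define C where "C = 1 + R3 / \<theta>0 ^ DIM('a)"
  have C: "0 < C" using R0 R3 \<theta>0 by (simp add: C_def add_pos_pos)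
  define t where "t n = (LINT x:sphere c R0|sphere_measure c R0. (\<phi> n x)\<^sup>2) / D" for n
  define h where "h n = H1_dist_sq \<Omega> (\<phi> n) u" for n
  have h0: "0 \<le> h n" for n
    unfolding h_def H1_dist_sq_def set_lebesgue_integral_def
    by (intro add_nonneg_nonneg Bochner_Integration.integral_nonneg) auto
  have t0: "0 \<le> t n" for n
    unfolding t_def set_lebesgue_integral_def D_def using R0
    by (intro divide_nonneg_nonneg Bochner_Integration.integral_nonneg) auto
  have J\<phi>: "J (\<phi> n) = ennreal (t n)" for n
    unfolding J_def t_def D_def
    by (rule sphere_integral[OF R0 continuous_on_subset[OF ext(2)[OF \<phi>] sph_cl]])
  have Jdiff: "J (\<lambda>x. \<phi> n x - u x) \<le> ennreal (C * h n / E)" for n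
  proof -
    obtain G where G: "continuous_on (closure \<Omega>) G" "\<And>x. x \<in> \<Omega> \<Longrightarrow> G x = grad (\<phi> n) x"
      using ext(1)[OF \<phi>] by blast
    have "ennreal E * J (\<lambda>x. \<phi> n x - u x) \<le> ennreal C *
        (\<integral>\<^sup>+y. ennreal (indicat_real A y * ((\<phi> n y - u y)\<^sup>2 + (norm (G y - Gu y))\<^sup>2)) \<partial>lborel)"
      unfolding E_def C_def J_def
    proof (rule trace_inequality)
      show "continuous_on A (\<lambda>x. \<phi> n x - u x)" "continuous_on (sphere c R0) (\<lambda>x. \<phi> n x - u x)"
        by (intro continuous_on_diff continuous_on_subset[OF ext(2)[OF \<phi>]] continuous_on_subset[OF ext(2)[OF u]]
            A_cl sph_cl)+
      show "continuous_on A (\<lambda>x. G x - Gu x)"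
        by (intro continuous_on_diff continuous_on_subset[OF G(1)] continuous_on_subset[OF Gu(1)] A_cl)
      show "GDERIV (\<lambda>x. \<phi> n x - u x) x :> G x - Gu x" if "R0 < norm (x - c)" "norm (x - c) < R3" for x
        using A_\<Omega>[OF that] G(2) Gu(2) ext(3)[OF \<phi>] ext(3)[OF u] by (auto intro: GDERIV_diff)
    qed
    also have "(\<integral>\<^sup>+y. ennreal (indicat_real A y * ((\<phi> n y - u y)\<^sup>2 + (norm (G y - Gu y))\<^sup>2)) \<partial>lborel)
        \<le> (\<integral>\<^sup>+y. ennreal (indicat_real \<Omega> y * ((\<phi> n y - u y)\<^sup>2 + (norm (grad (\<phi> n) y - grad u y))\<^sup>2)) \<partial>lborel)"
    proof (rule nn_integral_mono_AE)
      have "sphere c R0 \<in> null_sets lborel"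
        using negligible_sphere[of c R0] by (simp add: negligible_iff_null_sets null_sets_completion_iff)
      then have "AE y in lborel. y \<notin> sphere c R0" by (rule AE_not_in)
      then show "AE y in lborel. ennreal (indicat_real A y * ((\<phi> n y - u y)\<^sup>2 + (norm (G y - Gu y))\<^sup>2))
          \<le> ennreal (indicat_real \<Omega> y * ((\<phi> n y - u y)\<^sup>2 + (norm (grad (\<phi> n) y - grad u y))\<^sup>2))"
      proof eventually_elim
        case (elim y)
        show ?case
        proof (cases "y \<in> A")
          case True
          then have "y \<in> \<Omega>" using elim by (intro A_\<Omega>) (auto simp: A_def dist_norm norm_minus_commute)
          then show ?thesis using True G(2) Gu(2) by simp
        qed simp
      qed
    qed
    also have "\<dots> = ennreal (h n)" unfolding h_def by (rule H1_dist_sq_C1_closure[OF ob u \<phi>])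
    finally have "ennreal E * J (\<lambda>x. \<phi> n x - u x) \<le> ennreal C * ennreal (h n)"
      by (simp add: mult_left_mono)
    then have "ennreal (1 / E) * (ennreal E * J (\<lambda>x. \<phi> n x - u x)) \<le> ennreal (1 / E) * (ennreal C * ennreal (h n))"
      by (rule mult_left_mono) simp
    then show ?thesis using E C h0[of n] by (simp add: mult.assoc[symmetric] ennreal_mult[symmetric])
  qed
  \<comment> \<open>The functions are continuous on the closure only; restricting them to the sphere
    makes the integrands Borel without changing the integrals.\<close>
  define H where "H f x = indicat_real (sphere c R0) x *\<^sub>R f x" for f :: "'a \<Rightarrow> real" and x
  have HT: "H f (c + R0 *\<^sub>R sgn z) = f (c + R0 *\<^sub>R sgn z)" if "z \<noteq> 0" for f z
    using that R0 by (simp add: H_def dist_norm norm_sgn)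
  have JH: "J f = J (H f)" for f
    unfolding J_def
  proof (rule nn_integral_cong_AE)
    have "AE z in lborel. z \<noteq> (0::'a)" by (rule AE_lborel_singleton)
    then show "AE z in lborel. ennreal ((f (c + R0 *\<^sub>R sgn z))\<^sup>2) * indicator (ball 0 1) z
        = ennreal ((H f (c + R0 *\<^sub>R sgn z))\<^sup>2) * indicator (ball 0 1) z"
      by eventually_elim (simp only: HT not_False_eq_True)
  qed
  have Jm: "(\<lambda>z. ennreal ((H f (c + R0 *\<^sub>R sgn z))\<^sup>2) * indicator (ball 0 1) z) \<in> borel_measurable borel"
    if "continuous_on (closure \<Omega>) f" for f
  proof -
    have [measurable]: "H f \<in> borel_measurable borel" unfolding H_def[abs_def]
      by (intro borel_measurable_continuous_on_indicator continuous_on_subset[OF that sph_cl]) auto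
    have [measurable]: "ball (0::'a) 1 \<in> sets borel" by simp
    show ?thesis by measurable
  qed
  have bound: "J u \<le> ennreal (2 * t n + 2 * (C * h n / E))" for n
  proof -
    have "J u = J (H u)" by (rule JH)
    also have "\<dots> \<le> (\<integral>\<^sup>+z. ennreal 2 * (ennreal ((H (\<phi> n) (c + R0 *\<^sub>R sgn z))\<^sup>2) * indicator (ball 0 1) z)
        + ennreal 2 * (ennreal ((H (\<lambda>x. \<phi> n x - u x) (c + R0 *\<^sub>R sgn z))\<^sup>2) * indicator (ball 0 1) z) \<partial>lborel)"
      unfolding J_def
    proof (rule nn_integral_mono)
      fix z
      define p q where "p = H (\<phi> n) (c + R0 *\<^sub>R sgn z)" and "q = H u (c + R0 *\<^sub>R sgn z)"
      have pq: "H (\<lambda>x. \<phi> n x - u x) (c + R0 *\<^sub>R sgn z) = p - q"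
        by (simp add: H_def p_def q_def algebra_simps)
      \<comment> \<open>The difference of the two sides is the square of
        \<open>2 * p - q\<close>.\<close>
      have "q\<^sup>2 \<le> 2 * p\<^sup>2 + 2 * (p - q)\<^sup>2"
        using zero_le_power2[of "2 * p - q"] by (simp add: power2_eq_square algebra_simps)
      then have "ennreal (q\<^sup>2) \<le> ennreal (2 * p\<^sup>2 + 2 * (p - q)\<^sup>2)" by (rule ennreal_leI)
      also have "\<dots> = ennreal 2 * ennreal (p\<^sup>2) + ennreal 2 * ennreal ((p - q)\<^sup>2)"
        by (simp add: ennreal_plus ennreal_mult)
      finally have "ennreal (q\<^sup>2) * indicator (ball 0 1) z
          \<le> ennreal 2 * (ennreal (p\<^sup>2) * indicator (ball 0 1) z) + ennreal 2 * (ennreal ((p - q)\<^sup>2) * indicator (ball 0 1) z)"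
        by (simp add: indicator_def)
      then show "ennreal ((H u (c + R0 *\<^sub>R sgn z))\<^sup>2) * indicator (ball 0 1) z
          \<le> ennreal 2 * (ennreal ((H (\<phi> n) (c + R0 *\<^sub>R sgn z))\<^sup>2) * indicator (ball 0 1) z)
            + ennreal 2 * (ennreal ((H (\<lambda>x. \<phi> n x - u x) (c + R0 *\<^sub>R sgn z))\<^sup>2) * indicator (ball 0 1) z)"
        unfolding pq p_def q_def .
    qed
    also have "\<dots> = ennreal 2 * J (H (\<phi> n)) + ennreal 2 * J (H (\<lambda>x. \<phi> n x - u x))"
    proof -
      have m: "(\<lambda>z. ennreal ((H f (c + R0 *\<^sub>R sgn z))\<^sup>2) * indicator (ball 0 1) z) \<in> borel_measurable lborel"
        if "continuous_on (closure \<Omega>) f" for f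
        using Jm[OF that] by simp
      note m1 = m[OF ext(2)[OF \<phi>[of n]]]
        and m2 = m[OF continuous_on_diff[OF ext(2)[OF \<phi>[of n]] ext(2)[OF u]]]
      show ?thesis
        unfolding J_def nn_integral_cmult[OF m1, symmetric] nn_integral_cmult[OF m2, symmetric]
        by (rule nn_integral_add) (intro borel_measurable_times_ennreal m1 m2 borel_measurable_const)+
    qed
    also have "\<dots> = ennreal 2 * J (\<phi> n) + ennreal 2 * J (\<lambda>x. \<phi> n x - u x)"
      by (simp only: JH[symmetric])
    also have "\<dots> \<le> ennreal 2 * ennreal (t n) + ennreal 2 * ennreal (C * h n / E)"
      unfolding J\<phi> by (intro add_left_mono mult_left_mono Jdiff) simp
    also have "\<dots> = ennreal (2 * t n + 2 * (C * h n / E))"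
    proof -
      have X: "0 \<le> C * h n / E" using h0[of n] C E by simp
      have "ennreal (2 * t n + 2 * (C * h n / E)) = ennreal (2 * t n) + ennreal (2 * (C * h n / E))"
        using t0[of n] X by (intro ennreal_plus) auto
      also have "\<dots> = ennreal 2 * ennreal (t n) + ennreal 2 * ennreal (C * h n / E)"
        using ennreal_mult[of 2 "t n"] ennreal_mult[of 2 "C * h n / E"] t0[of n] X by simp
      finally show ?thesis by (rule sym)
    qed
    finally show ?thesis .
  qed
  have lim: "(\<lambda>n. ennreal (2 * t n + 2 * (C * h n / E))) \<longlonglongrightarrow> ennreal (2 * (0 / D) + 2 * (C * 0 / E))"
    unfolding t_def h_def
    by (intro tendsto_ennrealI tendsto_intros tr0 dist0) (use E R0 in \<open>auto simp: D_def\<close>)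
  have "J u \<le> ennreal (2 * (0 / D) + 2 * (C * 0 / E))"
    by (rule LIMSEQ_le_const[OF lim]) (use bound in blast)
  then have "J u \<le> 0" by simp
  then have "J (H u) = 0" by (simp add: JH[symmetric])
  then have "AE z in lborel. ennreal ((H u (c + R0 *\<^sub>R sgn z))\<^sup>2) * indicator (ball 0 1) z = 0"
    unfolding J_def using Jm[OF ext(2)[OF u]] by (subst (asm) nn_integral_0_iff_AE) auto
  then have "AE z in lborel. z \<in> ball 0 1 - {0} \<longrightarrow> u (c + R0 *\<^sub>R sgn z) = 0"
  proof eventually_elim
    case (elim z)
    show ?case
    proof
      assume z: "z \<in> ball 0 1 - {0}"
      then have "(H u (c + R0 *\<^sub>R sgn z))\<^sup>2 = 0" using elim by (simp add: ennreal_eq_0_iff)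
      then show "u (c + R0 *\<^sub>R sgn z) = 0" using HT[of z u] z by simp
    qed
  qed
  then have AE: "AE z in lebesgue. z \<in> ball 0 1 - {0} \<longrightarrow> u (c + R0 *\<^sub>R sgn z) = 0"
    by (rule AE_completion)
  have cont: "continuous_on (ball 0 1 - {0}) (\<lambda>z. u (c + R0 *\<^sub>R sgn z))"
  proof (rule continuous_on_compose2[OF continuous_on_subset[OF ext(2)[OF u] sph_cl]])
    show "continuous_on (ball 0 1 - {0}) (\<lambda>z. c + R0 *\<^sub>R sgn z)"
      by (intro continuous_intros) auto
    show "(\<lambda>z. c + R0 *\<^sub>R sgn z) ` (ball 0 1 - {0}) \<subseteq> sphere c R0"
      using R0 by (auto simp: dist_norm norm_sgn split: if_splits)
  qed
  \<comment> \<open>A point of the punctured unit ball, with norm 1 / 2, whose direction is that of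
    \<open>y - c\<close>.\<close>
  define z where "z = (1 / (2 * R0)) *\<^sub>R (y - c)"
  have nz: "norm z = 1 / 2" using y R0 by (simp add: z_def)
  have "open (ball (0::'a) 1 - {0})" by (intro open_Diff) auto
  from AE_zero_imp_zero[OF this cont AE, of z] have "u (c + R0 *\<^sub>R sgn z) = 0" using nz norm_zero by fastforce
  moreover have "c + R0 *\<^sub>R sgn z = y"
    unfolding sgn_div_norm nz unfolding z_def using R0 by simp
  ultimately show ?thesis by simp
qed

section \<open>The Neumann condition\<close>

lemma continuous_closure_set_integrable:
  fixes f :: "'a::euclidean_space \<Rightarrow> 'b::euclidean_space"
  assumes "open \<Omega>" "bounded \<Omega>" "continuous_on (closure \<Omega>) f"
  shows "set_integrable lebesgue \<Omega> f"
proof -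
  have "compact (closure \<Omega>)" using assms(2) by (simp add: compact_closure)
  then have "bounded (f ` closure \<Omega>)" using assms(3) by (intro compact_imp_bounded compact_continuous_image)
  then obtain M where "\<forall>v\<in>f ` closure \<Omega>. norm v \<le> M" unfolding bounded_iff by blast
  then have "norm (f x) \<le> M" if "x \<in> \<Omega>" for x using that closure_subset by blast
  with assms(1,2) continuous_on_subset[OF assms(3) closure_subset] show ?thesis
    by (rule bounded_continuous_set_integrable(2))
qed

lemma flat_nonneg: "0 \<le> flat n t"
  by (simp add: flat_def)

lemma continuous_on_flat [continuous_intros]:
  "continuous_on S f \<Longrightarrow> continuous_on S (\<lambda>x. flat n (f x))"
proof -
  have "continuous_on UNIV (flat n)"
    using DERIV_flat DERIV_isCont by (intro continuous_at_imp_continuous_on) blast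
  then show "continuous_on S f \<Longrightarrow> continuous_on S (\<lambda>x. flat n (f x))"
    by (rule continuous_on_compose2) auto
qed

text \<open>The cone over a small cap around \<open>y\<close> loses exactly its copy scaled by
  \<open>q\<close> when the part below radius \<open>q * R1\<close> is removed, and
  \<open>1 - q ^ DIM('a) >= 1 - q\<close>. The volume of a thin boundary layer near \<open>y\<close>
  is thus at least proportional to its thickness, in place of a surface integral.\<close>

lemma cone_shell_measure:
  fixes y :: "'a::euclidean_space"
  assumes R1: "0 < R1" and y: "norm y = R1" and \<epsilon>: "0 < \<epsilon>"
  defines "C \<equiv> {x. x \<noteq> 0 \<and> norm x < R1 \<and> norm ((R1 / norm x) *\<^sub>R x - y) < \<epsilon>}"
  obtains \<mu> where "0 < \<mu>" "\<And>q. 0 < q \<Longrightarrow> q < 1 \<Longrightarrow> C \<inter> {x. q * R1 \<le> norm x} \<in> lmeasurable \<and>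
    \<mu> * (1 - q) \<le> measure lebesgue (C \<inter> {x. q * R1 \<le> norm x})"
proof -
  have C_eq: "C = (ball 0 R1 - {0}) \<inter> (\<lambda>x. (R1 / norm x) *\<^sub>R x) -` ball y \<epsilon>"
    by (auto simp: C_def dist_norm norm_minus_commute)
  have opC: "open C" unfolding C_eq
    by (intro continuous_open_preimage continuous_intros open_Diff) auto
  have C: "C \<in> lmeasurable"
  proof (rule lmeasurable_open[OF _ opC])
    show "bounded C" by (rule bounded_subset[OF bounded_ball[of 0 R1]]) (auto simp: C_def)
  qed
  have "(1 / 2) *\<^sub>R y \<in> C" using R1 y \<epsilon> by (auto simp: C_def)
  then have "\<not> negligible C" using open_not_negligible[OF opC] by blast
  then have \<mu>: "0 < measure lebesgue C"
    using C by (metis negligible_iff_measure zero_less_measure_iff)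
  show ?thesis
  proof (rule that[OF \<mu>], intro conjI)
    fix q :: real assume q: "0 < q" "q < 1"
    let ?E = "C \<inter> {x. q * R1 \<le> norm x}"
    have img: "(\<lambda>x. q *\<^sub>R x + 0) ` C = C \<inter> {x. norm x < q * R1}"
    proof (intro set_eqI iffI)
      fix x assume "x \<in> (\<lambda>x. q *\<^sub>R x + 0) ` C"
      then obtain z where z: "z \<in> C" "x = q *\<^sub>R z" by auto
      have "q * norm z < 1 * R1" using z(1) q by (intro mult_strict_mono) (auto simp: C_def)
      then show "x \<in> C \<inter> {x. norm x < q * R1}" using z q by (simp add: C_def)
    next
      fix x assume x: "x \<in> C \<inter> {x. norm x < q * R1}"
      have "(1 / q) *\<^sub>R x \<in> C" using x q by (simp add: C_def field_simps)
      moreover have "x = q *\<^sub>R ((1 / q) *\<^sub>R x) + 0" using q by simp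
      ultimately show "x \<in> (\<lambda>x. q *\<^sub>R x + 0) ` C" by (rule rev_image_eqI)
    qed
    have inner: "measure lebesgue (C \<inter> {x. norm x < q * R1}) = q ^ DIM('a) * measure lebesgue C"
      using measure_lebesgue_affine[of q 0 C] q unfolding img by simp
    have meas: "C \<inter> {x. norm x < q * R1} \<in> lmeasurable"
    proof -
      have "C \<inter> {x. norm x < q * R1} = C \<inter> ball 0 (q * R1)" by auto
      then show ?thesis using C by (simp add: fmeasurable.Int)
    qed
    have E_eq: "?E = C - (C \<inter> {x. norm x < q * R1})" by auto
    show "?E \<in> lmeasurable" unfolding E_eq using C meas by (rule fmeasurable.Diff)
    have "measure lebesgue ?E = measure lebesgue C - q ^ DIM('a) * measure lebesgue C"
      unfolding E_eq inner[symmetric] using C meas by (intro measurable_measure_Diff) auto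
    moreover have "q ^ DIM('a) \<le> q ^ 1" using q by (intro power_decreasing) auto
    then have "q ^ DIM('a) * measure lebesgue C \<le> q * measure lebesgue C"
      using \<mu> by (intro mult_right_mono) auto
    ultimately show "measure lebesgue C * (1 - q) \<le> measure lebesgue ?E" by (simp add: algebra_simps)
  qed
qed

text \<open>If \<open>G y \<bullet> y\<close> had a sign, testing with a bump at \<open>y\<close>
  times a cutoff to a thin layer at the outer sphere would give a contradiction: the term with the
  differentiated cutoff stays away from 0, its size compensating the shrinking volume, while all
  other terms tend to 0.\<close>

lemma neumann_condition:
  fixes c :: "'a::euclidean_space"
  assumes R0: "0 < R0" and cR: "norm c + R0 < R1" and \<Omega>: "\<Omega> = annular_domain R0 R1 c"
    and u: "mixed_eigenfunction R0 R1 c \<tau> u" "u \<in> C1_closure \<Omega>"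
    and G: "continuous_on (closure \<Omega>) G" "\<And>x. x \<in> \<Omega> \<Longrightarrow> G x = grad u x"
    and y: "norm y = R1"
  shows "G y \<bullet> y = 0"
proof -
  note ob = open_bounded_annular_domain[OF R0, of R1 c, folded \<Omega>]
  have cl: "closure \<Omega> = cball 0 R1 - ball c R0" unfolding \<Omega> by (rule closure_annular_domain[OF R0 cR])
  have \<Omega>_iff: "x \<in> \<Omega> \<longleftrightarrow> norm x < R1 \<and> R0 < norm (x - c)" for x
    unfolding \<Omega> annular_domain_eq[OF R0] by (auto simp: dist_norm norm_minus_commute)
  have R1: "0 < R1" using R0 cR norm_ge_zero[of c] by linarith
  have uc: "continuous_on (closure \<Omega>) u" using u(2) by (simp add: C1_closure_def)
  have y_far: "R0 < norm (y - c)" using norm_triangle_ineq2[of y c] y cR by linarith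
  then have ycl: "y \<in> closure \<Omega>" unfolding cl using y by (simp add: dist_norm norm_minus_commute)
  \<comment> \<open>The factor \<sigma> treats both signs at once; it is used with 1 and -1.\<close>
  have not_pos: "\<not> 0 < \<sigma> * (G y \<bullet> y)" for \<sigma>
  proof
    assume pos: "0 < \<sigma> * (G y \<bullet> y)"
    define \<kappa> where "\<kappa> = \<sigma> * (G y \<bullet> y) / 2"
    have \<kappa>: "0 < \<kappa>" using pos by (simp add: \<kappa>_def)
    have "continuous_on (closure \<Omega>) (\<lambda>x. \<sigma> * (G x \<bullet> x))" by (intro continuous_intros G)
    then obtain \<rho>1 where \<rho>1: "0 < \<rho>1" "\<And>x. x \<in> closure \<Omega> \<Longrightarrow> dist x y < \<rho>1 \<Longrightarrow> dist (\<sigma> * (G x \<bullet> x)) (\<sigma> * (G y \<bullet> y)) < \<kappa>"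
      using ycl \<kappa> unfolding continuous_on_iff by blast
    define \<rho> where "\<rho> = min \<rho>1 (norm (y - c) - R0)"
    have \<rho>: "0 < \<rho>" using \<rho>1 y_far by (simp add: \<rho>_def)
    have lower: "\<kappa> \<le> \<sigma> * (G x \<bullet> x)" if "x \<in> \<Omega>" "norm (x - y) < \<rho>" for x
    proof -
      have "dist (\<sigma> * (G x \<bullet> x)) (\<sigma> * (G y \<bullet> y)) < \<kappa>"
        using that closure_subset by (intro \<rho>1(2)) (auto simp: \<rho>_def dist_norm)
      then show ?thesis unfolding dist_real_def \<kappa>_def by linarith
    qed
    have far: "R0 < norm (x - c)" if "norm (x - y) < \<rho>" for x
    proof -
      have "norm (y - c) \<le> norm (y - x) + norm (x - c)" using norm_triangle_ineq[of "y - x" "x - c"] by simp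
      then show ?thesis using that by (simp add: \<rho>_def norm_minus_commute)
    qed
    \<comment> \<open>A bump of radius \<rho> about \<open>y\<close>. Since \<open>flat 2\<close> is
      the derivative of \<open>flat 0\<close>, its gradient is \<open>- 2 * Q x\<close> times
      \<open>x - y\<close>.\<close>
    define P where "P x = flat 0 (\<rho>\<^sup>2 - (norm (x - y))\<^sup>2)" for x
    define Q where "Q x = flat 2 (\<rho>\<^sup>2 - (norm (x - y))\<^sup>2)" for x
    have P0: "P x = 0" if "\<not> norm (x - y) < \<rho>" for x
    proof -
      have "\<rho>\<^sup>2 \<le> (norm (x - y))\<^sup>2" using that \<rho> by (intro power_mono) auto
      then show ?thesis by (simp add: P_def flat_def)
    qed
    have cP: "continuous_on S P" "continuous_on S Q" for S
      unfolding P_def Q_def by (intro continuous_intros)+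
    define h where "h j = inverse (real (Suc j)) / 2" for j
    have h: "0 < h j" "h j \<le> 1 / 2" for j by (auto simp: h_def field_simps)
    have h0: "h \<longlonglongrightarrow> 0"
      unfolding h_def using tendsto_divide[OF LIMSEQ_inverse_real_of_nat tendsto_const[of 2]] by simp
    define q where "q j = 1 - h j" for j
    have q: "0 < q j" "q j < 1" for j using h[of j] by (auto simp: q_def)
    define w where "w j = 1 - (q j)\<^sup>2" for j
    have w: "0 < w j" for j using q[of j] by (simp add: w_def power_less_one_iff abs_square_less_1)
    define n where "n j = 1 / (2 * R1\<^sup>2 * w j)" for j
    have n: "0 < n j" for j using w[of j] R1 by (simp add: n_def)
    \<comment> \<open>Equals 1 on the outer sphere, 1 / 2 at \<open>norm x = q j * R1\<close>, and 0
      where \<open>(norm x)^2 = R1^2 * (1 - 2 * w j)\<close>. Hence \<open>flat 0 (B j x)\<close> is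
      a cutoff to a layer of thickness of order \<open>h j\<close>.\<close>
    define B where "B j x = 1 + n j * ((norm x)\<^sup>2 - R1\<^sup>2)" for j and x :: 'a
    have cB: "continuous_on S (\<lambda>x. flat m (B j x))" for S m j
      unfolding B_def by (intro continuous_intros)
    define \<phi> where "\<phi> j x = P x * flat 0 (B j x)" for j x
    define \<Phi> where "\<Phi> j x = P x *\<^sub>R ((flat 2 (B j x) * (2 * n j)) *\<^sub>R x) - flat 0 (B j x) *\<^sub>R ((2 * Q x) *\<^sub>R (x - y))" for j x
    have D: "GDERIV (\<phi> j) x :> \<Phi> j x" for j x
    proof -
      have D0: "(flat 0 has_real_derivative flat 2 t) (at t)" for t using DERIV_flat[of 0 t] by (simp add: numeral_2_eq_2)
      have dsq: "GDERIV (\<lambda>x. (norm (x - p))\<^sup>2) x :> 2 *\<^sub>R (x - p)" for p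
        by (rule has_laplacian_imp_GDERIV[OF has_laplacian_dist_sq])
      have "GDERIV (\<lambda>x. \<rho>\<^sup>2 - (norm (x - y))\<^sup>2) x :> 0 - 2 *\<^sub>R (x - y)"
        by (rule GDERIV_diff[OF GDERIV_const dsq])
      from GDERIV_DERIV_compose[OF this D0]
      have dP: "GDERIV P x :> (- 2 * Q x) *\<^sub>R (x - y)" by (simp add: P_def[abs_def] Q_def mult.commute)
      have "GDERIV (\<lambda>x. 1 + n j * ((norm (x - 0))\<^sup>2 - R1\<^sup>2)) x :> 0 + (n j *\<^sub>R (2 *\<^sub>R (x - 0) - 0) + ((norm (x - 0))\<^sup>2 - R1\<^sup>2) *\<^sub>R 0)"
        by (intro GDERIV_add GDERIV_mult GDERIV_diff GDERIV_const dsq)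
      then have "GDERIV (B j) x :> (2 * n j) *\<^sub>R x" by (simp add: B_def[abs_def] mult.commute)
      from GDERIV_DERIV_compose[OF this D0]
      have dB: "GDERIV (\<lambda>x. flat 0 (B j x)) x :> (flat 2 (B j x) * (2 * n j)) *\<^sub>R x" by simp
      show ?thesis
        unfolding \<phi>_def[abs_def] \<Phi>_def by (rule GDERIV_subst[OF GDERIV_mult[OF dP dB]]) simp
    qed
    have c\<Phi>: "continuous_on UNIV (\<Phi> j)" for j
      unfolding \<Phi>_def[abs_def] by (intro continuous_intros cP cB)
    \<comment> \<open>The weak equation is split: \<open>I j\<close> collects the terms in which the
      cutoff is differentiated, with the large factor \<open>n j\<close>; everything else is the
      cutoff times \<open>k\<close>, which does not depend on \<open>j\<close>.\<close>
    define k where "k x = \<tau> * (u x * P x) + 2 * Q x * (G x \<bullet> (x - y))" for x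
    have ck: "continuous_on (closure \<Omega>) k" unfolding k_def by (intro continuous_intros uc G cP)
    define I where "I j x = P x * (flat 2 (B j x) * (2 * n j)) * (G x \<bullet> x)" for j x
    have cI: "continuous_on (closure \<Omega>) (I j)" for j
      unfolding I_def by (intro continuous_intros G cP cB)
    have weak: "(LINT x:\<Omega>|lebesgue. I j x) = (LINT x:\<Omega>|lebesgue. flat 0 (B j x) * k x)" for j
    proof -
      have "\<phi> j \<in> C1_closure \<Omega>" using D c\<Phi> by (rule C1_imp_C1_closure)
      moreover have "\<phi> j x = 0" if "x \<in> sphere c R0" for x
        using far[of x] P0[of x] that by (auto simp: \<phi>_def dist_norm norm_minus_commute)
      ultimately have "(LINT x:\<Omega>|lebesgue. grad u x \<bullet> grad (\<phi> j) x) = \<tau> * (LINT x:\<Omega>|lebesgue. u x * \<phi> j x)"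
        by (rule mixed_eigenfunction_weak_form[OF R0 \<Omega> u])
      moreover have "(LINT x:\<Omega>|lebesgue. grad u x \<bullet> grad (\<phi> j) x) = (LINT x:\<Omega>|lebesgue. G x \<bullet> \<Phi> j x)"
        using G(2) grad_eq[OF D] ob(1) by (intro set_lebesgue_integral_cong) auto
      moreover have "(LINT x:\<Omega>|lebesgue. G x \<bullet> \<Phi> j x)
          = (LINT x:\<Omega>|lebesgue. I j x) - (LINT x:\<Omega>|lebesgue. flat 0 (B j x) * (2 * Q x * (G x \<bullet> (x - y))))"
      proof -
        have "set_integrable lebesgue \<Omega> (I j)" by (rule continuous_closure_set_integrable[OF ob cI])
        moreover have "set_integrable lebesgue \<Omega> (\<lambda>x. flat 0 (B j x) * (2 * Q x * (G x \<bullet> (x - y))))"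
          by (intro continuous_closure_set_integrable[OF ob] continuous_intros G cP cB)
        moreover have "(LINT x:\<Omega>|lebesgue. G x \<bullet> \<Phi> j x)
            = (LINT x:\<Omega>|lebesgue. I j x - flat 0 (B j x) * (2 * Q x * (G x \<bullet> (x - y))))"
          by (simp add: \<Phi>_def I_def inner_diff_right algebra_simps)
        ultimately show ?thesis by (simp add: set_integral_diff)
      qed
      moreover have "(LINT x:\<Omega>|lebesgue. flat 0 (B j x) * k x) = (LINT x:\<Omega>|lebesgue. \<tau> * (u x * \<phi> j x))
          + (LINT x:\<Omega>|lebesgue. flat 0 (B j x) * (2 * Q x * (G x \<bullet> (x - y))))"
      proof -
        have "(LINT x:\<Omega>|lebesgue. flat 0 (B j x) * k x) = (LINT x:\<Omega>|lebesgue. \<tau> * (u x * \<phi> j x)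
            + flat 0 (B j x) * (2 * Q x * (G x \<bullet> (x - y))))"
          by (simp add: k_def \<phi>_def algebra_simps)
        also have "\<dots> = (LINT x:\<Omega>|lebesgue. \<tau> * (u x * \<phi> j x))
          + (LINT x:\<Omega>|lebesgue. flat 0 (B j x) * (2 * Q x * (G x \<bullet> (x - y))))"
          by (rule set_integral_add(2))
             (unfold \<phi>_def, (intro continuous_closure_set_integrable[OF ob] continuous_intros G uc cP cB)+)
        finally show ?thesis .
      qed
      ultimately show ?thesis by simp
    qed
    have lim: "(\<lambda>j. LINT x:\<Omega>|lebesgue. flat 0 (B j x) * k x) \<longlonglongrightarrow> (LINT x:\<Omega>|lebesgue. 0)"
      unfolding set_lebesgue_integral_def
    proof (rule integral_dominated_convergence[where w = "\<lambda>x. norm (indicat_real \<Omega> x *\<^sub>R k x)"])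
      have "set_integrable lebesgue \<Omega> k" by (rule continuous_closure_set_integrable[OF ob ck])
      then show "integrable lebesgue (\<lambda>x. norm (indicat_real \<Omega> x *\<^sub>R k x))"
        unfolding set_integrable_def by (rule integrable_norm)
      show "(\<lambda>x. indicat_real \<Omega> x *\<^sub>R (flat 0 (B j x) * k x)) \<in> borel_measurable lebesgue" for j
        using continuous_closure_set_integrable[OF ob continuous_on_mult[OF cB[where j = j] ck]]
        unfolding set_integrable_def by (rule borel_measurable_integrable)
      show "AE x in lebesgue. norm (indicat_real \<Omega> x *\<^sub>R (flat 0 (B j x) * k x)) \<le> norm (indicat_real \<Omega> x *\<^sub>R k x)" for j
      proof (rule AE_I2)
        fix x
        have "\<bar>flat 0 (B j x)\<bar> \<le> 1" by (simp add: flat_def)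
        then have "\<bar>flat 0 (B j x)\<bar> * \<bar>k x\<bar> \<le> 1 * \<bar>k x\<bar>" by (rule mult_right_mono) simp
        then show "norm (indicat_real \<Omega> x *\<^sub>R (flat 0 (B j x) * k x)) \<le> norm (indicat_real \<Omega> x *\<^sub>R k x)"
          by (simp add: indicator_def abs_mult)
      qed
      show "AE x in lebesgue. (\<lambda>j. indicat_real \<Omega> x *\<^sub>R (flat 0 (B j x) * k x)) \<longlonglongrightarrow> indicat_real \<Omega> x *\<^sub>R 0"
      proof (rule AE_I2)
        fix x
        show "(\<lambda>j. indicat_real \<Omega> x *\<^sub>R (flat 0 (B j x) * k x)) \<longlonglongrightarrow> indicat_real \<Omega> x *\<^sub>R 0"
        proof (cases "x \<in> \<Omega>")
          case True
          then have "(norm x)\<^sup>2 < R1\<^sup>2" by (simp add: \<Omega>_iff power_strict_mono)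
          then have e: "0 < (R1\<^sup>2 - (norm x)\<^sup>2) / (2 * R1\<^sup>2)" using R1 by simp
          have "w \<longlonglongrightarrow> 1 - (1 - 0)\<^sup>2" unfolding w_def q_def by (intro tendsto_intros h0)
          then have "w \<longlonglongrightarrow> 0" by simp
          \<comment> \<open>Every interior point eventually lies outside the shrinking
            layer.\<close>
          from order_tendstoD(2)[OF this e] have "\<forall>\<^sub>F j in sequentially. B j x \<le> 0"
          proof eventually_elim
            case (elim j)
            then have "2 * R1\<^sup>2 * w j \<le> R1\<^sup>2 - (norm x)\<^sup>2" using R1 by (simp add: field_simps)
            then have "1 \<le> (R1\<^sup>2 - (norm x)\<^sup>2) / (2 * R1\<^sup>2 * w j)" using R1 w[of j] by (simp add: pos_le_divide_eq)
            then show ?case by (simp add: B_def n_def algebra_simps diff_divide_distrib)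
          qed
          then have "\<forall>\<^sub>F j in sequentially. indicat_real \<Omega> x *\<^sub>R (flat 0 (B j x) * k x) = 0"
            by eventually_elim (simp add: flat_def)
          then show ?thesis by (simp add: tendsto_eventually)
        qed simp
      qed
    qed simp
    define CC where "CC = {x. x \<noteq> 0 \<and> norm x < R1 \<and> norm ((R1 / norm x) *\<^sub>R x - y) < \<rho> / 4}"
    obtain \<mu> where \<mu>: "0 < \<mu>" "\<And>q. 0 < q \<Longrightarrow> q < 1 \<Longrightarrow> CC \<inter> {x. q * R1 \<le> norm x} \<in> lmeasurable \<and>
      \<mu> * (1 - q) \<le> measure lebesgue (CC \<inter> {x. q * R1 \<le> norm x})"
      using cone_shell_measure[OF R1 y, of "\<rho> / 4"] \<rho> unfolding CC_def by auto
    \<comment> \<open>A lower bound for \<open>P\<close> on the ball of radius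
      \<open>\<rho> / 2\<close> about \<open>y\<close>. The number \<open>exp (- 2)\<close> bounds
      \<open>flat 2\<close> from below between 1 / 2 and 1.\<close>
    define p0 where "p0 = exp (- 1 / (3 / 4 * \<rho>\<^sup>2))"
    define \<gamma> where "\<gamma> = \<kappa> * (p0 * exp (- 2))"
    have \<gamma>: "0 < \<gamma>" using \<kappa> by (simp add: \<gamma>_def p0_def)
    define E where "E j = CC \<inter> {x. q j * R1 \<le> norm x}" for j
    have EI: "\<gamma> * (2 * n j) * indicat_real (E j) x \<le> indicat_real \<Omega> x *\<^sub>R (\<sigma> * I j x)"
      if hj: "h j * R1 \<le> \<rho> / 4" for j x
    proof (cases "x \<in> E j")
      case True
      then have x: "x \<noteq> 0" "norm x < R1" "norm ((R1 / norm x) *\<^sub>R x - y) < \<rho> / 4" "q j * R1 \<le> norm x"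
        by (auto simp: E_def CC_def)
      have "norm (x - (R1 / norm x) *\<^sub>R x) = R1 - norm x"
      proof -
        have "x - (R1 / norm x) *\<^sub>R x = (1 - R1 / norm x) *\<^sub>R x" by (simp add: algebra_simps)
        then have "norm (x - (R1 / norm x) *\<^sub>R x) = \<bar>1 - R1 / norm x\<bar> * norm x" by simp
        also have "\<dots> = R1 - norm x" using x by (simp add: abs_if field_simps)
        finally show ?thesis .
      qed
      moreover have "norm (x - y) \<le> norm (x - (R1 / norm x) *\<^sub>R x) + norm ((R1 / norm x) *\<^sub>R x - y)"
        using norm_triangle_ineq[of "x - (R1 / norm x) *\<^sub>R x" "(R1 / norm x) *\<^sub>R x - y"] by simp
      moreover have "R1 - norm x \<le> h j * R1" using x(4) by (simp add: q_def algebra_simps)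
      ultimately have xy: "norm (x - y) < \<rho> / 2" using x(3) hj by linarith
      then have x\<rho>: "norm (x - y) < \<rho>" using \<rho> by linarith
      have x\<Omega>: "x \<in> \<Omega>" using far[OF x\<rho>] x(2) by (simp add: \<Omega>_iff)
      have "(norm (x - y))\<^sup>2 \<le> (\<rho> / 2)\<^sup>2" using xy by (intro power_mono) auto
      then have A: "3 / 4 * \<rho>\<^sup>2 \<le> \<rho>\<^sup>2 - (norm (x - y))\<^sup>2" by (simp add: power_divide)
      have "0 < 3 / 4 * \<rho>\<^sup>2" using \<rho> by simp
      then have Z: "0 < \<rho>\<^sup>2 - (norm (x - y))\<^sup>2" using A by linarith
      have "1 / (\<rho>\<^sup>2 - (norm (x - y))\<^sup>2) \<le> 1 / (3 / 4 * \<rho>\<^sup>2)"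
        by (rule divide_left_mono[OF A _ mult_pos_pos[OF Z \<open>0 < 3 / 4 * \<rho>\<^sup>2\<close>]]) simp
      then have "p0 \<le> exp (- (1 / (\<rho>\<^sup>2 - (norm (x - y))\<^sup>2)))" unfolding p0_def by simp
      moreover have "P x = exp (- (1 / (\<rho>\<^sup>2 - (norm (x - y))\<^sup>2)))"
        unfolding P_def flat_def if_P[OF Z] by simp
      ultimately have Pp: "p0 \<le> P x" by simp
      have B1: "1 / 2 \<le> B j x" "B j x \<le> 1"
      proof -
        have "(q j * R1)\<^sup>2 \<le> (norm x)\<^sup>2" using x(4) q[of j] R1 by (intro power_mono) auto
        then have "R1\<^sup>2 - (norm x)\<^sup>2 \<le> R1\<^sup>2 * w j" by (simp add: w_def power_mult_distrib algebra_simps)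
        then have "n j * (R1\<^sup>2 - (norm x)\<^sup>2) \<le> n j * (R1\<^sup>2 * w j)" using n[of j] by simp
        also have "\<dots> = 1 / 2" using R1 w[of j] by (simp add: n_def)
        finally show "1 / 2 \<le> B j x" by (simp add: B_def algebra_simps)
        have "(norm x)\<^sup>2 \<le> R1\<^sup>2" using x(2) by (intro power_mono) auto
        then show "B j x \<le> 1" using n[of j] by (simp add: B_def mult_le_0_iff)
      qed
      have Be: "exp (- 2) \<le> flat 2 (B j x)"
      proof -
        have "exp (- 2) \<le> exp (- 1 / B j x)" using B1 by (simp add: field_simps)
        also have "\<dots> \<le> exp (- 1 / B j x) / (B j x)\<^sup>2"
          using B1 by (simp add: pos_le_divide_eq power_le_one)
        finally show ?thesis using B1 by (simp add: flat_def)
      qed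
      have "\<kappa> * (p0 * exp (- 2)) \<le> (\<sigma> * (G x \<bullet> x)) * (P x * flat 2 (B j x))"
      proof (rule mult_mono)
        show "\<kappa> \<le> \<sigma> * (G x \<bullet> x)" by (rule lower[OF x\<Omega> x\<rho>])
        then show "0 \<le> \<sigma> * (G x \<bullet> x)" using \<kappa> by linarith
        show "p0 * exp (- 2) \<le> P x * flat 2 (B j x)"
          using Pp Be by (intro mult_mono) (auto simp: P_def flat_nonneg)
      qed (simp add: p0_def)
      then have "\<gamma> * (2 * n j) \<le> (\<sigma> * (G x \<bullet> x)) * (P x * flat 2 (B j x)) * (2 * n j)"
        unfolding \<gamma>_def using n[of j] by (intro mult_right_mono) auto
      then show ?thesis using True x\<Omega> by (simp add: I_def mult_ac)
    next
      case False
      have "0 \<le> \<sigma> * I j x" if "x \<in> \<Omega>"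
      proof (cases "norm (x - y) < \<rho>")
        case True
        have "0 \<le> (\<sigma> * (G x \<bullet> x)) * (P x * (flat 2 (B j x) * (2 * n j)))"
        proof (rule mult_nonneg_nonneg)
          show "0 \<le> \<sigma> * (G x \<bullet> x)" using lower[OF that True] \<kappa> by linarith
          show "0 \<le> P x * (flat 2 (B j x) * (2 * n j))"
            using n[of j] by (intro mult_nonneg_nonneg) (auto simp: P_def flat_nonneg)
        qed
        then show ?thesis by (simp add: I_def mult_ac)
      qed (simp add: I_def P0)
      then show ?thesis using False by (simp add: indicator_def)
    qed
    have bound: "\<gamma> * \<mu> / (2 * R1\<^sup>2) \<le> \<sigma> * (LINT x:\<Omega>|lebesgue. I j x)" if hj: "h j * R1 \<le> \<rho> / 4" for j
    proof -
      have E: "E j \<in> lmeasurable" "\<mu> * (1 - q j) \<le> measure lebesgue (E j)"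
        using \<mu>(2)[OF q(1)[of j] q(2)[of j]] by (auto simp: E_def)
      \<comment> \<open>The slope of the cutoff times the relative thickness of the layer stays
        bounded below, as \<open>w j = (1 - q j) * (1 + q j)\<close> is at most
        \<open>2 * (1 - q j)\<close>.\<close>
      have "1 / (2 * R1\<^sup>2) \<le> 2 * n j * (1 - q j)"
      proof -
        have "w j = (1 - q j) * (1 + q j)" by (simp add: w_def power2_eq_square algebra_simps)
        also have "\<dots> \<le> (1 - q j) * 2" using q[of j] by (intro mult_left_mono) auto
        finally have "w j \<le> 2 * (1 - q j)" by simp
        then have "1 \<le> 2 * (1 - q j) / w j" using w[of j] by (simp add: pos_le_divide_eq)
        then have "1 / (2 * R1\<^sup>2) * 1 \<le> 1 / (2 * R1\<^sup>2) * (2 * (1 - q j) / w j)"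
          by (rule mult_left_mono) simp
        also have "\<dots> = 2 * n j * (1 - q j)" using R1 w[of j] by (simp add: n_def field_simps)
        finally show ?thesis by simp
      qed
      then have "\<gamma> * \<mu> * (1 / (2 * R1\<^sup>2)) \<le> \<gamma> * \<mu> * (2 * n j * (1 - q j))"
        using \<gamma> \<mu> by (intro mult_left_mono) auto
      also have "\<dots> = \<gamma> * (2 * n j) * (\<mu> * (1 - q j))" by simp
      also have "\<dots> \<le> \<gamma> * (2 * n j) * measure lebesgue (E j)"
        using E(2) \<gamma> n[of j] by (intro mult_left_mono) auto
      also have "\<dots> = (LINT x|lebesgue. \<gamma> * (2 * n j) * indicat_real (E j) x)"
        using E(1) by (simp add: fmeasurable_def)
      also have "\<dots> \<le> (LINT x|lebesgue. indicat_real \<Omega> x *\<^sub>R (\<sigma> * I j x))"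
      proof (rule integral_mono)
        show "integrable lebesgue (\<lambda>x. \<gamma> * (2 * n j) * indicat_real (E j) x)"
          by (intro integrable_mult_right integrable_indicator_lmeasurable E(1))
        have "continuous_on (closure \<Omega>) (\<lambda>x. \<sigma> * I j x)" by (intro continuous_intros cI)
        from continuous_closure_set_integrable[OF ob this]
        show "integrable lebesgue (\<lambda>x. indicat_real \<Omega> x *\<^sub>R (\<sigma> * I j x))" by (simp add: set_integrable_def)
      qed (rule EI[OF hj])
      also have "\<dots> = \<sigma> * (LINT x:\<Omega>|lebesgue. I j x)"
        unfolding set_lebesgue_integral_def[symmetric] by (rule set_integral_mult_right)
      finally show ?thesis by simp
    qed
    have "(\<lambda>j. \<sigma> * (LINT x:\<Omega>|lebesgue. I j x)) \<longlonglongrightarrow> \<sigma> * (LINT x:\<Omega>|lebesgue. (0::real))"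
      unfolding weak by (intro tendsto_intros lim)
    then have lim0: "(\<lambda>j. \<sigma> * (LINT x:\<Omega>|lebesgue. I j x)) \<longlonglongrightarrow> 0" by (simp add: set_lebesgue_integral_def)
    have "0 < \<rho> / 4 / R1" using \<rho> R1 by simp
    from order_tendstoD(2)[OF h0 this]
    have "\<forall>\<^sub>F j in sequentially. \<gamma> * \<mu> / (2 * R1\<^sup>2) \<le> \<sigma> * (LINT x:\<Omega>|lebesgue. I j x)"
      by eventually_elim (use R1 in \<open>auto intro!: bound simp: pos_less_divide_eq less_imp_le\<close>)
    then have "\<gamma> * \<mu> / (2 * R1\<^sup>2) \<le> 0"
      by (rule tendsto_lowerbound[OF lim0]) simp
    moreover have "0 < \<gamma> * \<mu> / (2 * R1\<^sup>2)" using \<gamma> \<mu> R1 by simp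
    ultimately show False by simp
  qed
  show ?thesis using not_pos[of 1] not_pos[of "-1"] by simp
qed

section \<open>The theorem\<close>

lemma has_laplacian_transform:
  assumes "has_laplacian f F L x" "open S" "x \<in> S" "\<And>y. y \<in> S \<Longrightarrow> F y = G y"
  shows "has_laplacian f G L x"
proof -
  from assms(1) obtain H where H: "(F has_derivative H) (at x)" "(\<Sum>b\<in>Basis. H b \<bullet> b) = L"
    and ev: "\<forall>\<^sub>F y in nhds x. GDERIV f y :> F y"
    unfolding has_laplacian_def by blast
  have "(G has_derivative H) (at x)"
    using H(1) assms(2-4) by (rule has_derivative_transform_within_open)
  moreover have "\<forall>\<^sub>F y in nhds x. GDERIV f y :> G y"
    using ev eventually_nhds_in_open[OF assms(2,3)] by eventually_elim (simp add: assms(4))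
  ultimately show ?thesis using H(2) unfolding has_laplacian_def by blast
qed

text \<open>Every point in the closure of an open set is a limit point of it, so the limit that
  defines the boundary gradient is unique.\<close>

lemma grad_closure_eq:
  assumes \<Omega>: "open \<Omega>" and G: "continuous_on (closure \<Omega>) G" "\<And>x. x \<in> \<Omega> \<Longrightarrow> G x = grad u x"
    and x: "x \<in> closure \<Omega>"
  shows "grad_closure \<Omega> u x = G x"
  unfolding grad_closure_def
proof (rule tendsto_Lim)
  have "x islimpt \<Omega>"
    using x \<Omega> interior_limit_point[of x \<Omega>] by (cases "x \<in> \<Omega>") (auto simp: closure_def interior_open)
  then show "\<not> trivial_limit (at x within \<Omega>)" by (simp add: trivial_limit_within)
  have "(G \<longlongrightarrow> G x) (at x within closure \<Omega>)" using G(1) x by (simp add: continuous_on_def)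
  then have "(G \<longlongrightarrow> G x) (at x within \<Omega>)" by (rule tendsto_within_subset[OF _ closure_subset])
  moreover have "\<forall>\<^sub>F y in at x within \<Omega>. G y = grad u y"
    by (auto simp: eventually_at_filter G(2) intro!: always_eventually)
  ultimately show "(grad u \<longlongrightarrow> G x) (at x within \<Omega>)" by (rule Lim_transform_eventually)
qed

theorem theorem4p2:
  fixes R0 R1 s :: real and k :: "'n::finite" and e1 :: "real ^ 'n"
    and \<Omega> :: "(real ^ 'n) set" and u :: "real ^ 'n \<Rightarrow> real"
  assumes "CARD('n) \<ge> 2"
    and "0 < R0" and "R0 < R1" and "0 < s" and "s < R1 - R0"
    and "e1 = axis k 1"
    and "\<Omega> = annular_domain R0 R1 (s *\<^sub>R e1)"
    and "mixed_eigenfunction R0 R1 (s *\<^sub>R e1) (first_mixed_eigenvalue R0 R1 (s *\<^sub>R e1)) u"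
    and "C_k_on 2 u \<Omega>" and "u \<in> C1_closure \<Omega>"
    and "\<And>x. x \<in> \<Omega> \<Longrightarrow> u x > 0"
  shows "(\<forall>x\<in>\<Omega>. \<forall>t>1. s *\<^sub>R e1 + t *\<^sub>R (x - s *\<^sub>R e1) \<in> \<Omega> \<longrightarrow>
            u x < u (s *\<^sub>R e1 + t *\<^sub>R (x - s *\<^sub>R e1))) \<and>
         (\<forall>x \<in> closure \<Omega> - {R1 *\<^sub>R e1, - (R1 *\<^sub>R e1)}.
            grad_closure \<Omega> u x \<bullet> (x - s *\<^sub>R e1) > 0)"
proof -
  note R0 = \<open>0 < R0\<close> and s = \<open>0 < s\<close> and \<Omega> = \<open>\<Omega> = annular_domain R0 R1 (s *\<^sub>R e1)\<close>
    and uC1 = \<open>u \<in> C1_closure \<Omega>\<close> and upos = \<open>\<And>x. x \<in> \<Omega> \<Longrightarrow> u x > 0\<close>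
  define c where "c = s *\<^sub>R e1"
  define \<tau> where "\<tau> = first_mixed_eigenvalue R0 R1 c"
  have eig: "mixed_eigenfunction R0 R1 c \<tau> u"
    using assms(8) by (simp add: c_def \<tau>_def)
  have \<Omega>c: "\<Omega> = annular_domain R0 R1 c" using \<Omega> by (simp add: c_def)
  have ne: "norm e1 = 1" using \<open>e1 = axis k 1\<close> by simp
  have nc: "norm c = s" using s ne by (simp add: c_def)
  have cR: "norm c + R0 < R1" using nc \<open>s < R1 - R0\<close> by simp
  note ob = open_bounded_annular_domain[OF R0, of R1 c, folded \<Omega>c]
  have cl: "closure \<Omega> = cball 0 R1 - ball c R0" unfolding \<Omega>c by (rule closure_annular_domain[OF R0 cR])
  have \<Omega>_eq: "\<Omega> = ball 0 R1 - cball c R0" unfolding \<Omega>c by (rule annular_domain_eq[OF R0])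
  obtain G where G: "continuous_on (closure \<Omega>) G" "\<And>x. x \<in> \<Omega> \<Longrightarrow> G x = grad u x"
    using uC1 unfolding C1_closure_def by blast
  have uc: "continuous_on (closure \<Omega>) u" using uC1 by (simp add: C1_closure_def)
  have "has_trace_on_sphere \<Omega> c R0 u (\<lambda>_. 0)"
    using eig unfolding mixed_eigenfunction_def Let_def H1_zero_on_sphere_def \<Omega>c by blast
  then have inner0: "u x = 0" if "norm (x - c) = R0" for x
    by (rule trace_zero_imp_zero[OF R0 cR \<Omega>c uC1 _ that])
  \<comment> \<open>Testing the eigenfunction with itself yields \<open>0 \<le> \<tau>\<close>, once
    the integral of \<open>u * u\<close> is known to be positive.\<close>
  have energy: "(LINT x:\<Omega>|lebesgue. grad u x \<bullet> grad u x) = \<tau> * (LINT x:\<Omega>|lebesgue. u x * u x)"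
    by (rule mixed_eigenfunction_weak_form[OF R0 \<Omega>c eig uC1 uC1])
       (rule inner0, simp add: dist_norm norm_minus_commute)
  \<comment> \<open>A point on the axis, halfway between the radii \<open>R0\<close> and
    \<open>R1 - s\<close> about \<open>c\<close>; positivity of \<open>u\<close> there makes the
    integral of \<open>u * u\<close> nonzero.\<close>
  define x0 where "x0 = c + ((R0 + (R1 - s)) / 2) *\<^sub>R e1"
  have x0: "x0 \<in> \<Omega>"
  proof -
    have "norm (x0 - c) = (R0 + (R1 - s)) / 2" using R0 cR nc ne by (simp add: x0_def)
    moreover have "norm x0 \<le> norm c + norm (x0 - c)" using norm_triangle_ineq[of c "x0 - c"] by simp
    ultimately show ?thesis using cR nc
      unfolding \<Omega>_eq by (simp add: dist_norm norm_minus_commute field_simps)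
  qed
  have int0: "f x0 = 0" if f: "continuous_on (closure \<Omega>) f" "(LINT x:\<Omega>|lebesgue. f x) = 0" "\<And>x. 0 \<le> f x"
    for f :: "real ^ 'n \<Rightarrow> real"
  proof -
    have "integrable lebesgue (\<lambda>x. indicat_real \<Omega> x *\<^sub>R f x)"
      using continuous_closure_set_integrable[OF ob f(1)] by (simp add: set_integrable_def)
    moreover have "AE x in lebesgue. 0 \<le> indicat_real \<Omega> x *\<^sub>R f x" by (rule AE_I2) (simp add: f(3))
    ultimately have "AE x in lebesgue. indicat_real \<Omega> x *\<^sub>R f x = 0"
      using f(2) unfolding set_lebesgue_integral_def by (simp add: integral_nonneg_eq_0_iff_AE)
    then have "AE x in lebesgue. x \<in> \<Omega> \<longrightarrow> f x = 0" by eventually_elim auto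
    then show ?thesis by (rule AE_zero_imp_zero[OF ob(1) continuous_on_subset[OF f(1) closure_subset] _ x0])
  qed
  have pos: "0 < (LINT x:\<Omega>|lebesgue. u x * u x)"
  proof -
    have "(LINT x:\<Omega>|lebesgue. u x * u x) \<noteq> 0"
      using int0[of "\<lambda>x. u x * u x"] upos[OF x0] uc by (auto intro: continuous_on_mult)
    moreover have "0 \<le> (LINT x:\<Omega>|lebesgue. u x * u x)"
      unfolding set_lebesgue_integral_def by (rule Bochner_Integration.integral_nonneg) simp
    ultimately show ?thesis by simp
  qed
  have "0 \<le> (LINT x:\<Omega>|lebesgue. grad u x \<bullet> grad u x)"
    unfolding set_lebesgue_integral_def by (rule Bochner_Integration.integral_nonneg) simp
  then have \<tau>0: "0 \<le> \<tau>" using pos unfolding energy by (simp add: zero_le_mult_iff)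
  have E: "eccentric_annulus R0 R1 s \<tau> e1 u G"
    unfolding eccentric_annulus_def c_def[symmetric] cl[symmetric] \<Omega>_eq[symmetric]
  proof (intro conjI allI impI)
    show "has_laplacian u G (- \<tau> * u x) x" if "x \<in> \<Omega>" for x
      by (rule has_laplacian_transform[OF mixed_eigenfunction_laplacian[OF R0 \<Omega>c eig uC1 assms(9) that] ob(1) that])
         (simp add: G(2))
    show "G x \<bullet> x = 0" if "norm x = R1" for x
      by (rule neumann_condition[OF R0 cR \<Omega>c eig uC1 G that])
  qed (use R0 s assms(5) ne \<tau>0 uc G(1) upos inner0 in auto)
  have \<Omega>_iff: "x \<in> \<Omega> \<longleftrightarrow> norm x < R1 \<and> R0 < norm (x - c)" for x
    by (auto simp: \<Omega>_eq dist_norm norm_minus_commute)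
  \<comment> \<open>Zero energy makes the gradient vanish in \<Omega>, hence by continuity on the
    inner sphere, where Hopf's lemma makes it nonzero.\<close>
  have "\<tau> \<noteq> 0"
  proof
    assume "\<tau> = 0"
    have G0: "AE x in lebesgue. x \<in> \<Omega> \<longrightarrow> G x = 0"
    proof -
      have cG: "continuous_on (closure \<Omega>) (\<lambda>x. G x \<bullet> G x)" by (intro continuous_intros G(1))
      have "(LINT x:\<Omega>|lebesgue. G x \<bullet> G x) = (LINT x:\<Omega>|lebesgue. grad u x \<bullet> grad u x)"
        using ob(1) by (intro set_lebesgue_integral_cong) (auto simp: G(2))
      then have "(LINT x|lebesgue. indicat_real \<Omega> x *\<^sub>R (G x \<bullet> G x)) = 0"
        unfolding energy using \<open>\<tau> = 0\<close> by (simp add: set_lebesgue_integral_def)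
      moreover have "integrable lebesgue (\<lambda>x. indicat_real \<Omega> x *\<^sub>R (G x \<bullet> G x))"
        using continuous_closure_set_integrable[OF ob cG] by (simp add: set_integrable_def)
      ultimately have "AE x in lebesgue. indicat_real \<Omega> x *\<^sub>R (G x \<bullet> G x) = 0"
        by (subst integral_nonneg_eq_0_iff_AE[symmetric]) auto
      then show ?thesis by eventually_elim auto
    qed
    have "G x = 0" if "x \<in> \<Omega>" for x
      by (rule AE_zero_imp_zero[OF ob(1) continuous_on_subset[OF G(1) closure_subset] G0 that])
    moreover define y where "y = c + R0 *\<^sub>R e1"
    have y: "norm (y - c) = R0" using ne R0 by (simp add: y_def)
    have "norm y \<le> R1" using norm_triangle_ineq[of "y - c" c] y cR by simp
    then have "y \<in> closure \<Omega>" using y by (simp add: cl dist_norm norm_minus_commute)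
    ultimately have "G y = 0" using continuous_constant_on_closure[OF G(1)] by blast
    then show False using eccentric_annulus.grad_inner_pos[OF E, folded c_def, OF y] by simp
  qed
  then have \<tau>: "0 < \<tau>" using \<tau>0 by simp
  have grad_G: "GDERIV u x :> G x" if "x \<in> \<Omega>" for x
    using uC1 that GDERIV_grad[of u x] by (simp add: C1_closure_def G(2))
  note rad = eccentric_annulus.radial_derivative_pos[OF E \<tau>, folded c_def, folded cl]
  show ?thesis
    unfolding c_def[symmetric]
  proof (intro conjI ballI allI impI)
    fix x and t :: real
    assume x: "x \<in> \<Omega>" and t: "1 < t" and z: "c + t *\<^sub>R (x - c) \<in> \<Omega>"
    define p where "p \<theta> = c + \<theta> *\<^sub>R (x - c)" for \<theta>
    \<comment> \<open>\<Omega> is not convex, so the two constraints are treated separately: the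
      distance to \<open>c\<close> grows along the ray, and the large ball is convex.\<close>
    have p\<Omega>: "p \<theta> \<in> \<Omega>" if "1 \<le> \<theta>" "\<theta> \<le> t" for \<theta>
    proof -
      have "norm (p \<theta> - c) = \<theta> * norm (x - c)" using that by (simp add: p_def)
      moreover have "1 * norm (x - c) \<le> \<theta> * norm (x - c)" using that by (intro mult_right_mono) auto
      ultimately have "R0 < norm (p \<theta> - c)" using x by (simp add: \<Omega>_iff)
      moreover have "p \<theta> \<in> ball 0 R1"
      proof -
        have "p \<theta> \<in> closed_segment x (c + t *\<^sub>R (x - c))"
          unfolding in_segment
        proof (intro exI[of _ "(\<theta> - 1) / (t - 1)"] conjI)
          have "c + \<theta> *\<^sub>R w = (1 - l) *\<^sub>R (c + w) + l *\<^sub>R (c + t *\<^sub>R w)" if "\<theta> = 1 - l + l * t" for l w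
            unfolding that by (simp add: algebra_simps)
          moreover have "\<theta> = 1 - l + l * t" if "l = (\<theta> - 1) / (t - 1)" for l
          proof -
            have "l * (t - 1) = \<theta> - 1" using that t by simp
            then show ?thesis by (simp add: algebra_simps)
          qed
          ultimately have "c + \<theta> *\<^sub>R w = (1 - (\<theta> - 1) / (t - 1)) *\<^sub>R (c + w)
              + ((\<theta> - 1) / (t - 1)) *\<^sub>R (c + t *\<^sub>R w)" for w by blast
          from this[of "x - c"]
          show "p \<theta> = (1 - (\<theta> - 1) / (t - 1)) *\<^sub>R x + ((\<theta> - 1) / (t - 1)) *\<^sub>R (c + t *\<^sub>R (x - c))"
            by (simp add: p_def)
        qed (use that t in auto)
        moreover have "closed_segment x (c + t *\<^sub>R (x - c)) \<subseteq> ball 0 R1"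
          using x z by (intro closed_segment_subset) (auto simp: \<Omega>_eq)
        ultimately show ?thesis by blast
      qed
      ultimately show ?thesis by (simp add: \<Omega>_iff)
    qed
    have "u (p 1) < u (p t)"
    proof (rule DERIV_pos_imp_increasing[OF t])
      fix \<theta> assume \<theta>: "1 \<le> \<theta>" "\<theta> \<le> t"
      have "((\<lambda>\<theta>. u (p \<theta>)) has_real_derivative G (p \<theta>) \<bullet> (x - c)) (at \<theta>)"
        using grad_G[OF p\<Omega>[OF \<theta>]] unfolding p_def by (rule GDERIV_along_line)
      moreover have "0 < G (p \<theta>) \<bullet> (x - c)"
      proof -
        have "p \<theta> \<noteq> R1 *\<^sub>R e1" "p \<theta> \<noteq> - (R1 *\<^sub>R e1)"
          using p\<Omega>[OF \<theta>] ne by (auto simp: \<Omega>_iff)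
        then have "0 < G (p \<theta>) \<bullet> (p \<theta> - c)" using p\<Omega>[OF \<theta>] by (intro rad subsetD[OF closure_subset])
        also have "p \<theta> - c = \<theta> *\<^sub>R (x - c)" by (simp add: p_def)
        finally show ?thesis using \<theta> by (simp add: zero_less_mult_iff)
      qed
      ultimately show "\<exists>y. ((\<lambda>\<theta>. u (p \<theta>)) has_real_derivative y) (at \<theta>) \<and> 0 < y" by blast
    qed
    then show "u x < u (c + t *\<^sub>R (x - c))" by (simp add: p_def)
  next
    fix x assume "x \<in> closure \<Omega> - {R1 *\<^sub>R e1, - (R1 *\<^sub>R e1)}"
    then show "0 < grad_closure \<Omega> u x \<bullet> (x - c)"
      using rad[of x] grad_closure_eq[OF ob(1) G] by auto
  qed
qed

end
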